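(* Consider the strictly hyperbolic Cauchy problem described in the context, with characteristic roots $\tau_1(\xi),\dots,\tau_m(\xi)$ and amplitudes $A_j^k(t,\xi)$. Assume that the roots $\tau_1(\xi),\dots,\tau_L(\xi)$ coincide in a set contained in $\mathcal M\subset\mathbb R^n$, that is $\{\xi:\tau_1(\xi)=\dots=\tau_L(\xi)\}\subset\mathcal M$, and that, for some $\varepsilon>0$, they do not intersect the other roots $\tau_{L+1}(\xi),\dots,\tau_m(\xi)$ in the set $\mathcal M^\varepsilon=\{\xi\in\mathbb R^n:\operatorname{dist}(\xi,\mathcal M)<\varepsilon\}$. Let $\chi\in C_0^\infty(\mathcal M^\varepsilon)$. Assume that there exists $\delta>0$ such that $\operatorname{Im}\tau_k(\xi)\ge\delta$ for all $\xi\in\mathcal M^\varepsilon$ and $k=1,\dots,L$. Then for all $t\ge0$ we have $$\Big\|D_t^rD_x^\alpha\Big(\int_{\mathcal M^\varepsilon}e^{ix\cdot\xi}\Big(\sum_{k=1}^Le^{i\tau_k(\xi)t}A_j^k(t,\xi)\Big)\chi(\xi)\widehat f(\xi)\,d\xi\Big)\Big\|_{L^q(\mathbb R^n_x)}\le C(1+t)^{L-1}e^{-\delta t}\|f\|_{L^p},$$ where $\frac1p+\frac1q=1$, $1\le p\le2$, for every $j=0,\dots,m-1$, integer $r\ge0$, multi-index $\alpha$ and $f\in C_0^\infty(\mathbb R^n)$, with $C$ independent of $t$ and $f$.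
   Context: $D_t=\frac1i\partial_t$, $D_{x_k}=\frac1i\partial_{x_k}$; $\widehat f(\xi)=\int e^{-ix\cdot\xi}f(x)\,dx$. Cauchy problem: $L(D_t,D_x)u\equiv D_t^mu+\sum_{j=1}^mP_j(D_x)D_t^{m-j}u+\sum_{l=0}^{m-1}\sum_{|\alpha|+r=l}c_{\alpha,r}D_x^\alpha D_t^ru=0$ for $t>0$, $x\in\mathbb R^n$, with $D_t^lu(0,x)=f_l(x)\in C_0^\infty(\mathbb R^n)$, $l=0,\dots,m-1$; $P_j(\xi)$ is a constant coefficient homogeneous polynomial of degree $j$, $c_{\alpha,r}\in\mathbb C$. Full symbol $L(\tau,\xi)=\tau^m+\sum_jP_j(\xi)\tau^{m-j}+\sum_l\sum_{|\alpha|+r=l}c_{\alpha,r}\xi^\alpha\tau^r$, with roots in $\tau$ denoted $\tau_1(\xi),\dots,\tau_m(\xi)$ (the characteristic roots). Strict hyperbolicity: for $\xi\ne0$ the principal part $\tau^m+\sum_jP_j(\xi)\tau^{m-j}$ has $m$ real pairwise distinct roots. As a consequence different roots $\tau_k$ can coincide only in a bounded set of $\xi$, and $\mathcal M$, $\mathcal M^\varepsilon$ are taken bounded. Amplitudes: let $E_j(t,\xi)$ be the solution of the ODE $L(D_t,\xi)E_j(t,\xi)=0$ with $D_t^lE_j(0,\xi)=\delta_{lj}$, $l=0,\dots,m-1$. Then $E_j(t,\xi)=\sum_{k=1}^me^{i\tau_k(\xi)t}A_j^k(t,\xi)$, where $A^k_j(t,\xi)$ are polynomials in $t$ with coefficients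 depending on $\xi$, and the solution is $u(t,x)=\sum_{j=0}^{m-1}(2\pi)^{-n}\int e^{ix\cdot\xi}E_j(t,\xi)\widehat f_j(\xi)\,d\xi$. For $\xi\in\mathcal M^\varepsilon$ the sum $\sum_{k=1}^L e^{i\tau_k(\xi)t}A_j^k(t,\xi)$ is the part of the exponential polynomial $E_j(\cdot,\xi)$ carried by the exponents $\tau_1(\xi),\dots,\tau_L(\xi)$.
   Formalization: The roots are assumed numbered so that the group τ_1,…,τ_L depends continuously on ξ in M^ε, i.e. ∏_{k≤L}(z−τ_k(ξ)) is continuous there (implied by continuity of each root); for arbitrary pointwise numberings the integral may be undefined. *)

theory Defs
  imports
    "HOL-Analysis.Analysis"
    "HOL-Computational_Algebra.Polynomial"
    "HOL-Probability.Essential_Supremum"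
begin

text \<open>Differentiation with \<open>D = (1/\<i>) \<partial>\<close>. These operators are total; wherever they are used, existence of the
  derivatives is required or asserted separately.\<close>

definition Dt :: "(real \<Rightarrow> complex) \<Rightarrow> real \<Rightarrow> complex" where
  "Dt g t = (1 / \<i>) * vector_derivative g (at t)"

definition Dx :: "'n \<Rightarrow> (real ^ 'n \<Rightarrow> complex) \<Rightarrow> real ^ 'n \<Rightarrow> complex" where
  "Dx i f x = (1 / \<i>) * vector_derivative (\<lambda>s. f (x + s *\<^sub>R axis i 1)) (at 0)"

text \<open>The order in which the coordinates are enumerated is irrelevant for smooth functions, because
  the partial derivatives then commute.\<close>

definition Dx_multi :: "('n::finite \<Rightarrow> nat) \<Rightarrow> (real ^ 'n \<Rightarrow> complex) \<Rightarrow> real ^ 'n \<Rightarrow> complex" where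
  "Dx_multi \<alpha> f = foldr (\<lambda>i. Dx i ^^ \<alpha> i) (SOME is. distinct is \<and> set is = UNIV) f"

definition smooth :: "(real ^ 'n::finite \<Rightarrow> complex) \<Rightarrow> bool" where
  "smooth f \<longleftrightarrow> (\<forall>is. continuous_on UNIV (foldr Dx is f) \<and>
     (\<forall>i x. (\<lambda>s. foldr Dx is f (x + s *\<^sub>R axis i 1)) differentiable (at 0)))"

definition smooth_time :: "(real \<Rightarrow> complex) \<Rightarrow> bool" where
  "smooth_time g \<longleftrightarrow> (\<forall>l t. (Dt ^^ l) g differentiable (at t))"

definition C0_infinity :: "(real ^ 'n::finite) set \<Rightarrow> (real ^ 'n \<Rightarrow> complex) set" where
  "C0_infinity U = {f. smooth f \<and> compact (closure {x. f x \<noteq> 0}) \<and> closure {x. f x \<noteq> 0} \<subseteq> U}"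

definition fourier :: "(real ^ 'n::finite \<Rightarrow> complex) \<Rightarrow> real ^ 'n \<Rightarrow> complex" where
  "fourier f \<xi> = (LINT x|lborel. exp (- \<i> * complex_of_real (x \<bullet> \<xi>)) * f x)"

text \<open>The \<open>L\<^sup>q\<close> norm for an exponent \<open>q \<in> [1,\<infinity>]\<close>, equal to \<open>\<infinity>\<close> outside of \<open>L\<^sup>q\<close>; so a finite bound
  includes measurability and membership in \<open>L\<^sup>q\<close>.\<close>

definition Lp_norm :: "ennreal \<Rightarrow> (real ^ 'n::finite \<Rightarrow> complex) \<Rightarrow> ennreal" where
  "Lp_norm q g =
     (if g \<notin> borel_measurable lborel then \<infinity>
      else if q = \<infinity> then esssup lborel (\<lambda>x. ennreal (norm (g x)))
      else let I = (\<integral>\<^sup>+ x. ennreal (norm (g x) powr enn2real q) \<partial>lborel)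
           in if I = \<infinity> then \<infinity> else ennreal (enn2real I powr (1 / enn2real q)))"

definition mdeg :: "('n::finite \<Rightarrow> nat) \<Rightarrow> nat" where
  "mdeg \<alpha> = (\<Sum>i\<in>UNIV. \<alpha> i)"

definition mpow :: "real ^ 'n::finite \<Rightarrow> ('n \<Rightarrow> nat) \<Rightarrow> complex" where
  "mpow \<xi> \<alpha> = (\<Prod>i\<in>UNIV. complex_of_real (\<xi> $ i) ^ \<alpha> i)"

definition homogeneous_poly :: "nat \<Rightarrow> (real ^ 'n::finite \<Rightarrow> complex) \<Rightarrow> bool" where
  "homogeneous_poly d p \<longleftrightarrow> (\<exists>a. \<forall>\<xi>. p \<xi> = (\<Sum>\<alpha> | mdeg \<alpha> = d. a \<alpha> * mpow \<xi> \<alpha>))"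

text \<open>In the next two definitions \<open>y r\<close> stands in for the \<open>r\<close>-th power of \<open>\<tau>\<close>: \<open>y r = \<tau> ^ r\<close> gives the
  symbol and \<open>y r = D\<^sub>t\<^sup>r g(t)\<close> gives the ordinary differential operator \<open>L(D\<^sub>t, \<xi>)\<close> applied to \<open>g\<close>.\<close>

definition principal_form ::
  "nat \<Rightarrow> (nat \<Rightarrow> real ^ 'n::finite \<Rightarrow> complex) \<Rightarrow> real ^ 'n \<Rightarrow> (nat \<Rightarrow> complex) \<Rightarrow> complex" where
  "principal_form m P \<xi> y = y m + (\<Sum>j=1..m. P j \<xi> * y (m - j))"

definition full_form ::
  "nat \<Rightarrow> (nat \<Rightarrow> real ^ 'n::finite \<Rightarrow> complex) \<Rightarrow> (('n \<Rightarrow> nat) \<Rightarrow> nat \<Rightarrow> complex) \<Rightarrow>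
   real ^ 'n \<Rightarrow> (nat \<Rightarrow> complex) \<Rightarrow> complex" where
  "full_form m P c \<xi> y = principal_form m P \<xi> y +
     (\<Sum>l<m. \<Sum>(\<alpha>, r) | mdeg \<alpha> + r = l. c \<alpha> r * mpow \<xi> \<alpha> * y r)"

definition principal_symbol ::
  "nat \<Rightarrow> (nat \<Rightarrow> real ^ 'n::finite \<Rightarrow> complex) \<Rightarrow> complex \<Rightarrow> real ^ 'n \<Rightarrow> complex" where
  "principal_symbol m P z \<xi> = principal_form m P \<xi> (\<lambda>r. z ^ r)"

definition full_symbol ::
  "nat \<Rightarrow> (nat \<Rightarrow> real ^ 'n::finite \<Rightarrow> complex) \<Rightarrow> (('n \<Rightarrow> nat) \<Rightarrow> nat \<Rightarrow> complex) \<Rightarrow>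
   complex \<Rightarrow> real ^ 'n \<Rightarrow> complex" where
  "full_symbol m P c z \<xi> = full_form m P c \<xi> (\<lambda>r. z ^ r)"

definition strictly_hyperbolic ::
  "nat \<Rightarrow> (nat \<Rightarrow> real ^ 'n::finite \<Rightarrow> complex) \<Rightarrow> bool" where
  "strictly_hyperbolic m P \<longleftrightarrow>
     (\<forall>\<xi>. \<xi> \<noteq> 0 \<longrightarrow> card {x::real. principal_symbol m P (complex_of_real x) \<xi> = 0} = m)"

text \<open>The roots \<open>\<tau>\<^sub>1(\<xi>), \<dots>, \<tau>\<^sub>m(\<xi>)\<close> of the full symbol, counted with multiplicity.\<close>

definition characteristic_roots ::
  "nat \<Rightarrow> (nat \<Rightarrow> real ^ 'n::finite \<Rightarrow> complex) \<Rightarrow> (('n \<Rightarrow> nat) \<Rightarrow> nat \<Rightarrow> complex) \<Rightarrow>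
   (nat \<Rightarrow> real ^ 'n \<Rightarrow> complex) \<Rightarrow> bool" where
  "characteristic_roots m P c \<tau> \<longleftrightarrow>
     (\<forall>\<xi> z. full_symbol m P c z \<xi> = (\<Prod>k=1..m. z - \<tau> k \<xi>))"

text \<open>\<open>g\<close> solves \<open>L(D\<^sub>t, \<xi>) g = 0\<close> on the whole line with \<open>D\<^sub>t\<^sup>l g(0) = \<delta>\<^sub>l\<^sub>j\<close> for \<open>l < m\<close>.\<close>

definition fundamental_solution ::
  "nat \<Rightarrow> (nat \<Rightarrow> real ^ 'n::finite \<Rightarrow> complex) \<Rightarrow> (('n \<Rightarrow> nat) \<Rightarrow> nat \<Rightarrow> complex) \<Rightarrow>
   real ^ 'n \<Rightarrow> nat \<Rightarrow> (real \<Rightarrow> complex) \<Rightarrow> bool" where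
  "fundamental_solution m P c \<xi> j g \<longleftrightarrow>
     (\<forall>l<m. \<forall>t. (Dt ^^ l) g differentiable (at t)) \<and>
     (\<forall>t. full_form m P c \<xi> (\<lambda>r. (Dt ^^ r) g t) = 0) \<and>
     (\<forall>l<m. (Dt ^^ l) g 0 = (if l = j then 1 else 0))"

text \<open>The guard \<open>M \<noteq> {}\<close> is needed since \<open>infdist \<xi> {} = 0\<close>.\<close>

definition nbhd :: "real \<Rightarrow> (real ^ 'n::finite) set \<Rightarrow> (real ^ 'n) set" where
  "nbhd \<epsilon> M = {\<xi>. M \<noteq> {} \<and> infdist \<xi> M < \<epsilon>}"

text \<open>The unordered group of roots \<open>\<tau>\<^sub>1, \<dots>, \<tau>\<^sub>L\<close> depends continuously on \<open>\<xi> \<in> U\<close>, i.e. so does the monic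
  polynomial having them as its roots. This is implied by continuity of the individual roots; the
  latter is not required because roots that meet need not admit a continuous numbering when the
  dimension is at least 2.\<close>

definition continuous_root_group ::
  "nat \<Rightarrow> (nat \<Rightarrow> real ^ 'n::finite \<Rightarrow> complex) \<Rightarrow> (real ^ 'n) set \<Rightarrow> bool" where
  "continuous_root_group L \<tau> U \<longleftrightarrow> (\<forall>z. continuous_on U (\<lambda>\<xi>. \<Prod>k=1..L. z - \<tau> k \<xi>))"

definition group_part ::
  "nat \<Rightarrow> (nat \<Rightarrow> real ^ 'n \<Rightarrow> complex) \<Rightarrow> (nat \<Rightarrow> real ^ 'n \<Rightarrow> complex poly) \<Rightarrow>
   real \<Rightarrow> real ^ 'n \<Rightarrow> complex" where
  "group_part L \<tau> A t \<xi> =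
     (\<Sum>k=1..L. exp (\<i> * \<tau> k \<xi> * complex_of_real t) * poly (A k \<xi>) (complex_of_real t))"

definition localized_solution ::
  "(real ^ 'n::finite) set \<Rightarrow> nat \<Rightarrow> (nat \<Rightarrow> real ^ 'n \<Rightarrow> complex) \<Rightarrow>
   (nat \<Rightarrow> real ^ 'n \<Rightarrow> complex poly) \<Rightarrow> (real ^ 'n \<Rightarrow> complex) \<Rightarrow> (real ^ 'n \<Rightarrow> complex) \<Rightarrow>
   real \<Rightarrow> real ^ 'n \<Rightarrow> complex" where
  "localized_solution U L \<tau> A chi f t x =
     (LINT \<xi>:U|lborel. exp (\<i> * complex_of_real (x \<bullet> \<xi>)) * group_part L \<tau> A t \<xi> * chi \<xi> * fourier f \<xi>)"

end

theory Submission
  imports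
    Defs
    "HOL-Complex_Analysis.Cauchy_Integral_Formula"
    "HOL-Computational_Algebra.Field_as_Ring"
    "HOL-Computational_Algebra.Polynomial_Factorial"
    "HOL-Probability.Characteristic_Functions"
begin

text \<open>Two independent facts combine: a pointwise bound on the Fourier side and an \<open>L\<^sup>p\<close>-\<open>L\<^sup>q\<close> estimate
  for multipliers of compact support.

  The pointwise bound. Write \<open>U\<close> for the neighbourhood of \<open>M\<close>. For \<open>\<xi> \<in> U\<close> the full symbol splits into
  coprime factors \<open>Q\<close>, with the roots \<open>\<tau>\<^sub>1, \<dots>, \<tau>\<^sub>L\<close>, and \<open>R\<close>, with the others, and the part \<open>g\<close> of the
  fundamental solution carried by the first group is characterized by the fact that \<open>Q(D\<^sub>t)\<close> annihilates
  \<open>g\<close> and \<open>R(D\<^sub>t)\<close> annihilates the rest (\<open>shift_op_split_coprime\<close>). The individual amplitudes may be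
  singular where roots of the group meet, but \<open>g\<close> is not:
  the jet \<open>D\<^sub>t\<^sup>n g(0)\<close> solves a linear system with trivial kernel whose coefficients, being coefficients
  of \<open>Q\<close> and \<open>R\<close>, are continuous in \<open>\<xi>\<close>, so it is continuous in \<open>\<xi>\<close> and hence bounded on the support of
  \<open>\<chi>\<close> (\<open>continuous_coprime_component\<close>). Integrating the first order factors \<open>D\<^sub>t - \<tau>\<^sub>k\<close> of \<open>Q(D\<^sub>t)\<close> one
  after the other turns bounded initial values into the bound \<open>C (1 + t)\<^bsup>L-1\<^esup> e\<^bsup>-\<delta>t\<^esup>\<close>, each factor after
  the first costing one power of \<open>1 + t\<close> (\<open>ode_decay_bound\<close>). No distance between roots inside the group
  enters.

  The multiplier estimate. Let \<open>T\<close> be the adjoint Fourier transform restricted to functions supported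
  in a fixed compact set. It maps \<open>L\<^sup>2\<close> to \<open>L\<^sup>2\<close> by Plancherel and \<open>L\<^sup>2\<close> to \<open>L\<^sup>\<infinity>\<close> by the Cauchy-Schwarz
  inequality, hence \<open>L\<^sup>2\<close> to \<open>L\<^sup>q\<close> for \<open>2 \<le> q \<le> \<infinity>\<close> because \<open>|v|\<^sup>q \<le> sup |v|\<^bsup>q-2\<^esup> |v|\<^sup>2\<close>
  (\<open>fourier_adj_Lq_bound\<close>). By duality the restriction of the Fourier transform to the compact set maps
  \<open>L\<^sup>p\<close> to \<open>L\<^sup>2\<close>. Between the two maps stands multiplication by a bounded function, which acts on \<open>L\<^sup>2\<close>
  with norm at most its supremum (\<open>multiplier_Lp_Lq_bound\<close>). This avoids interpolation of operators.

  Derivatives \<open>D\<^sub>t\<^sup>r D\<^sub>x\<^sup>\<alpha>\<close> of the localized solution pass under the integral, where they only replace \<open>g\<close> by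
  \<open>\<xi>\<^sup>\<alpha> D\<^sub>t\<^sup>r g\<close>, which satisfies the same bound on the support of \<open>\<chi>\<close>.\<close>

section \<open>Polynomials in the derivative acting on jets\<close>

text \<open>If \<open>a n = D\<^sub>t\<^sup>n u(t)\<close> is the jet of a function \<open>u\<close> at \<open>t\<close>, then \<open>shift_op p a\<close> is the jet of
  \<open>p(D\<^sub>t) u\<close> at \<open>t\<close>. Sequences of complex numbers thus become a module over the polynomial ring, and the
  algebra of constant coefficient operators can be done without differentiability side conditions.\<close>

definition shift_op :: "complex poly \<Rightarrow> (nat \<Rightarrow> complex) \<Rightarrow> nat \<Rightarrow> complex" where
  "shift_op p a n = (\<Sum>i\<le>degree p. coeff p i * a (n + i))"

lemma shift_op_eq_sum_atMost:
  assumes "degree p \<le> N"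
  shows "shift_op p a n = (\<Sum>i\<le>N. coeff p i * a (n + i))"
  unfolding shift_op_def
  by (rule sum.mono_neutral_left) (use assms in \<open>auto simp: coeff_eq_0\<close>)

lemma shift_op_0 [simp]: "shift_op 0 a = (\<lambda>n. 0)"
  by (rule ext) (simp add: shift_op_def)

lemma shift_op_1 [simp]: "shift_op 1 a = a"
  by (rule ext) (simp add: shift_op_def)

lemma shift_op_add: "shift_op (p + q) a n = shift_op p a n + shift_op q a n"
proof -
  define N where "N = max (degree p) (degree q)"
  have "degree p \<le> N" "degree q \<le> N" "degree (p + q) \<le> N"
    by (auto simp: N_def degree_add_le_max)
  then show ?thesis
    by (simp add: shift_op_eq_sum_atMost[where N=N] sum.distrib ring_distribs)
qed

lemma shift_op_add_right: "shift_op p (\<lambda>n. a n + b n) n = shift_op p a n + shift_op p b n"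
  by (simp add: shift_op_def sum.distrib ring_distribs)

lemma shift_op_smult: "shift_op (smult c p) a n = c * shift_op p a n"
  by (simp add: shift_op_eq_sum_atMost[where N="degree p"] degree_smult_le sum_distrib_left mult.assoc)

lemma shift_op_pCons: "shift_op (pCons c p) a n = c * a n + shift_op p a (Suc n)"
proof -
  have "shift_op (pCons c p) a n = (\<Sum>i\<le>Suc (degree p). coeff (pCons c p) i * a (n + i))"
    by (rule shift_op_eq_sum_atMost) (simp add: degree_pCons_le)
  also have "\<dots> = c * a n + shift_op p a (Suc n)"
    by (subst sum.atMost_Suc_shift) (simp add: shift_op_def)
  finally show ?thesis .
qed

lemma shift_op_mult: "shift_op (p * q) a = shift_op p (shift_op q a)"
proof (rule ext)
  show "shift_op (p * q) a n = shift_op p (shift_op q a) n" for n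
  proof (induction p arbitrary: n)
    case (pCons c p)
    have "shift_op (pCons c p * q) a n = c * shift_op q a n + shift_op (p * q) a (Suc n)"
      by (simp add: mult_pCons_left shift_op_add shift_op_smult shift_op_pCons)
    then show ?case
      using pCons.IH by (simp add: shift_op_pCons)
  qed simp
qed

lemma shift_op_zero [simp]: "shift_op p (\<lambda>n. 0) = (\<lambda>n. 0)"
  by (rule ext) (simp add: shift_op_def)

lemma shift_op_commute: "shift_op p (shift_op q a) = shift_op q (shift_op p a)"
  by (simp add: mult.commute flip: shift_op_mult)

lemma coprime_poly_bezout:
  assumes "coprime (p :: complex poly) q"
  obtains x y where "x * p + y * q = 1"
  using assms bezout_coefficients_fst_snd[of p q] by (simp add: coprime_iff_gcd_eq_1)

text \<open>Bezout: \<open>1 = x p + y q\<close> acts on \<open>a\<close> as the identity and as zero.\<close>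

lemma shift_op_coprime_eq_0:
  assumes "coprime p q" "shift_op p a = (\<lambda>n. 0)" "shift_op q a = (\<lambda>n. 0)"
  shows "a = (\<lambda>n. 0)"
proof -
  obtain x y where xy: "x * p + y * q = 1" using coprime_poly_bezout[OF assms(1)] .
  have "a n = 0" for n
  proof -
    have "a n = shift_op (x * p + y * q) a n" by (simp add: xy)
    also have "\<dots> = 0" by (simp add: shift_op_add shift_op_mult assms)
    finally show ?thesis .
  qed
  then show ?thesis by auto
qed

text \<open>The sum of a \<open>Q\<close>-primary and an \<open>R\<close>-primary sequence is direct, so that a relation for the sum is
  inherited by the summands: \<open>Q R g = - Q R h\<close> is annihilated by powers of both \<open>Q\<close> and \<open>R\<close> and thus
  vanishes; then \<open>Q g\<close> is annihilated by \<open>R\<close> and by a power of \<open>Q\<close>. The primary hypothesis allows the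
  amplitudes of an exponential polynomial to have any degree, as they may where roots coincide.\<close>

lemma shift_op_split_coprime:
  assumes cop: "coprime Q R"
    and g: "shift_op (Q ^ N) g = (\<lambda>n. 0)"
    and h: "shift_op (R ^ N) h = (\<lambda>n. 0)"
    and sum: "shift_op (Q * R) (\<lambda>n. g n + h n) = (\<lambda>n. 0)"
  shows "shift_op Q g = (\<lambda>n. 0)" "shift_op R h = (\<lambda>n. 0)"
proof -
  have key: "shift_op Q g = (\<lambda>n. 0)"
    if cop: "coprime Q R" and g: "shift_op (Q ^ N) g = (\<lambda>n. 0)"
    and h: "shift_op (R ^ N) h = (\<lambda>n. 0)"
    and sum: "shift_op (Q * R) (\<lambda>n. g n + h n) = (\<lambda>n. 0)" for Q R g h
  proof -
    define w where "w = shift_op (Q * R) g"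
    have wh: "w = shift_op (Q * R) (shift_op [:-1:] h)"
    proof
      fix n
      have "shift_op (Q * R) g n + shift_op (Q * R) h n = 0"
        using sum by (simp add: fun_eq_iff flip: shift_op_add_right)
      then show "w n = shift_op (Q * R) (shift_op [:-1:] h) n"
        by (simp add: w_def shift_op_commute[of "Q * R" "[:-1:]"] shift_op_pCons add_eq_0_iff2)
    qed
    have wQ: "shift_op (Q ^ N) w = (\<lambda>n. 0)"
      unfolding w_def by (subst shift_op_commute) (simp add: g)
    have wR: "shift_op (R ^ N) w = (\<lambda>n. 0)"
      unfolding wh by (subst shift_op_commute[of "R ^ N" "Q * R"], subst shift_op_commute[of "R ^ N" "[:-1:]"]) (simp add: h)
    have "coprime (Q ^ N) (R ^ N)" using cop by simp
    then have "w = (\<lambda>n. 0)" using wQ wR by (rule shift_op_coprime_eq_0)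
    then have Rg: "shift_op R (shift_op Q g) = (\<lambda>n. 0)"
      unfolding w_def by (simp add: shift_op_mult[symmetric] mult.commute)
    have Qg: "shift_op (Q ^ N) (shift_op Q g) = (\<lambda>n. 0)"
      by (subst shift_op_commute) (simp add: g)
    have "coprime R (Q ^ N)" using cop by (simp add: coprime_commute)
    then show ?thesis using Rg Qg by (rule shift_op_coprime_eq_0)
  qed
  show "shift_op Q g = (\<lambda>n. 0)" using key[OF cop g h sum] .
  show "shift_op R h = (\<lambda>n. 0)"
    by (rule key[of R Q h g]) (use assms in \<open>simp_all add: coprime_commute mult.commute add.commute\<close>)
qed

lemma coprime_linear_factors:
  assumes "\<And>k l. k \<in> I \<Longrightarrow> l \<in> J \<Longrightarrow> a k \<noteq> (b l :: complex)"
  shows "coprime (\<Prod>k\<in>I. [:- a k, 1:]) (\<Prod>l\<in>J. [:- b l, 1:])"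
proof (rule prod_coprime_left, rule prod_coprime_right)
  fix k l assume "k \<in> I" "l \<in> J"
  then have ne: "b l - a k \<noteq> 0" using assms by force
  show "coprime [:- a k, 1:] [:- b l, 1:]"
  proof (rule coprimeI)
    fix c assume "c dvd [:- a k, 1:]" "c dvd [:- b l, 1:]"
    then have "c dvd [:- a k, 1:] - [:- b l, 1:]" by (rule dvd_diff)
    then have "c dvd [:b l - a k:]" by simp
    then show "is_unit c" using ne by (meson dvd_trans is_unit_triv)
  qed
qed

lemma shift_op_eq_0I:
  assumes "\<And>i. coeff p i \<noteq> 0 \<Longrightarrow> a (n + i) = 0"
  shows "shift_op p a n = 0"
  unfolding shift_op_def using assms by (intro sum.neutral) auto

lemma shift_op_monom: "shift_op (monom 1 k) a 0 = a k"
proof -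
  have "shift_op (monom 1 k) a 0 = (\<Sum>i\<le>k. coeff (monom 1 k) i * a (0 + i))"
    by (rule shift_op_eq_sum_atMost) (simp add: degree_monom_le)
  also have "\<dots> = (\<Sum>i\<le>k. if i = k then a k else 0)"
    by (rule sum.cong) auto
  finally show ?thesis by simp
qed

lemma shift_op_monic_recurrence:
  assumes "shift_op p a n = 0" "lead_coeff p = 1"
  shows "a (n + degree p) = - (\<Sum>i<degree p. coeff p i * a (n + i))"
  using assms unfolding shift_op_def
  by (simp add: lessThan_Suc_atMost[symmetric] add_eq_0_iff)

section \<open>Exponential polynomials\<close>

text \<open>The action of \<open>D\<^sub>t\<close> on amplitudes: \<open>D\<^sub>t (e\<^bsup>i\<tau>t\<^esup> p(t)) = e\<^bsup>i\<tau>t\<^esup> (\<tau> p(t) - i p'(t))\<close>.\<close>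

definition exp_D :: "complex \<Rightarrow> complex poly \<Rightarrow> complex poly" where
  "exp_D \<tau> p = smult \<tau> p - smult \<i> (pderiv p)"

definition exp_poly :: "'k set \<Rightarrow> ('k \<Rightarrow> complex) \<Rightarrow> ('k \<Rightarrow> complex poly) \<Rightarrow> complex \<Rightarrow> complex" where
  "exp_poly S \<tau> A z = (\<Sum>k\<in>S. exp (\<i> * \<tau> k * z) * poly (A k) z)"

lemma exp_poly_has_field_derivative:
  "(exp_poly S \<tau> A has_field_derivative \<i> * exp_poly S \<tau> (\<lambda>k. exp_D (\<tau> k) (A k)) z) (at z)"
proof -
  have "((\<lambda>z. exp (\<i> * \<tau> k * z) * poly (A k) z) has_field_derivative
          \<i> * (exp (\<i> * \<tau> k * z) * poly (exp_D (\<tau> k) (A k)) z)) (at z)" for k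
    by (rule derivative_eq_intros poly_DERIV refl | simp add: exp_D_def algebra_simps)+
  then show ?thesis
    unfolding exp_poly_def sum_distrib_left by (rule DERIV_sum)
qed

lemma exp_poly_has_vector_derivative:
  "((\<lambda>t. exp_poly S \<tau> A (complex_of_real t)) has_vector_derivative
     \<i> * exp_poly S \<tau> (\<lambda>k. exp_D (\<tau> k) (A k)) (of_real t)) (at t)"
  by (rule has_vector_derivative_real_field[OF exp_poly_has_field_derivative])

lemma Dt_exp_poly:
  "Dt (\<lambda>t. exp_poly S \<tau> A (complex_of_real t)) =
     (\<lambda>t. exp_poly S \<tau> (\<lambda>k. exp_D (\<tau> k) (A k)) (of_real t))"
  unfolding Dt_def by (rule ext) (simp add: vector_derivative_at[OF exp_poly_has_vector_derivative])

lemma Dt_funpow_exp_poly: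
  "(Dt ^^ n) (\<lambda>t. exp_poly S \<tau> A (complex_of_real t)) =
     (\<lambda>t. exp_poly S \<tau> (\<lambda>k. (exp_D (\<tau> k) ^^ n) (A k)) (of_real t))"
  by (induction n) (simp_all add: Dt_exp_poly)

lemma higher_deriv_exp_poly:
  "(deriv ^^ n) (exp_poly S \<tau> A) = (\<lambda>z. \<i> ^ n * exp_poly S \<tau> (\<lambda>k. (exp_D (\<tau> k) ^^ n) (A k)) z)"
proof (induction n)
  case (Suc n)
  have "deriv (\<lambda>z. \<i> ^ n * exp_poly S \<tau> (\<lambda>k. (exp_D (\<tau> k) ^^ n) (A k)) z) z =
        \<i> ^ n * (\<i> * exp_poly S \<tau> (\<lambda>k. (exp_D (\<tau> k) ^^ Suc n) (A k)) z)" for z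
    by (intro DERIV_imp_deriv DERIV_cmult) (use exp_poly_has_field_derivative in simp)
  then have "deriv (\<lambda>z. \<i> ^ n * exp_poly S \<tau> (\<lambda>k. (exp_D (\<tau> k) ^^ n) (A k)) z) =
      (\<lambda>z. \<i> ^ n * (\<i> * exp_poly S \<tau> (\<lambda>k. (exp_D (\<tau> k) ^^ Suc n) (A k)) z))" by (rule ext)
  then show ?case using Suc by (simp add: mult.assoc mult.left_commute)
qed simp

text \<open>Exponential polynomials are entire, so their jet at \<open>0\<close> determines them. Measurability in \<open>\<xi>\<close> at
  all times is deduced from this.\<close>

lemma exp_poly_taylor:
  "(\<lambda>n. (\<i> * z) ^ n / fact n * exp_poly S \<tau> (\<lambda>k. (exp_D (\<tau> k) ^^ n) (A k)) 0) sums exp_poly S \<tau> A z"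
proof -
  have "exp_poly S \<tau> A holomorphic_on ball 0 (norm z + 1)"
    using exp_poly_has_field_derivative by (force simp: holomorphic_on_open)
  then have "(\<lambda>n. (deriv ^^ n) (exp_poly S \<tau> A) 0 / fact n * (z - 0) ^ n) sums exp_poly S \<tau> A z"
    by (rule holomorphic_power_series) auto
  then show ?thesis by (simp add: higher_deriv_exp_poly power_mult_distrib mult_ac)
qed

lemma exp_D_funpow_smult: "(exp_D \<tau> ^^ n) (smult c p) = smult c ((exp_D \<tau> ^^ n) p)"
  by (induction n) (simp_all add: exp_D_def pderiv_smult smult_diff_right mult_ac)

lemma exp_D_funpow_pderiv: "(exp_D \<tau> ^^ n) (pderiv p) = pderiv ((exp_D \<tau> ^^ n) p)"
  by (induction n) (simp_all add: exp_D_def pderiv_smult pderiv_diff)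

text \<open>The operator \<open>D\<^sub>t - \<tau>\<^sub>k\<close> replaces the amplitude of \<open>e\<^bsup>i\<tau>t\<^esup>\<close>, \<open>\<tau> = \<tau>\<^sub>k\<close>, by a multiple of its derivative,
  so a power exceeding all the degrees of the amplitudes annihilates everything. One \<open>N\<close> serves for all
  times \<open>z\<close>.\<close>

lemma exp_poly_annihilated:
  assumes "finite S"
  obtains N where "\<And>N' z. N' \<ge> N \<Longrightarrow> shift_op ((\<Prod>k\<in>S. [:- \<tau> k, 1:]) ^ N')
      (\<lambda>n. exp_poly S \<tau> (\<lambda>k. (exp_D (\<tau> k) ^^ n) (A k)) z) = (\<lambda>n. 0)"
proof -
  (* 0 is inserted only because the maximum of an empty set is unspecified *)
  define N where "N = Suc (Max (insert 0 (degree ` A ` S)))"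
  have deg: "degree (A k) < N" if "k \<in> S" for k
    using that assms by (auto simp: N_def less_Suc_eq_le intro!: Max_ge)
  define e where "e k p z = (\<lambda>n. exp (\<i> * \<tau> k * z) * poly ((exp_D (\<tau> k) ^^ n) p) z)" for k p z
  have step: "shift_op [:- \<tau> k, 1:] (e k p z) = e k (smult (-\<i>) (pderiv p)) z" for k p z
    by (rule ext) (simp add: shift_op_pCons e_def exp_D_funpow_smult exp_D_funpow_pderiv exp_D_def algebra_simps del: smult_minus_left)
  have kill: "shift_op ([:- \<tau> k, 1:] ^ N') (e k p z) = (\<lambda>n. 0)" if "degree p < N'" for N' k p z
    using that
  proof (induction N' arbitrary: p)
    case (Suc N')
    have "shift_op ([:- \<tau> k, 1:] ^ Suc N') (e k p z) = shift_op ([:- \<tau> k, 1:] ^ N') (e k (smult (-\<i>) (pderiv p)) z)"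
      by (simp only: power_Suc2 shift_op_mult step)
    also have "\<dots> = (\<lambda>n. 0)"
    proof (cases "degree p = 0")
      case True
      then have "pderiv p = 0" by (simp add: pderiv_eq_0_iff)
      moreover have "(exp_D \<tau>' ^^ n) 0 = 0" for \<tau>' n by (induction n) (simp_all add: exp_D_def)
      ultimately have "e k (smult (-\<i>) (pderiv p)) z = (\<lambda>n. 0)" by (simp add: e_def)
      then show ?thesis by simp
    next
      case False
      then show ?thesis using Suc by (auto simp: degree_pderiv)
    qed
    finally show ?case .
  qed simp
  have "shift_op ((\<Prod>k\<in>S. [:- \<tau> k, 1:]) ^ N')
      (\<lambda>n. exp_poly S \<tau> (\<lambda>k. (exp_D (\<tau> k) ^^ n) (A k)) z) = (\<lambda>n. 0)" if "N' \<ge> N" for N' z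
  proof
    fix n
    have "shift_op ((\<Prod>k\<in>S. [:- \<tau> k, 1:]) ^ N')
      (\<lambda>n. exp_poly S \<tau> (\<lambda>k. (exp_D (\<tau> k) ^^ n) (A k)) z) n
      = (\<Sum>k\<in>S. shift_op ((\<Prod>k\<in>S. [:- \<tau> k, 1:]) ^ N') (e k (A k) z) n)"
      unfolding shift_op_def exp_poly_def e_def sum_distrib_left by (rule sum.swap)
    also have "\<dots> = (\<Sum>k\<in>S. 0)"
    proof (rule sum.cong)
      fix k assume k: "k \<in> S"
      have "(\<Prod>k\<in>S. [:- \<tau> k, 1:]) ^ N' = (\<Prod>k\<in>S - {k}. [:- \<tau> k, 1:]) ^ N' * [:- \<tau> k, 1:] ^ N'"
        by (simp only: prod.remove[OF assms k] power_mult_distrib mult.commute)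
      then show "shift_op ((\<Prod>k\<in>S. [:- \<tau> k, 1:]) ^ N') (e k (A k) z) n = 0"
        using kill[of "A k" N' k z] deg[OF k] that by (simp add: shift_op_mult)
    qed simp
    finally show "shift_op ((\<Prod>k\<in>S. [:- \<tau> k, 1:]) ^ N')
      (\<lambda>n. exp_poly S \<tau> (\<lambda>k. (exp_D (\<tau> k) ^^ n) (A k)) z) n = 0" by simp
  qed
  then show ?thesis by (rule that)
qed

section \<open>Continuous dependence of a component on parameters\<close>

text \<open>Pointwise convergence of polynomials of bounded degree is convergence of the coefficients. The
  induction on the degree passes to the difference quotient at a point \<open>z0\<close>, whose values are under control
  except at \<open>z0\<close>; the finite exceptional set \<open>Z\<close> absorbs these points. It is also used to exclude the
  zeros of a denominator.\<close>

lemma coeff_tendsto: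
  fixes p :: "'a \<Rightarrow> complex poly"
  assumes "\<And>\<xi>. degree (p \<xi>) \<le> d" "degree p0 \<le> d" "finite Z"
    and "\<And>z. z \<notin> Z \<Longrightarrow> ((\<lambda>\<xi>. poly (p \<xi>) z) \<longlongrightarrow> poly p0 z) F"
  shows "((\<lambda>\<xi>. coeff (p \<xi>) i) \<longlongrightarrow> coeff p0 i) F"
  using assms
proof (induction d arbitrary: p p0 Z i)
  case 0
  obtain z where "z \<notin> Z" using 0 ex_new_if_finite infinite_UNIV_char_0 by blast
  have const: "coeff q i = (if i = 0 then poly q z else 0)" if "degree q \<le> 0" for q :: "complex poly"
    using that by (auto elim!: degree_eq_zeroE simp: coeff_pCons split: nat.split)
  have "((\<lambda>\<xi>. if i = 0 then poly (p \<xi>) z else 0) \<longlongrightarrow> (if i = 0 then poly p0 z else 0)) F"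
    using 0(4)[OF \<open>z \<notin> Z\<close>] by auto
  then show ?case using const 0 by simp
next
  case (Suc d)
  obtain z0 where z0: "z0 \<notin> Z" using Suc ex_new_if_finite infinite_UNIV_char_0 by blast
  have div: "poly (synthetic_div q z0) z = (poly q z - poly q z0) / (z - z0)" if "z \<noteq> z0" for q z
  proof -
    have "poly q z = poly ([:- z0, 1:] * synthetic_div q z0 + [:poly q z0:]) z"
      by (simp only: synthetic_div_correct')
    then show ?thesis using that by (simp add: field_simps)
  qed
  have IH: "((\<lambda>\<xi>. coeff (synthetic_div (p \<xi>) z0) i) \<longlongrightarrow> coeff (synthetic_div p0 z0) i) F" for i
  proof (rule Suc.IH)
    show "degree (synthetic_div (p \<xi>) z0) \<le> d" for \<xi>
      using Suc.prems(1)[of \<xi>] by (simp add: degree_synthetic_div)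
    show "degree (synthetic_div p0 z0) \<le> d"
      using Suc.prems(2) by (simp add: degree_synthetic_div)
    show "finite (insert z0 Z)" using Suc.prems by simp
    fix z assume "z \<notin> insert z0 Z"
    then show "((\<lambda>\<xi>. poly (synthetic_div (p \<xi>) z0) z) \<longlongrightarrow> poly (synthetic_div p0 z0) z) F"
      using div Suc.prems(4)[of z] Suc.prems(4)[OF z0] by (auto intro!: tendsto_intros)
  qed
  have coeff: "coeff q i = (case i of 0 \<Rightarrow> poly q z0 - z0 * coeff (synthetic_div q z0) 0
      | Suc j \<Rightarrow> coeff (synthetic_div q z0) j - z0 * coeff (synthetic_div q z0) (Suc j))" for q
  proof -
    have "coeff q i = coeff ([:- z0, 1:] * synthetic_div q z0 + [:poly q z0:]) i"
      by (simp only: synthetic_div_correct')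
    then show ?thesis by (simp add: coeff_pCons split: nat.split)
  qed
  show ?case
    unfolding coeff[of "p _"] coeff[of p0]
    using IH Suc.prems(4)[OF z0] by (cases i) (auto intro!: tendsto_intros)
qed

text \<open>Gaussian elimination near a point: since the kernel is trivial, each column contains an entry that
  does not vanish at that point, hence not nearby; it serves as pivot and removes one unknown from the other
  equations. For such a local argument the system may be overdetermined, and no determinant appears.\<close>

lemma continuous_linear_system:
  fixes a :: "'i \<Rightarrow> 'j \<Rightarrow> 'a::t2_space \<Rightarrow> complex"
  assumes "finite J" "open U"
    and "\<And>i j. i \<in> I \<Longrightarrow> j \<in> J \<Longrightarrow> continuous_on U (a i j)"
    and "\<And>i. i \<in> I \<Longrightarrow> continuous_on U (b i)"
    and "\<And>\<xi> i. \<xi> \<in> U \<Longrightarrow> i \<in> I \<Longrightarrow> (\<Sum>j\<in>J. a i j \<xi> * v j \<xi>) = b i \<xi>"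
    and "\<And>\<xi> y. \<xi> \<in> U \<Longrightarrow> (\<And>i. i \<in> I \<Longrightarrow> (\<Sum>j\<in>J. a i j \<xi> * y j) = 0) \<Longrightarrow> (\<forall>j\<in>J. y j = 0)"
    and "j \<in> J"
  shows "continuous_on U (v j)"
  using assms
proof (induction J arbitrary: U a b j rule: finite_induct)
  case (insert j0 J)
  note fin = insert.hyps(1) and j0 = insert.hyps(2)
  have "continuous (at \<xi>0) (v j)" if \<xi>0: "\<xi>0 \<in> U" for \<xi>0
  proof -
    have "\<exists>i0\<in>I. a i0 j0 \<xi>0 \<noteq> 0"
    proof (rule ccontr)
      assume "\<not> ?thesis"
      then have "\<forall>j\<in>insert j0 J. (if j = j0 then 1 else 0 :: complex) = 0"
        using fin j0 by (intro insert.prems(5)[OF \<xi>0]) (auto intro!: sum.neutral)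
      then show False by auto
    qed
    then obtain i0 where i0: "i0 \<in> I" "a i0 j0 \<xi>0 \<noteq> 0" by blast
    have c0: "continuous_on U (a i0 j0)" using insert.prems(2) i0 by auto
    define V where "V = U \<inter> (a i0 j0 -` (- {0}))"
    have V: "open V" "V \<subseteq> U" "\<xi>0 \<in> V" "\<And>\<xi>. \<xi> \<in> V \<Longrightarrow> a i0 j0 \<xi> \<noteq> 0"
      using continuous_open_preimage[OF c0 insert.prems(1)] \<xi>0 i0 by (auto simp: V_def)
    define a' where "a' i j \<xi> = a i j \<xi> - a i j0 \<xi> * a i0 j \<xi> / a i0 j0 \<xi>" for i j \<xi>
    define b' where "b' i \<xi> = b i \<xi> - a i j0 \<xi> * b i0 \<xi> / a i0 j0 \<xi>" for i \<xi>
    have red: "(\<Sum>j\<in>J. a' i j \<xi> * y j) =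
        (\<Sum>j\<in>insert j0 J. a i j \<xi> * y j) - a i j0 \<xi> * (\<Sum>j\<in>insert j0 J. a i0 j \<xi> * y j) / a i0 j0 \<xi>"
      if "\<xi> \<in> V" for i y \<xi>
      using V(4)[OF that] fin j0
      by (simp add: a'_def sum_subtractf left_diff_distrib sum_distrib_left sum_divide_distrib field_simps)
    have contV: "continuous_on V (a i j)" if "i \<in> I" "j \<in> insert j0 J" for i j
      using insert.prems(2) V that continuous_on_subset by blast
    have contVb: "continuous_on V (b i)" if "i \<in> I" for i
      using insert.prems(3) V that continuous_on_subset by blast
    have J: "continuous_on V (v j)" if "j \<in> J" for j
    proof (rule insert.IH[of V a' b' j])
      show "open V" by fact
      show "continuous_on V (a' i j)" if "i \<in> I" "j \<in> J" for i j
        unfolding a'_def using contV that i0 V by (intro continuous_intros) auto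
      show "continuous_on V (b' i)" if "i \<in> I" for i
        unfolding b'_def using contV contVb that i0 V by (intro continuous_intros) auto
      show "(\<Sum>j\<in>J. a' i j \<xi> * v j \<xi>) = b' i \<xi>" if "\<xi> \<in> V" "i \<in> I" for \<xi> i
        using red[OF that(1), of i "\<lambda>j. v j \<xi>"] insert.prems(4) V that i0 by (auto simp: b'_def)
      show "j \<in> J" by fact
      fix \<xi> y assume \<xi>: "\<xi> \<in> V" and y: "\<And>i. i \<in> I \<Longrightarrow> (\<Sum>j\<in>J. a' i j \<xi> * y j) = 0"
      \<comment> \<open>a kernel vector of the reduced system extends to one of the full system, the pivot row being solved
        for the new entry\<close>
      define y' where "y' = y(j0 := - (\<Sum>j\<in>J. a i0 j \<xi> * y j) / a i0 j0 \<xi>)"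
      have y'J: "(\<Sum>j\<in>J. c j * y' j) = (\<Sum>j\<in>J. c j * y j)" for c
        using j0 by (intro sum.cong) (auto simp: y'_def)
      have row0: "(\<Sum>j\<in>insert j0 J. a i0 j \<xi> * y' j) = 0"
        using fin j0 V(4)[OF \<xi>] by (simp add: y'J) (simp add: y'_def)
      have "(\<Sum>j\<in>insert j0 J. a i j \<xi> * y' j) = 0" if "i \<in> I" for i
        using red[OF \<xi>, of i y'] y'J[of "\<lambda>j. a' i j \<xi>"] y[OF that] row0 by simp
      then have "\<forall>j\<in>insert j0 J. y' j = 0"
        using insert.prems(5) \<xi> V by blast
      then show "\<forall>j\<in>J. y j = 0" using j0 by (auto simp: y'_def split: if_splits)
    qed
    have vj0: "v j0 \<xi> = (b i0 \<xi> - (\<Sum>j\<in>J. a i0 j \<xi> * v j \<xi>)) / a i0 j0 \<xi>" if "\<xi> \<in> V" for \<xi>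
      using insert.prems(4)[of \<xi> i0] V(2) V(4)[OF that] i0 that fin j0
      by (auto simp: field_simps)
    have "continuous_on V (\<lambda>\<xi>. (b i0 \<xi> - (\<Sum>j\<in>J. a i0 j \<xi> * v j \<xi>)) / a i0 j0 \<xi>)"
      using contV contVb J i0 V by (intro continuous_intros) auto
    then have "continuous_on V (v j0)"
      by (rule continuous_on_eq) (use vj0 in auto)
    then have "continuous_on V (v j)" using J insert.prems(6) by auto
    then show ?thesis using V by (simp add: continuous_on_eq_continuous_at)
  qed
  then show ?case using insert.prems(1) by (simp add: continuous_on_eq_continuous_at)
qed simp

lemma continuous_recurrence:
  fixes p :: "'a::t2_space \<Rightarrow> complex poly"
  assumes coeff: "\<And>i. continuous_on U (\<lambda>\<xi>. coeff (p \<xi>) i)"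
    and monic: "\<And>\<xi>. \<xi> \<in> U \<Longrightarrow> degree (p \<xi>) = L \<and> lead_coeff (p \<xi>) = 1"
    and rec: "\<And>\<xi>. \<xi> \<in> U \<Longrightarrow> shift_op (p \<xi>) (a \<xi>) = (\<lambda>n. 0)"
    and init: "\<And>n. n < L \<Longrightarrow> continuous_on U (\<lambda>\<xi>. a \<xi> n)"
  shows "continuous_on U (\<lambda>\<xi>. a \<xi> n)"
proof (induction n rule: less_induct)
  case (less n)
  show ?case
  proof (cases "n < L")
    case False
    then obtain k where k: "n = k + L" by (metis add.commute le_Suc_ex not_less)
    have "continuous_on U (\<lambda>\<xi>. - (\<Sum>i<L. coeff (p \<xi>) i * a \<xi> (k + i)))"
      using coeff less k by (intro continuous_intros) auto
    then show ?thesis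
    proof (rule continuous_on_eq)
      fix \<xi> assume \<xi>: "\<xi> \<in> U"
      then show "- (\<Sum>i<L. coeff (p \<xi>) i * a \<xi> (k + i)) = a \<xi> n"
        using shift_op_monic_recurrence[of "p \<xi>" "a \<xi>" k] rec[OF \<xi>] monic[OF \<xi>] k by auto
    qed
  qed (use init in auto)
qed

text \<open>The jet \<open>g\<close> is recovered from \<open>a = g + h\<close> by a linear system for \<open>g 0, \<dots>, g (L + N - 1)\<close>: the rows
  \<open>(Q g) i = 0\<close> for \<open>i < N\<close> and \<open>(R g) i = (R a) i\<close> for \<open>i < L\<close>, i.e. the Sylvester matrix of \<open>Q\<close> and \<open>R\<close>.
  Its kernel is trivial because every \<open>z\<^sup>k\<close> with \<open>k < L + N\<close> can be written as \<open>c Q + e R\<close> with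
  \<open>deg c < N\<close> and \<open>deg e < L\<close>, which expresses the \<open>k\<close>-th unknown through the rows.\<close>

lemma continuous_coprime_component:
  fixes Q R :: "'a::t2_space \<Rightarrow> complex poly"
  assumes U: "open U"
    and Q: "\<And>i. continuous_on U (\<lambda>\<xi>. coeff (Q \<xi>) i)"
    and R: "\<And>i. continuous_on U (\<lambda>\<xi>. coeff (R \<xi>) i)"
    and degQ: "\<And>\<xi>. \<xi> \<in> U \<Longrightarrow> degree (Q \<xi>) = L \<and> lead_coeff (Q \<xi>) = 1"
    and degR: "\<And>\<xi>. \<xi> \<in> U \<Longrightarrow> degree (R \<xi>) = N"
    and cop: "\<And>\<xi>. \<xi> \<in> U \<Longrightarrow> coprime (Q \<xi>) (R \<xi>)"
    and Qg: "\<And>\<xi>. \<xi> \<in> U \<Longrightarrow> shift_op (Q \<xi>) (g \<xi>) = (\<lambda>n. 0)"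
    and Rh: "\<And>\<xi>. \<xi> \<in> U \<Longrightarrow> shift_op (R \<xi>) (h \<xi>) = (\<lambda>n. 0)"
    and gh: "\<And>n. continuous_on U (\<lambda>\<xi>. g \<xi> n + h \<xi> n)"
  shows "continuous_on U (\<lambda>\<xi>. g \<xi> n)"
proof -
  define row where "row p i j = (if i \<le> j then coeff p (j - i) else 0)" for p :: "complex poly" and i j :: nat
  have row: "(\<Sum>j<L+N. row p i j * y j) = shift_op p y i" if "degree p + i < L + N" for p i y
  proof -
    have "(\<Sum>j<L+N. row p i j * y j) = (\<Sum>j\<in>{i..i + degree p}. coeff p (j - i) * y j)"
      by (rule sum.mono_neutral_cong_right) (use that in \<open>auto simp: row_def coeff_eq_0\<close>)
    also have "\<dots> = shift_op p y i"
      unfolding shift_op_def atMost_atLeast0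
      using sum.shift_bounds_cl_nat_ivl[of "\<lambda>j. coeff p (j - i) * y j" 0 i "degree p"]
      by (simp add: add.commute)
    finally show ?thesis .
  qed
  define I where "I = {True} \<times> {..<N} \<union> {False} \<times> {..<L}"
  define A where "A = (\<lambda>(t, i) j \<xi>. row (if t then Q \<xi> else R \<xi>) i j)"
  define B where "B = (\<lambda>(t, i) \<xi>. if t then 0 else shift_op (R \<xi>) (\<lambda>n. g \<xi> n + h \<xi> n) i)"
  have "continuous_on U (\<lambda>\<xi>. g \<xi> k)" if "k < L + N" for k
  proof (rule continuous_linear_system[where J="{..<L+N}" and I=I and a=A and b=B and v="\<lambda>k \<xi>. g \<xi> k"])
    show "continuous_on U (A i j)" for i j
      unfolding A_def row_def using Q R by (cases i; cases "fst i"; cases "snd i \<le> j") auto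
    show "continuous_on U (B i)" for i
    proof (cases "fst i")
      case False
      have "continuous_on U (\<lambda>\<xi>. \<Sum>l\<le>N. coeff (R \<xi>) l * (g \<xi> (snd i + l) + h \<xi> (snd i + l)))"
        by (intro continuous_on_sum continuous_on_mult R gh)
      then show ?thesis
        by (rule continuous_on_eq) (use False degR in \<open>auto simp: B_def shift_op_def split: prod.splits\<close>)
    qed (auto simp: B_def split: prod.splits)
    show "(\<Sum>j<L+N. A i j \<xi> * g \<xi> j) = B i \<xi>" if "\<xi> \<in> U" "i \<in> I" for \<xi> i
    proof (cases "fst i")
      case True
      then show ?thesis
        using that degQ[OF that(1)] Qg[OF that(1)] row[of "Q \<xi>" "snd i" "g \<xi>"]
        by (auto simp: I_def A_def B_def)
    next
      case False
      then show ?thesis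
        using that degR[OF that(1)] Rh[OF that(1)] row[of "R \<xi>" "snd i" "g \<xi>"]
        by (auto simp: I_def A_def B_def shift_op_add_right)
    qed
    show "\<forall>j\<in>{..<L+N}. y j = 0"
      if \<xi>: "\<xi> \<in> U" and y: "\<And>i. i \<in> I \<Longrightarrow> (\<Sum>j<L+N. A i j \<xi> * y j) = 0" for \<xi> y
    proof
      fix k assume k: "k \<in> {..<L+N}"
      have dQ: "degree (Q \<xi>) = L" "Q \<xi> \<noteq> 0" and dR: "degree (R \<xi>) = N"
        using degQ[OF \<xi>] degR[OF \<xi>] by auto
      have yQ: "shift_op (Q \<xi>) y i = 0" if "i < N" for i
        using y[of "(True, i)"] that row[of "Q \<xi>" i y] dQ by (simp add: I_def A_def)
      have yR: "shift_op (R \<xi>) y i = 0" if "i < L" for i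
        using y[of "(False, i)"] that row[of "R \<xi>" i y] dR by (simp add: I_def A_def)
      obtain u w where uw: "u * Q \<xi> + w * R \<xi> = 1" using coprime_poly_bezout[OF cop[OF \<xi>]] .
      \<comment> \<open>reduce the cofactor of \<open>R\<close> modulo \<open>Q\<close>; the degree of the other cofactor is then forced\<close>
      define e where "e = (monom 1 k * w) mod Q \<xi>"
      define c where "c = monom 1 k * u + ((monom 1 k * w) div Q \<xi>) * R \<xi>"
      have "monom 1 k = monom 1 k * (u * Q \<xi> + w * R \<xi>)" by (simp add: uw)
      also have "\<dots> = monom 1 k * u * Q \<xi> + ((monom 1 k * w) div Q \<xi> * Q \<xi> + e) * R \<xi>"
        unfolding e_def div_mult_mod_eq by (simp only: distrib_left mult.assoc)
      also have "\<dots> = c * Q \<xi> + e * R \<xi>"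
        by (simp only: c_def distrib_left distrib_right mult_ac add_ac)
      finally have split: "monom 1 k = c * Q \<xi> + e * R \<xi>" .
      have e: "i < L" if "coeff e i \<noteq> 0" for i
      proof -
        have "e \<noteq> 0" using that by auto
        then have "degree e < L" using degree_mod_less'[OF dQ(2)] dQ(1) by (auto simp: e_def)
        then show ?thesis using that le_degree[of e i] by linarith
      qed
      have eR: "degree (e * R \<xi>) < L + N \<or> e * R \<xi> = 0"
      proof (cases "e = 0")
        case False
        then have "degree e < L" using e[of "degree e"] by simp
        then show ?thesis using degree_mult_le[of e "R \<xi>"] dR by linarith
      qed simp
      have c: "i < N" if "coeff c i \<noteq> 0" for i
      proof -
        have c0: "c \<noteq> 0" using that by auto
        have cQ: "c * Q \<xi> = monom 1 k - e * R \<xi>" using split by simp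
        have "degree (monom (1::complex) k) < L + N" using k by (simp add: degree_monom_eq)
        then have "degree (c * Q \<xi>) < L + N"
          unfolding cQ using eR by (metis degree_diff_less diff_zero)
        then have "degree c < N" using c0 dQ by (simp add: degree_mult_eq)
        then show ?thesis using that le_degree[of c i] by linarith
      qed
      have "y k = shift_op (c * Q \<xi> + e * R \<xi>) y 0"
        unfolding split[symmetric] by (rule shift_op_monom[symmetric])
      also have "\<dots> = shift_op c (shift_op (Q \<xi>) y) 0 + shift_op e (shift_op (R \<xi>) y) 0"
        by (simp add: shift_op_add shift_op_mult)
      also have "\<dots> = 0"
        using c e yQ yR by (simp add: shift_op_eq_0I)
      finally show "y k = 0" .
    qed
  qed (use U that in auto)
  then have "continuous_on U (\<lambda>\<xi>. g \<xi> k)" if "k < L" for k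
    using that by simp
  then show ?thesis
    using continuous_recurrence[of U Q L g n] Q degQ Qg by blast
qed

section \<open>Decay of the solutions of an ordinary differential equation\<close>

lemma has_vector_derivative_bound:
  fixes f :: "real \<Rightarrow> 'a::real_normed_vector"
  assumes "convex S" "\<And>s. s \<in> S \<Longrightarrow> (f has_vector_derivative f' s) (at s within S)"
    and "\<And>s. s \<in> S \<Longrightarrow> norm (f' s) \<le> B" and "a \<in> S" "b \<in> S"
  shows "norm (f b - f a) \<le> B * \<bar>b - a\<bar>"
proof -
  have "norm (f b - f a) \<le> B * norm (b - a)"
  proof (rule differentiable_bound[of S f "\<lambda>s h. h *\<^sub>R f' s"])
    show "onorm (\<lambda>h. h *\<^sub>R f' s) \<le> B" if "s \<in> S" for s
      using assms(3)[OF that] by (intro onorm_le) (simp add: mult.commute[of B] mult_left_mono)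
  qed (use assms in \<open>auto simp: has_vector_derivative_def\<close>)
  then show ?thesis by simp
qed

lemma monic_poly_root_bound:
  fixes p :: "complex poly"
  assumes "poly p z = 0" "lead_coeff p = 1"
  shows "norm z \<le> 1 + (\<Sum>i<degree p. norm (coeff p i))"
proof (rule ccontr)
  assume "\<not> ?thesis"
  then have z: "norm z > 1 + (\<Sum>i<degree p. norm (coeff p i))" by simp
  have nonneg: "(\<Sum>i<degree p. norm (coeff p i)) \<ge> 0" by (simp add: sum_nonneg)
  have z1: "norm z > 1" using z nonneg by linarith
  obtain d where d: "degree p = Suc d"
    using assms by (cases "degree p") (auto elim: degree_eq_zeroE)
  have "z ^ degree p = - (\<Sum>i<degree p. coeff p i * z ^ i)"
    using assms by (simp add: poly_altdef lessThan_Suc_atMost[symmetric] add_eq_0_iff2)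
  then have "norm z ^ degree p \<le> (\<Sum>i<degree p. norm (coeff p i) * norm z ^ i)"
    by (metis (no_types, lifting) norm_minus_cancel norm_mult norm_power norm_sum sum.cong)
  also have "\<dots> \<le> (\<Sum>i<degree p. norm (coeff p i) * norm z ^ d)"
    using z1 d by (intro sum_mono mult_left_mono power_increasing) auto
  also have "\<dots> = (\<Sum>i<degree p. norm (coeff p i)) * norm z ^ d"
    by (simp add: sum_distrib_right)
  also have "\<dots> < norm z * norm z ^ d"
    using z z1 by (intro mult_strict_right_mono zero_less_power) linarith+
  finally show False by (simp add: d)
qed

text \<open>Here \<open>G n\<close> is the \<open>n\<close>-th derivative \<open>D\<^sub>t\<^sup>n\<close> of a solution. The function \<open>G' 0 = (D\<^sub>t - \<tau>\<^sub>k) G 0\<close> solves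
  the equation without the factor for \<open>k\<close>, and \<open>G 0\<close> is regained from it by integrating
  \<open>e\<^bsup>i\<tau>(t-s)\<^esup> G' 0 (s)\<close>, \<open>\<tau> = \<tau>\<^sub>k\<close>, over \<open>[0, t]\<close>; the integrand is bounded by \<open>e\<^bsup>-\<delta>t\<^esup>\<close> times a power of
  \<open>1 + t\<close>, so the integration adds one power. The sign \<open>\<sigma>\<close> treats both directions of time.\<close>

lemma ode_decay_bound:
  fixes G :: "nat \<Rightarrow> real \<Rightarrow> complex"
  assumes "finite S"
    and "\<And>n t. (G n has_vector_derivative \<i> * G (Suc n) t) (at t)"
    and "\<And>t. shift_op (\<Prod>k\<in>S. [:- \<tau> k, 1:]) (\<lambda>n. G n t) = (\<lambda>n. 0)"
    and "\<And>k. k \<in> S \<Longrightarrow> norm (\<tau> k) \<le> B" "\<And>k. k \<in> S \<Longrightarrow> \<delta> \<le> \<sigma> * Im (\<tau> k)"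
    and "\<And>n. n < card S \<Longrightarrow> norm (G n 0) \<le> K" "0 \<le> K" "0 \<le> B"
    and "\<bar>\<sigma>\<bar> = 1" "0 \<le> t"
  shows "norm (G 0 (\<sigma> * t)) \<le> K * (1 + B) ^ card S * (1 + t) ^ (card S - 1) * exp (- \<delta> * t)"
  using assms
proof (induction S arbitrary: G K t rule: finite_induct)
  case empty
  have "G 0 (\<sigma> * t) = 0" using empty.prems(2)[of "\<sigma> * t"] by (simp add: fun_eq_iff)
  then show ?case using empty.prems by simp
next
  case (insert k S)
  note dG = insert.prems(1) and kill = insert.prems(2)
  define c where "c = card S"
  define G' where "G' n t = G (Suc n) t - \<tau> k * G n t" for n t
  have G'_shift: "G' n t = shift_op [:- \<tau> k, 1:] (\<lambda>n. G n t) n" for n t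
    by (simp add: G'_def shift_op_pCons)
  have B: "norm (\<tau> k) \<le> B" and \<delta>: "\<delta> \<le> \<sigma> * Im (\<tau> k)"
    using insert.prems by auto
  have init: "norm (G n 0) \<le> K" if "n \<le> c" for n
    using insert.prems(5)[of n] that insert.hyps by (simp add: c_def)
  have G'_bound: "norm (G' 0 (\<sigma> * s)) \<le> K * (1 + B) * (1 + B) ^ c * (1 + s) ^ (c - 1) * exp (- \<delta> * s)"
    if "0 \<le> s" for s
    unfolding c_def
  proof (rule insert.IH[of G' "K * (1 + B)" s])
    show "(G' n has_vector_derivative \<i> * G' (Suc n) t) (at t)" for n t
      unfolding G'_def by (auto intro!: derivative_eq_intros dG simp: algebra_simps)
    show "shift_op (\<Prod>k\<in>S. [:- \<tau> k, 1:]) (\<lambda>n. G' n t) = (\<lambda>n. 0)" for t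
    proof -
      have "(\<lambda>n. G' n t) = shift_op [:- \<tau> k, 1:] (\<lambda>n. G n t)"
        by (rule ext) (rule G'_shift)
      then show ?thesis
        using kill[of t, unfolded prod.insert[OF insert.hyps] shift_op_mult]
        by (simp only: shift_op_commute[of "\<Prod>k\<in>S. [:- \<tau> k, 1:]" "[:- \<tau> k, 1:]"])
    qed
    show "norm (G' n 0) \<le> K * (1 + B)" if "n < card S" for n
    proof -
      have "norm (G' n 0) \<le> norm (G (Suc n) 0) + norm (\<tau> k) * norm (G n 0)"
        unfolding G'_def by (metis norm_mult norm_triangle_ineq4)
      also have "\<dots> \<le> K + B * K"
        using init[of n] init[of "Suc n"] that B insert.prems(6,7)
        by (intro add_mono mult_mono) (auto simp: c_def)
      finally show ?thesis by (simp add: algebra_simps)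
    qed
  qed (use insert.prems that in auto)
  have G'_zero: "G' 0 s = 0" if "c = 0" for s
    using kill[of s] that insert.hyps by (simp add: G'_shift c_def fun_eq_iff shift_op_pCons)
  \<comment> \<open>\<open>\<phi>\<close> interpolates between \<open>G 0 (\<sigma> * t)\<close>, at \<open>s = t\<close>, and a multiple of \<open>G 0 0\<close>, at \<open>s = 0\<close>, and its derivative
    only involves \<open>G' 0\<close>\<close>
  define \<phi> where "\<phi> s = exp (\<i> * \<tau> k * of_real (\<sigma> * (t - s))) * G 0 (\<sigma> * s)" for s
  \<comment> \<open>for \<open>c = 0\<close> the function \<open>G' 0\<close> vanishes, and the truncated difference \<open>c - 1 = 0\<close> would give a bound
    that is one power of \<open>1 + t\<close> too large\<close>
  define M where "M = K * (1 + B) ^ Suc c * (if c = 0 then 0 else (1 + t) ^ (c - 1)) * exp (- \<delta> * t)"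
  have exp_bound: "norm (exp (\<i> * \<tau> k * of_real (\<sigma> * (t - s)))) \<le> exp (- \<delta> * (t - s))" if "s \<le> t" for s
    using mult_right_mono[OF \<delta>, of "t - s"] that by (simp add: norm_exp_eq_Re algebra_simps)
  have "norm (\<phi> t - \<phi> 0) \<le> M * \<bar>t - 0\<bar>"
  proof (rule has_vector_derivative_bound[where S="{0..t}"
        and f'="\<lambda>s. \<i> * of_real \<sigma> * (exp (\<i> * \<tau> k * of_real (\<sigma> * (t - s))) * G' 0 (\<sigma> * s))"])
    fix s assume s: "s \<in> {0..t}"
    have dG\<sigma>: "((\<lambda>s. G 0 (\<sigma> * s)) has_vector_derivative of_real \<sigma> * (\<i> * G 1 (\<sigma> * s))) (at s within {0..t})"
    proof -
      have "((G 0 \<circ> (\<lambda>s. \<sigma> * s)) has_vector_derivative \<sigma> *\<^sub>R (\<i> * G (Suc 0) (\<sigma> * s))) (at s within {0..t})"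
        by (rule vector_diff_chain_within)
          (auto intro!: derivative_eq_intros has_vector_derivative_at_within[OF dG]
            simp flip: has_real_derivative_iff_has_vector_derivative)
      then show ?thesis by (simp add: o_def scaleR_conv_of_real)
    qed
    have dexp: "((\<lambda>s. exp (\<i> * \<tau> k * of_real (\<sigma> * (t - s)))) has_vector_derivative
        - (\<i> * \<tau> k * of_real \<sigma>) * exp (\<i> * \<tau> k * of_real (\<sigma> * (t - s)))) (at s within {0..t})"
    proof -
      have "((\<lambda>z. exp (\<i> * \<tau> k * (of_real \<sigma> * (of_real t - z)))) has_field_derivative
          - (\<i> * \<tau> k * of_real \<sigma>) * exp (\<i> * \<tau> k * (of_real \<sigma> * (of_real t - of_real s)))) (at (of_real s))"
        by (auto intro!: derivative_eq_intros)
      from has_vector_derivative_real_field[OF this, of "{0..t}"] show ?thesis by simp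
    qed
    show "(\<phi> has_vector_derivative
        \<i> * of_real \<sigma> * (exp (\<i> * \<tau> k * of_real (\<sigma> * (t - s))) * G' 0 (\<sigma> * s))) (at s within {0..t})"
      unfolding \<phi>_def G'_def
      by (rule has_vector_derivative_eq_rhs[OF has_vector_derivative_mult[OF dexp dG\<sigma>]])
        (simp add: algebra_simps)
    have "norm (exp (\<i> * \<tau> k * of_real (\<sigma> * (t - s))) * G' 0 (\<sigma> * s)) \<le> M"
    proof (cases "c = 0")
      case False
      have "norm (exp (\<i> * \<tau> k * of_real (\<sigma> * (t - s))) * G' 0 (\<sigma> * s))
          \<le> exp (- \<delta> * (t - s)) * (K * (1 + B) * (1 + B) ^ c * (1 + s) ^ (c - 1) * exp (- \<delta> * s))"
        unfolding norm_mult using s exp_bound G'_bound by (intro mult_mono) auto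
      also have "\<dots> = K * (1 + B) * (1 + B) ^ c * (1 + s) ^ (c - 1) * (exp (- \<delta> * (t - s)) * exp (- \<delta> * s))"
        by (simp only: mult_ac)
      also have "exp (- \<delta> * (t - s)) * exp (- \<delta> * s) = exp (- \<delta> * t)"
        by (simp add: algebra_simps flip: exp_add)
      also have "K * (1 + B) * (1 + B) ^ c = K * (1 + B) ^ Suc c"
        by simp
      also have "K * (1 + B) ^ Suc c * (1 + s) ^ (c - 1) * exp (- \<delta> * t)
          \<le> K * (1 + B) ^ Suc c * (1 + t) ^ (c - 1) * exp (- \<delta> * t)"
        using s insert.prems by (intro mult_right_mono mult_left_mono power_mono) auto
      finally show ?thesis using False by (simp add: M_def)
    qed (simp add: G'_zero M_def)
    then show "norm (\<i> * of_real \<sigma> * (exp (\<i> * \<tau> k * of_real (\<sigma> * (t - s))) * G' 0 (\<sigma> * s))) \<le> M"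
      using insert.prems by (simp add: norm_mult)
  qed (use insert.prems in auto)
  moreover have "norm (\<phi> 0) \<le> exp (- \<delta> * t) * K"
    unfolding \<phi>_def norm_mult using exp_bound[of 0] init[of 0] insert.prems by (intro mult_mono) auto
  moreover have "\<phi> t = G 0 (\<sigma> * t)" by (simp add: \<phi>_def)
  ultimately have "norm (G 0 (\<sigma> * t)) \<le> exp (- \<delta> * t) * K + M * t"
    using insert.prems norm_triangle_ineq2[of "\<phi> t" "\<phi> 0"] by auto
  also have "\<dots> \<le> K * (1 + B) ^ Suc c * (1 + t) ^ c * exp (- \<delta> * t)"
  proof -
    define b where "b = (1 + B) ^ Suc c"
    have b: "b \<ge> 1" unfolding b_def using insert.prems by (intro one_le_power) auto
    have "K + K * b * (if c = 0 then 0 else (1 + t) ^ (c - 1)) * t \<le> K * b * (1 + t) ^ c"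
    proof (cases c)
      case 0
      then show ?thesis using b insert.prems by (simp add: mult_left_le mult_le_cancel_left1)
    next
      case (Suc d)
      have p: "(1 + t) ^ d \<ge> 1" using insert.prems by (intro one_le_power) auto
      have "K \<le> K * b" using b insert.prems by (simp add: mult_le_cancel_left1)
      also have "\<dots> \<le> K * b * (1 + t) ^ d"
        using mult_left_mono[OF p, of "K * b"] b insert.prems by simp
      finally show ?thesis using Suc by (simp add: algebra_simps)
    qed
    then have "(K + K * b * (if c = 0 then 0 else (1 + t) ^ (c - 1)) * t) * exp (- \<delta> * t)
        \<le> K * b * (1 + t) ^ c * exp (- \<delta> * t)" by (rule mult_right_mono) simp
    then show ?thesis by (simp add: M_def b_def algebra_simps)
  qed
  finally show ?case using insert.hyps by (simp add: c_def)
qed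

section \<open>The full symbol as a polynomial in the time frequency\<close>

lemma full_form_add: "full_form m P c \<xi> (\<lambda>r. y r + y' r) = full_form m P c \<xi> y + full_form m P c \<xi> y'"
  by (simp add: full_form_def principal_form_def sum.distrib distrib_left case_prod_unfold)

lemma full_form_scale: "full_form m P c \<xi> (\<lambda>r. b * y r) = b * full_form m P c \<xi> y"
  by (simp add: full_form_def principal_form_def sum_distrib_left distrib_left case_prod_unfold mult_ac)

lemma full_form_sum:
  "finite S \<Longrightarrow> full_form m P c \<xi> (\<lambda>r. \<Sum>i\<in>S. y i * e i r) = (\<Sum>i\<in>S. y i * full_form m P c \<xi> (e i))"
proof (induction S rule: finite_induct)
  case empty
  show ?case using full_form_scale[of m P c \<xi> 0 "\<lambda>_. 0"] by simp
qed (simp add: full_form_add full_form_scale)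

lemma full_form_cong:
  assumes "\<And>r. r \<le> m \<Longrightarrow> y r = y' r"
  shows "full_form m P c \<xi> y = full_form m P c \<xi> y'"
  unfolding full_form_def principal_form_def
  using assms by (intro arg_cong2[where f="(+)"] sum.cong) auto

lemma continuous_mpow: "continuous_on UNIV (\<lambda>\<xi>. mpow \<xi> \<alpha>)"
  unfolding mpow_def by (intro continuous_intros)

lemma continuous_full_form:
  assumes "\<And>i. i \<in> {1..m} \<Longrightarrow> homogeneous_poly i (P i)"
  shows "continuous_on UNIV (\<lambda>\<xi>. full_form m P c \<xi> y)"
proof -
  have "continuous_on UNIV (P i)" if i: "i \<in> {1..m}" for i
  proof -
    obtain a where "P i = (\<lambda>\<xi>. \<Sum>\<alpha> | mdeg \<alpha> = i. a \<alpha> * mpow \<xi> \<alpha>)"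
      using assms[OF i] by (auto simp: homogeneous_poly_def fun_eq_iff)
    then show ?thesis by (auto intro!: continuous_intros continuous_mpow)
  qed
  then show ?thesis
    unfolding full_form_def principal_form_def case_prod_unfold
    by (intro continuous_intros continuous_mpow) auto
qed

text \<open>The coefficient of \<open>\<tau>\<^sup>i\<close> in the full symbol, extracted by inserting the \<open>i\<close>-th unit vector for the
  powers of \<open>\<tau>\<close>.\<close>

definition form_coeff where
  "form_coeff m P c i \<xi> = full_form m P c \<xi> (\<lambda>r. if r = i then 1 else 0)"

lemma full_form_eq_form_coeff: "full_form m P c \<xi> y = (\<Sum>i\<le>m. form_coeff m P c i \<xi> * y i)"
proof -
  have "full_form m P c \<xi> y = full_form m P c \<xi> (\<lambda>r. \<Sum>i\<le>m. y i * (if r = i then 1 else 0))"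
    by (rule full_form_cong) (simp add: if_distrib cong: if_cong)
  then show ?thesis by (simp only: full_form_sum[OF finite_atMost] form_coeff_def mult.commute)
qed

lemma coeff_full_symbol:
  assumes "characteristic_roots m P c \<tau>"
  shows "coeff (\<Prod>k=1..m. [:- \<tau> k \<xi>, 1:]) i = (if i \<le> m then form_coeff m P c i \<xi> else 0)"
proof -
  have "poly (\<Prod>k=1..m. [:- \<tau> k \<xi>, 1:]) z = poly (\<Sum>i\<le>m. monom (form_coeff m P c i \<xi>) i) z" for z
    using assms by (simp add: characteristic_roots_def full_symbol_def full_form_eq_form_coeff
        poly_prod poly_sum poly_monom flip: diff_conv_add_uminus)
  then have "(\<Prod>k=1..m. [:- \<tau> k \<xi>, 1:]) = (\<Sum>i\<le>m. monom (form_coeff m P c i \<xi>) i)"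
    using poly_eq_poly_eq_iff by blast
  then show ?thesis by (simp add: coeff_sum)
qed

lemma linear_factors_monic:
  fixes a :: "'k \<Rightarrow> complex"
  shows "degree (\<Prod>k\<in>S. [:- a k, 1:]) = card S" "lead_coeff (\<Prod>k\<in>S. [:- a k, 1:]) = 1"
  by (simp add: degree_prod_eq_sum_degree, subst lead_coeff_prod, simp)

lemma poly_linear_factors: "poly (\<Prod>k\<in>S. [:- a k, 1:]) z = (\<Prod>k\<in>S. z - (a k :: complex))"
  by (simp add: poly_prod)

lemma shift_op_full_symbol:
  assumes "characteristic_roots m P c \<tau>"
  shows "shift_op (\<Prod>k=1..m. [:- \<tau> k \<xi>, 1:]) y 0 = full_form m P c \<xi> y"
  by (simp add: shift_op_def linear_factors_monic(1) coeff_full_symbol[OF assms] full_form_eq_form_coeff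
      del: One_nat_def)

text \<open>Differentiating the equation \<open>p(D\<^sub>t) G = 0\<close> shows that all its derivatives hold as well.\<close>

lemma shift_op_derivatives:
  fixes G :: "nat \<Rightarrow> real \<Rightarrow> complex"
  assumes dG: "\<And>n t. (G n has_vector_derivative \<i> * G (Suc n) t) (at t)"
    and zero: "\<And>t. shift_op p (\<lambda>n. G n t) 0 = 0"
  shows "shift_op p (\<lambda>n. G n t) = (\<lambda>n. 0)"
proof
  show "shift_op p (\<lambda>n. G n t) n = 0" for n
  proof (induction n arbitrary: t)
    case (Suc n)
    have "((\<lambda>t. shift_op p (\<lambda>n. G n t) n) has_vector_derivative
        (\<Sum>i\<le>degree p. coeff p i * (\<i> * G (Suc (n + i)) t))) (at t)"
      unfolding shift_op_def by (intro has_vector_derivative_sum has_vector_derivative_mult_right dG)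
    moreover have "(\<lambda>t. shift_op p (\<lambda>n. G n t) n) = (\<lambda>t. 0)" using Suc by auto
    ultimately have "(\<Sum>i\<le>degree p. coeff p i * (\<i> * G (Suc (n + i)) t)) = 0"
      by (metis has_vector_derivative_const vector_derivative_unique_at)
    then have "\<i> * shift_op p (\<lambda>n. G n t) (Suc n) = 0"
      by (simp add: shift_op_def sum_distrib_left mult_ac)
    then show ?case by simp
  qed (rule zero)
qed

section \<open>The part of the fundamental solution carried by a group of roots\<close>

lemma group_part_eq_exp_poly:
  "group_part L \<tau> A t \<xi> = exp_poly {1..L} (\<lambda>k. \<tau> k \<xi>) (\<lambda>k. A k \<xi>) (of_real t)"
  by (simp add: group_part_def exp_poly_def)

locale separated_root_group =
  fixes m L j :: nat
    and P :: "nat \<Rightarrow> real ^ 'n::finite \<Rightarrow> complex"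
    and c :: "('n \<Rightarrow> nat) \<Rightarrow> nat \<Rightarrow> complex"
    and \<tau> :: "nat \<Rightarrow> real ^ 'n \<Rightarrow> complex"
    and A :: "nat \<Rightarrow> real ^ 'n \<Rightarrow> complex poly"
    and U :: "(real ^ 'n) set"
  assumes P: "\<And>i. i \<in> {1..m} \<Longrightarrow> homogeneous_poly i (P i)"
    and roots: "characteristic_roots m P c \<tau>"
    and E: "\<And>\<xi>. fundamental_solution m P c \<xi> j
      (\<lambda>t. exp_poly {1..m} (\<lambda>k. \<tau> k \<xi>) (\<lambda>k. A k \<xi>) (of_real t))"
    and L: "1 \<le> L" "L \<le> m"
    and U: "open U"
    and separated: "\<And>\<xi> k l. \<xi> \<in> U \<Longrightarrow> k \<in> {1..L} \<Longrightarrow> l \<in> {L+1..m} \<Longrightarrow> \<tau> k \<xi> \<noteq> \<tau> l \<xi>"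
    and cont: "continuous_root_group L \<tau> U"
begin

definition Q where "Q \<xi> = (\<Prod>k\<in>{1..L}. [:- \<tau> k \<xi>, 1:])"
definition R where "R \<xi> = (\<Prod>k\<in>{L+1..m}. [:- \<tau> k \<xi>, 1:])"

text \<open>\<open>D\<^sub>t\<^sup>n\<close> of the part of the fundamental solution carried by the roots with index in \<open>S\<close>.\<close>

definition deriv_part :: "nat set \<Rightarrow> nat \<Rightarrow> real \<Rightarrow> real ^ 'n \<Rightarrow> complex" where
  "deriv_part S n t \<xi> = exp_poly S (\<lambda>k. \<tau> k \<xi>) (\<lambda>k. (exp_D (\<tau> k \<xi>) ^^ n) (A k \<xi>)) (of_real t)"

text \<open>The part carried by the group of roots, the only one that enters the estimate.\<close>

abbreviation "g \<equiv> deriv_part {1..L}"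

lemma roots_split: "{1..m} = {1..L} \<union> {L+1..m}" "{1..L} \<inter> {L+1..m} = {}"
  using L by auto

lemma full_symbol_factor: "(\<Prod>k=1..m. [:- \<tau> k \<xi>, 1:]) = Q \<xi> * R \<xi>"
  unfolding Q_def R_def roots_split(1) by (rule prod.union_disjoint) auto

lemma deriv_part_split: "deriv_part {1..m} n t \<xi> = g n t \<xi> + deriv_part {L+1..m} n t \<xi>"
  unfolding deriv_part_def exp_poly_def roots_split(1) by (rule sum.union_disjoint) auto

lemma deriv_part_has_vector_derivative:
  "((\<lambda>t. deriv_part S n t \<xi>) has_vector_derivative \<i> * deriv_part S (Suc n) t \<xi>) (at t)"
  using exp_poly_has_vector_derivative[of S "\<lambda>k. \<tau> k \<xi>" "\<lambda>k. (exp_D (\<tau> k \<xi>) ^^ n) (A k \<xi>)" t]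
  by (simp add: deriv_part_def)

lemma Dt_funpow_solution:
  "(Dt ^^ n) (\<lambda>t. exp_poly S (\<lambda>k. \<tau> k \<xi>) (\<lambda>k. A k \<xi>) (of_real t)) t = deriv_part S n t \<xi>"
  by (simp add: Dt_funpow_exp_poly deriv_part_def)

lemma solution_annihilated:
  "shift_op (\<Prod>k=1..m. [:- \<tau> k \<xi>, 1:]) (\<lambda>n. deriv_part {1..m} n t \<xi>) = (\<lambda>n. 0)"
proof (rule shift_op_derivatives[of "\<lambda>n t. deriv_part {1..m} n t \<xi>"])
  show "shift_op (\<Prod>k=1..m. [:- \<tau> k \<xi>, 1:]) (\<lambda>n. deriv_part {1..m} n t \<xi>) 0 = 0" for t
    unfolding shift_op_full_symbol[OF roots]
    using E[of \<xi>] by (simp only: fundamental_solution_def Dt_funpow_solution)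
qed (rule deriv_part_has_vector_derivative)

lemma coprime_QR: "\<xi> \<in> U \<Longrightarrow> coprime (Q \<xi>) (R \<xi>)"
  unfolding Q_def R_def by (rule coprime_linear_factors) (use separated in auto)

text \<open>Applied at each fixed time \<open>t\<close> to the jets of the two parts, whose sum is annihilated by the full
  symbol \<open>Q R\<close>.\<close>

lemma parts_annihilated:
  assumes "\<xi> \<in> U"
  shows "shift_op (Q \<xi>) (\<lambda>n. g n t \<xi>) = (\<lambda>n. 0)"
    and "shift_op (R \<xi>) (\<lambda>n. deriv_part {L+1..m} n t \<xi>) = (\<lambda>n. 0)"
proof -
  obtain N1 where N1: "\<And>N z. N \<ge> N1 \<Longrightarrow> shift_op (Q \<xi> ^ N) (\<lambda>n. exp_poly {1..L} (\<lambda>k. \<tau> k \<xi>)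
      (\<lambda>k. (exp_D (\<tau> k \<xi>) ^^ n) (A k \<xi>)) z) = (\<lambda>n. 0)"
    unfolding Q_def using exp_poly_annihilated[of "{1..L}" "\<lambda>k. \<tau> k \<xi>" "\<lambda>k. A k \<xi>"] by auto
  obtain N2 where N2: "\<And>N z. N \<ge> N2 \<Longrightarrow> shift_op (R \<xi> ^ N) (\<lambda>n. exp_poly {L+1..m} (\<lambda>k. \<tau> k \<xi>)
      (\<lambda>k. (exp_D (\<tau> k \<xi>) ^^ n) (A k \<xi>)) z) = (\<lambda>n. 0)"
    unfolding R_def using exp_poly_annihilated[of "{L+1..m}" "\<lambda>k. \<tau> k \<xi>" "\<lambda>k. A k \<xi>"] by auto
  define N where "N = max N1 N2"
  have "shift_op (Q \<xi> * R \<xi>) (\<lambda>n. g n t \<xi> + deriv_part {L+1..m} n t \<xi>) = (\<lambda>n. 0)"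
    using solution_annihilated[of \<xi> t] unfolding full_symbol_factor deriv_part_split .
  moreover have "shift_op (Q \<xi> ^ N) (\<lambda>n. g n t \<xi>) = (\<lambda>n. 0)"
    unfolding deriv_part_def by (rule N1) (simp add: N_def)
  moreover have "shift_op (R \<xi> ^ N) (\<lambda>n. deriv_part {L+1..m} n t \<xi>) = (\<lambda>n. 0)"
    unfolding deriv_part_def by (rule N2) (simp add: N_def)
  ultimately show "shift_op (Q \<xi>) (\<lambda>n. g n t \<xi>) = (\<lambda>n. 0)"
    and "shift_op (R \<xi>) (\<lambda>n. deriv_part {L+1..m} n t \<xi>) = (\<lambda>n. 0)"
    using shift_op_split_coprime[OF coprime_QR[OF assms]] by blast+
qed

lemma degree_Q: "degree (Q \<xi>) = L" "lead_coeff (Q \<xi>) = 1"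
  by (simp add: Q_def linear_factors_monic(1)) (unfold Q_def, rule linear_factors_monic(2))

lemma degree_R: "degree (R \<xi>) = m - L"
  unfolding R_def linear_factors_monic by auto

lemma continuous_symbol_coeff: "continuous_on UNIV (\<lambda>\<xi>. coeff (\<Prod>k=1..m. [:- \<tau> k \<xi>, 1:]) i)"
proof -
  have "continuous_on UNIV (\<lambda>\<xi>. form_coeff m P c i \<xi>)"
    unfolding form_coeff_def by (rule continuous_full_form) (use P in auto)
  then show ?thesis unfolding coeff_full_symbol[OF roots] by (cases "i \<le> m") simp_all
qed

lemma continuous_symbol: "continuous_on UNIV (\<lambda>\<xi>. poly (\<Prod>k=1..m. [:- \<tau> k \<xi>, 1:]) z)"
  unfolding poly_altdef linear_factors_monic
  by (intro continuous_intros continuous_symbol_coeff)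

lemma Q_tendsto:
  assumes "\<xi> \<in> U"
  shows "((\<lambda>\<eta>. poly (Q \<eta>) z) \<longlongrightarrow> poly (Q \<xi>) z) (at \<xi>)"
  using cont U assms unfolding continuous_root_group_def Q_def poly_linear_factors
  by (simp add: continuous_on_eq_continuous_at isCont_def)

lemma continuous_coeff_Q: "continuous_on U (\<lambda>\<xi>. coeff (Q \<xi>) i)"
  unfolding continuous_on_eq_continuous_at[OF U] isCont_def
  by (intro ballI coeff_tendsto[where d=L and Z="{}"]) (auto simp: degree_Q Q_tendsto)

text \<open>At every \<open>z\<close> that is not a root of \<open>Q \<xi>\<close> the quotient of the full symbol by \<open>Q\<close> is continuous in the
  parameter at \<open>\<xi>\<close>; finitely many excluded points do no harm.\<close>

lemma continuous_coeff_R: "continuous_on U (\<lambda>\<xi>. coeff (R \<xi>) i)"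
  unfolding continuous_on_eq_continuous_at[OF U] isCont_def
proof (intro ballI coeff_tendsto[where d="m - L"])
  fix \<xi> assume \<xi>: "\<xi> \<in> U"
  have "Q \<xi> \<noteq> 0" using degree_Q[of \<xi>] by auto
  then show "finite {z. poly (Q \<xi>) z = 0}" by (rule poly_roots_finite)
  fix z assume "z \<notin> {z. poly (Q \<xi>) z = 0}"
  then have z: "poly (Q \<xi>) z \<noteq> 0" by simp
  have div: "poly (Q \<eta>) z \<noteq> 0 \<Longrightarrow> poly (\<Prod>k=1..m. [:- \<tau> k \<eta>, 1:]) z / poly (Q \<eta>) z = poly (R \<eta>) z" for \<eta>
    unfolding full_symbol_factor by simp
  have "((\<lambda>\<eta>. poly (\<Prod>k=1..m. [:- \<tau> k \<eta>, 1:]) z / poly (Q \<eta>) z) \<longlongrightarrow>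
      poly (\<Prod>k=1..m. [:- \<tau> k \<xi>, 1:]) z / poly (Q \<xi>) z) (at \<xi>)"
    by (intro tendsto_divide Q_tendsto \<xi> z)
      (use continuous_symbol[of z] in \<open>simp add: continuous_on_eq_continuous_at isCont_def\<close>)
  then have "((\<lambda>\<eta>. poly (\<Prod>k=1..m. [:- \<tau> k \<eta>, 1:]) z / poly (Q \<eta>) z) \<longlongrightarrow> poly (R \<xi>) z) (at \<xi>)"
    unfolding div[OF z] .
  moreover have "\<forall>\<^sub>F \<eta> in at \<xi>. poly (Q \<eta>) z \<noteq> 0"
    by (rule tendsto_imp_eventually_ne[OF Q_tendsto[OF \<xi>] z])
  then have "\<forall>\<^sub>F \<eta> in at \<xi>. poly (\<Prod>k=1..m. [:- \<tau> k \<eta>, 1:]) z / poly (Q \<eta>) z = poly (R \<eta>) z"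
    by eventually_elim (rule div)
  ultimately show "((\<lambda>\<eta>. poly (R \<eta>) z) \<longlongrightarrow> poly (R \<xi>) z) (at \<xi>)"
    by (rule Lim_transform_eventually)
qed (simp_all add: degree_R)

lemma continuous_solution_0: "continuous_on UNIV (\<lambda>\<xi>. deriv_part {1..m} n 0 \<xi>)"
proof (rule continuous_recurrence[where p="\<lambda>\<xi>. \<Prod>k=1..m. [:- \<tau> k \<xi>, 1:]" and L=m
      and a="\<lambda>\<xi> n. deriv_part {1..m} n 0 \<xi>"])
  show "degree (\<Prod>k=1..m. [:- \<tau> k \<xi>, 1:]) = m \<and> lead_coeff (\<Prod>k=1..m. [:- \<tau> k \<xi>, 1:]) = 1" for \<xi>
    using linear_factors_monic[of "\<lambda>k. \<tau> k \<xi>" "{1..m}"] by simp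
  show "shift_op (\<Prod>k=1..m. [:- \<tau> k \<xi>, 1:]) (\<lambda>n. deriv_part {1..m} n 0 \<xi>) = (\<lambda>n. 0)" for \<xi>
    by (rule solution_annihilated)
  fix n assume n: "n < m"
  have "deriv_part {1..m} n 0 \<xi> = (if n = j then 1 else 0)" for \<xi>
    using E[of \<xi>] n by (simp only: fundamental_solution_def Dt_funpow_solution)
  then show "continuous_on UNIV (\<lambda>\<xi>. deriv_part {1..m} n 0 \<xi>)" by simp
qed (rule continuous_symbol_coeff)

lemma continuous_g_0: "continuous_on U (\<lambda>\<xi>. g n 0 \<xi>)"
proof (rule continuous_coprime_component[where Q=Q and R=R and L=L and N="m - L"
      and g="\<lambda>\<xi> n. g n 0 \<xi>" and h="\<lambda>\<xi> n. deriv_part {L+1..m} n 0 \<xi>"])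
  show "continuous_on U (\<lambda>\<xi>. g n 0 \<xi> + deriv_part {L+1..m} n 0 \<xi>)" for n
    using continuous_on_subset[OF continuous_solution_0[of n] subset_UNIV] by (simp only: deriv_part_split)
  show "shift_op (Q \<xi>) (\<lambda>n. g n 0 \<xi>) = (\<lambda>n. 0)"
    "shift_op (R \<xi>) (\<lambda>n. deriv_part {L+1..m} n 0 \<xi>) = (\<lambda>n. 0)" if "\<xi> \<in> U" for \<xi>
    by (rule parts_annihilated[OF that])+
qed (auto simp: U continuous_coeff_Q continuous_coeff_R degree_Q(1) degree_Q(2)[unfolded degree_Q(1)]
    degree_R coprime_QR)

lemma g_taylor: "(\<lambda>l. (\<i> * of_real t) ^ l / fact l * g (n + l) 0 \<xi>) sums g n t \<xi>"
  using exp_poly_taylor[of "of_real t" "{1..L}" "\<lambda>k. \<tau> k \<xi>" "\<lambda>k. (exp_D (\<tau> k \<xi>) ^^ n) (A k \<xi>)"]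
  by (simp add: deriv_part_def funpow_add add.commute[of n])

text \<open>The numbering of the roots may depend on \<open>\<xi>\<close> in an irregular way, but \<open>g n t\<close> is a pointwise limit of
  Taylor polynomials in \<open>t\<close>, whose coefficients are continuous in \<open>\<xi>\<close>.\<close>

lemma g_borel_measurable: "(\<lambda>\<xi>. indicator U \<xi> * g n t \<xi>) \<in> borel_measurable borel"
proof (rule borel_measurable_LIMSEQ_metric)
  show "(\<lambda>N. indicator U \<xi> * (\<Sum>l<N. (\<i> * of_real t) ^ l / fact l * g (n + l) 0 \<xi>))
      \<longlonglongrightarrow> indicator U \<xi> * g n t \<xi>" for \<xi>
    using g_taylor[of t n \<xi>] unfolding sums_def by (intro tendsto_mult_left)
  fix N
  have "continuous_on U (\<lambda>\<xi>. \<Sum>l<N. (\<i> * of_real t) ^ l / fact l * g (n + l) 0 \<xi>)"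
    by (intro continuous_intros continuous_g_0)
  then have "(\<lambda>\<xi>. indicator U \<xi> *\<^sub>R (\<Sum>l<N. (\<i> * of_real t) ^ l / fact l * g (n + l) 0 \<xi>)) \<in> borel_measurable borel"
    using U by (intro borel_measurable_continuous_on_indicator) auto
  moreover have "indicator U \<xi> * z = indicator U \<xi> *\<^sub>R z" for \<xi> and z :: complex
    by (simp add: indicator_def)
  ultimately show "(\<lambda>\<xi>. indicator U \<xi> * (\<Sum>l<N. (\<i> * of_real t) ^ l / fact l * g (n + l) 0 \<xi>)) \<in> borel_measurable borel"
    by presburger
qed

lemma roots_bounded_on_compact:
  assumes "compact K" "K \<subseteq> U"
  obtains B where "B \<ge> 0" "\<And>\<xi> k. \<xi> \<in> K \<Longrightarrow> k \<in> {1..L} \<Longrightarrow> norm (\<tau> k \<xi>) \<le> B"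
proof -
  have "continuous_on K (\<lambda>\<xi>. 1 + (\<Sum>i<L. norm (coeff (Q \<xi>) i)))"
    by (intro continuous_intros continuous_on_subset[OF continuous_coeff_Q assms(2)])
  then have "bounded ((\<lambda>\<xi>. 1 + (\<Sum>i<L. norm (coeff (Q \<xi>) i))) ` K)"
    using assms(1) compact_continuous_image compact_imp_bounded by blast
  then obtain B where B: "B > 0" "\<And>\<xi>. \<xi> \<in> K \<Longrightarrow> \<bar>1 + (\<Sum>i<L. norm (coeff (Q \<xi>) i))\<bar> \<le> B"
    by (auto simp: bounded_pos)
  have "norm (\<tau> k \<xi>) \<le> B" if "\<xi> \<in> K" "k \<in> {1..L}" for \<xi> k
  proof -
    have "poly (Q \<xi>) (\<tau> k \<xi>) = 0"
      unfolding Q_def poly_linear_factors using that by (intro prod_zero) auto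
    then have "norm (\<tau> k \<xi>) \<le> 1 + (\<Sum>i<L. norm (coeff (Q \<xi>) i))"
      using monic_poly_root_bound[of "Q \<xi>" "\<tau> k \<xi>"] degree_Q[of \<xi>] by simp
    then show ?thesis using B(2)[OF that(1)] by linarith
  qed
  then show ?thesis using B(1) that[of B] by simp
qed

lemma initial_values_bounded_on_compact:
  assumes "compact K" "K \<subseteq> U"
  obtains C where "C \<ge> 0" "\<And>\<xi> l. \<xi> \<in> K \<Longrightarrow> l < L \<Longrightarrow> norm (g (n + l) 0 \<xi>) \<le> C"
proof -
  have "continuous_on K (\<lambda>\<xi>. \<Sum>l<L. norm (g (n + l) 0 \<xi>))"
    by (intro continuous_intros continuous_on_subset[OF continuous_g_0 assms(2)])
  then have "bounded ((\<lambda>\<xi>. \<Sum>l<L. norm (g (n + l) 0 \<xi>)) ` K)"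
    using assms(1) compact_continuous_image compact_imp_bounded by blast
  then obtain C where C: "C > 0" "\<And>\<xi>. \<xi> \<in> K \<Longrightarrow> \<bar>\<Sum>l<L. norm (g (n + l) 0 \<xi>)\<bar> \<le> C"
    by (auto simp: bounded_pos)
  have "norm (g (n + l) 0 \<xi>) \<le> C" if "\<xi> \<in> K" "l < L" for \<xi> l
  proof -
    have "norm (g (n + l) 0 \<xi>) \<le> (\<Sum>l<L. norm (g (n + l) 0 \<xi>))"
      using that by (intro member_le_sum[of l "{..<L}" "\<lambda>l. norm (g (n + l) 0 \<xi>)"]) auto
    then show ?thesis using C(2)[OF that(1)] by linarith
  qed
  then show ?thesis using C(1) that[of C] by simp
qed

lemma g_bound_direction:
  assumes "compact K" "K \<subseteq> U" "\<bar>\<sigma>\<bar> = 1"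
    and "\<And>\<xi> k. \<xi> \<in> K \<Longrightarrow> k \<in> {1..L} \<Longrightarrow> \<delta> \<le> \<sigma> * Im (\<tau> k \<xi>)"
  obtains C where "C \<ge> 0"
    "\<And>\<xi> t. \<xi> \<in> K \<Longrightarrow> t \<ge> 0 \<Longrightarrow> norm (g n (\<sigma> * t) \<xi>) \<le> C * (1 + t) ^ (L - 1) * exp (- \<delta> * t)"
proof -
  obtain B where B: "B \<ge> 0" "\<And>\<xi> k. \<xi> \<in> K \<Longrightarrow> k \<in> {1..L} \<Longrightarrow> norm (\<tau> k \<xi>) \<le> B"
    using roots_bounded_on_compact[OF assms(1,2)] by blast
  obtain C where C: "C \<ge> 0" "\<And>\<xi> l. \<xi> \<in> K \<Longrightarrow> l < L \<Longrightarrow> norm (g (n + l) 0 \<xi>) \<le> C"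
    using initial_values_bounded_on_compact[OF assms(1,2)] by blast
  have "norm (g n (\<sigma> * t) \<xi>) \<le> C * (1 + B) ^ L * (1 + t) ^ (L - 1) * exp (- \<delta> * t)"
    if "\<xi> \<in> K" "t \<ge> 0" for \<xi> t
  proof -
    have "shift_op (Q \<xi>) (\<lambda>l. g (n + l) s \<xi>) = (\<lambda>l. 0)" for s
    proof
      fix l
      have "shift_op (Q \<xi>) (\<lambda>l. g (n + l) s \<xi>) l = shift_op (Q \<xi>) (\<lambda>l. g l s \<xi>) (n + l)"
        by (simp add: shift_op_def add.assoc)
      then show "shift_op (Q \<xi>) (\<lambda>l. g (n + l) s \<xi>) l = 0"
        using parts_annihilated(1)[of \<xi> s] that assms by auto
    qed
    then have "norm (g (n + 0) (\<sigma> * t) \<xi>)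
        \<le> C * (1 + B) ^ card {1..L} * (1 + t) ^ (card {1..L} - 1) * exp (- \<delta> * t)"
      using B C assms that unfolding Q_def
      by (intro ode_decay_bound[where G="\<lambda>l t. g (n + l) t \<xi>" and \<tau>="\<lambda>k. \<tau> k \<xi>"])
        (auto intro: deriv_part_has_vector_derivative simp del: One_nat_def)
    then show ?thesis by simp
  qed
  then show ?thesis using B C that[of "C * (1 + B) ^ L"] by simp
qed

lemma g_decay:
  assumes "compact K" "K \<subseteq> U" "\<And>\<xi> k. \<xi> \<in> K \<Longrightarrow> k \<in> {1..L} \<Longrightarrow> \<delta> \<le> Im (\<tau> k \<xi>)"
  obtains C where "C \<ge> 0"
    "\<And>\<xi> t. \<xi> \<in> K \<Longrightarrow> t \<ge> 0 \<Longrightarrow> norm (g n t \<xi>) \<le> C * (1 + t) ^ (L - 1) * exp (- \<delta> * t)"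
  using g_bound_direction[of K 1 \<delta> n] assms by auto

text \<open>Uniform bounds for all times in a bounded interval, past times included; they dominate the integrals
  that are differentiated in time. The bound on the roots serves as (possibly negative) rate in both
  directions of time.\<close>

lemma g_locally_bounded:
  assumes "compact K" "K \<subseteq> U"
  obtains C where "C \<ge> 0" "\<And>\<xi> t. \<xi> \<in> K \<Longrightarrow> \<bar>t\<bar> \<le> T \<Longrightarrow> norm (g n t \<xi>) \<le> C"
proof -
  obtain B where B: "B \<ge> 0" "\<And>\<xi> k. \<xi> \<in> K \<Longrightarrow> k \<in> {1..L} \<Longrightarrow> norm (\<tau> k \<xi>) \<le> B"
    using roots_bounded_on_compact[OF assms(1,2)] by blast
  have Im: "\<bar>Im (\<tau> k \<xi>)\<bar> \<le> B" if "\<xi> \<in> K" "k \<in> {1..L}" for \<xi> k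
    using B(2)[OF that] abs_Im_le_cmod[of "\<tau> k \<xi>"] by linarith
  have Im1: "- B \<le> 1 * Im (\<tau> k \<xi>)" "- B \<le> (- 1) * Im (\<tau> k \<xi>)" if "\<xi> \<in> K" "k \<in> {1..L}" for \<xi> k
    using Im[OF that] by auto
  obtain C1 where C1: "C1 \<ge> 0"
    "\<And>\<xi> t. \<xi> \<in> K \<Longrightarrow> t \<ge> 0 \<Longrightarrow> norm (g n (1 * t) \<xi>) \<le> C1 * (1 + t) ^ (L - 1) * exp (- (- B) * t)"
    using g_bound_direction[OF assms, of 1 "- B"] Im1(1) by auto
  obtain C2 where C2: "C2 \<ge> 0"
    "\<And>\<xi> t. \<xi> \<in> K \<Longrightarrow> t \<ge> 0 \<Longrightarrow> norm (g n ((- 1) * t) \<xi>) \<le> C2 * (1 + t) ^ (L - 1) * exp (- (- B) * t)"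
    using g_bound_direction[OF assms, of "- 1" "- B"] Im1(2) by auto
  define T' where "T' = max T 0"
  have mono: "C * (1 + t) ^ (L - 1) * exp (- (- B) * t) \<le> C * (1 + T') ^ (L - 1) * exp (B * T')"
    if "C \<ge> 0" "0 \<le> t" "t \<le> T'" for C t
    using that B(1) by (intro mult_mono mult_left_mono power_mono) (auto intro!: mult_left_mono)
  have "norm (g n t \<xi>) \<le> (C1 + C2) * (1 + T') ^ (L - 1) * exp (B * T')" if "\<xi> \<in> K" "\<bar>t\<bar> \<le> T" for \<xi> t
  proof -
    have "norm (g n t \<xi>) \<le> C1 * (1 + T') ^ (L - 1) * exp (B * T') \<or>
        norm (g n t \<xi>) \<le> C2 * (1 + T') ^ (L - 1) * exp (B * T')"
    proof (cases "t \<ge> 0")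
      case True
      then show ?thesis
        using C1(2)[OF that(1) True] mono[OF C1(1) True] that by (auto simp: T'_def)
    next
      case False
      then have "- t \<ge> 0" by simp
      then show ?thesis
        using C2(2)[OF that(1) \<open>- t \<ge> 0\<close>] mono[OF C2(1) \<open>- t \<ge> 0\<close>] that by (auto simp: T'_def)
    qed
    moreover have "C1 * (1 + T') ^ (L - 1) * exp (B * T') \<ge> 0" "C2 * (1 + T') ^ (L - 1) * exp (B * T') \<ge> 0"
      using C1 C2 by (auto simp: T'_def intro!: mult_nonneg_nonneg)
    ultimately show ?thesis by (auto simp: distrib_right)
  qed
  moreover have "(C1 + C2) * (1 + T') ^ (L - 1) * exp (B * T') \<ge> 0"
    using C1 C2 by (auto simp: T'_def intro!: mult_nonneg_nonneg)
  ultimately show ?thesis using that by blast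
qed

end

section \<open>The adjoint Fourier transform\<close>

text \<open>By the mean value inequality the remainders \<open>D s\<close> of the first order expansion, divided by
  \<open>|s - t|\<close>, are dominated by \<open>2 w\<close>.\<close>

lemma has_vector_derivative_lebesgue_integral:
  fixes f f' :: "real \<Rightarrow> 'a \<Rightarrow> complex"
  assumes int: "\<And>s. integrable M (f s)"
    and deriv: "\<And>s x. \<bar>s - t\<bar> < 1 \<Longrightarrow> ((\<lambda>s. f s x) has_vector_derivative f' s x) (at s)"
    and bound: "\<And>s x. \<bar>s - t\<bar> < 1 \<Longrightarrow> norm (f' s x) \<le> w x"
    and w: "integrable M w" and f': "integrable M (f' t)"
  shows "((\<lambda>s. LINT x|M. f s x) has_vector_derivative (LINT x|M. f' t x)) (at t)"
proof -
  define T where "T = {t - 1<..<t + 1}"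
  have T: "open T" "convex T" "t \<in> T" by (auto simp: T_def)
  have sT: "\<bar>s - t\<bar> < 1" if "s \<in> T" for s
    using that by (auto simp: T_def)
  define D where "D s x = (1 / norm (s - t)) *\<^sub>R (f s x - (f t x + (s - t) *\<^sub>R f' t x))" for s x
  have bd: "norm (f s x - f t x) \<le> w x * \<bar>s - t\<bar>" if "s \<in> T" for s x
    by (rule has_vector_derivative_bound[where S=T and f'="\<lambda>s. f' s x"])
      (use that T sT in \<open>auto intro: has_vector_derivative_at_within[OF deriv] bound\<close>)
  have D_bound: "norm (D s x) \<le> 2 * w x" if s: "s \<in> T - {t}" for s x
  proof -
    have "norm (f s x - (f t x + (s - t) *\<^sub>R f' t x)) \<le> norm (f s x - f t x) + norm ((s - t) *\<^sub>R f' t x)"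
      by (metis diff_diff_eq norm_triangle_ineq4)
    also have "\<dots> \<le> w x * \<bar>s - t\<bar> + \<bar>s - t\<bar> * w x"
      using bd[of s x] bound[of t x] s by (intro add_mono) (auto intro: mult_left_mono)
    finally show ?thesis
      using s by (simp add: D_def divide_simps)
  qed
  have D_int: "integrable M (D s)" for s
    unfolding D_def by (intro integrable_scaleR_right Bochner_Integration.integrable_diff
        Bochner_Integration.integrable_add int f')
  have D_lim: "((\<lambda>s. D s x) \<longlongrightarrow> 0) (at t within T)" for x
    using has_vector_derivative_at_within[OF deriv[of t x], of T]
    unfolding has_vector_derivative_def has_derivative_within D_def by simp
  have "((\<lambda>s. LINT x|M. D s x) \<longlongrightarrow> 0) (at t within T)"
    unfolding tendsto_at_iff_sequentially comp_def
  proof safe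
    fix X :: "nat \<Rightarrow> real" assume X: "\<forall>i. X i \<in> T - {t}" "X \<longlonglongrightarrow> t"
    have "(\<lambda>i. LINT x|M. D (X i) x) \<longlonglongrightarrow> (LINT x|M. 0)"
    proof (rule integral_dominated_convergence[where w="\<lambda>x. 2 * w x"])
      show "AE x in M. (\<lambda>i. D (X i) x) \<longlonglongrightarrow> 0"
      proof (rule AE_I2)
        fix x
        show "(\<lambda>i. D (X i) x) \<longlonglongrightarrow> 0"
          using D_lim[of x] X unfolding tendsto_at_iff_sequentially comp_def by blast
      qed
      show "AE x in M. norm (D (X i) x) \<le> 2 * w x" for i
        using D_bound X by auto
    qed (use D_int w in auto)
    then show "(\<lambda>i. LINT x|M. D (X i) x) \<longlonglongrightarrow> 0" by simp
  qed
  moreover have "(LINT x|M. D s x) = (1 / norm (s - t)) *\<^sub>R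
      ((LINT x|M. f s x) - ((LINT x|M. f t x) + (s - t) *\<^sub>R (LINT x|M. f' t x)))" for s
    unfolding D_def
    by (simp only: integral_scaleR_right Bochner_Integration.integral_diff
        Bochner_Integration.integral_add int f' integrable_scaleR_right Bochner_Integration.integrable_add)
  ultimately have lim: "((\<lambda>s. (1 / norm (s - t)) *\<^sub>R
      ((LINT x|M. f s x) - ((LINT x|M. f t x) + (s - t) *\<^sub>R (LINT x|M. f' t x)))) \<longlongrightarrow> 0) (at t within T)"
    by (simp only:)
  have "((\<lambda>s. LINT x|M. f s x) has_vector_derivative (LINT x|M. f' t x)) (at t within T)"
    unfolding has_vector_derivative_def has_derivative_within
    by (rule conjI[OF bounded_linear_scaleR_left lim])
  then show ?thesis by (simp only: at_within_open[OF T(3,1)])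
qed

text \<open>A class of functions stable under multiplication by continuous functions, on which every integral
  below converges absolutely. It contains the indicator functions of compact sets, by which Fourier
  transforms are cut off.\<close>

definition bounded_comp_supp :: "(real ^ 'n::finite \<Rightarrow> complex) \<Rightarrow> bool" where
  "bounded_comp_supp W \<longleftrightarrow> W \<in> borel_measurable borel \<and> (\<exists>B. \<forall>\<xi>. norm (W \<xi>) \<le> B) \<and>
     (\<exists>r. \<forall>\<xi>. W \<xi> \<noteq> 0 \<longrightarrow> norm \<xi> \<le> r)"

text \<open>The inverse Fourier transform up to the factor \<open>(2\<pi>)\<^bsup>-n\<^esup>\<close>.\<close>

definition fourier_adj :: "(real ^ 'n::finite \<Rightarrow> complex) \<Rightarrow> real ^ 'n \<Rightarrow> complex" where
  "fourier_adj W x = (LINT \<xi>|lborel. exp (\<i> * complex_of_real (x \<bullet> \<xi>)) * W \<xi>)"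

lemma bounded_comp_supp_integrable:
  assumes "bounded_comp_supp W" shows "integrable lborel W"
proof -
  obtain B r where B: "\<And>\<xi>. norm (W \<xi>) \<le> B" and r: "\<And>\<xi>. W \<xi> \<noteq> 0 \<Longrightarrow> norm \<xi> \<le> r"
    and meas: "W \<in> borel_measurable borel"
    using assms unfolding bounded_comp_supp_def by blast
  show ?thesis
  proof (rule integrableI_bounded_set[where A="cball 0 r" and B=B])
    show "emeasure lborel (cball 0 r :: (real ^ 'n) set) < \<infinity>"
      using emeasure_lborel_cball_finite by (simp add: less_top[symmetric])
  qed (use B r meas in auto)
qed

lemma bounded_comp_supp_mult:
  assumes W: "bounded_comp_supp W" and h: "continuous_on UNIV h"
  shows "bounded_comp_supp (\<lambda>\<xi>. h \<xi> * W \<xi>)"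
proof -
  obtain B r where B: "\<And>\<xi>. norm (W \<xi>) \<le> B" and r: "\<And>\<xi>. W \<xi> \<noteq> 0 \<Longrightarrow> norm \<xi> \<le> r"
    and meas: "W \<in> borel_measurable borel"
    using W unfolding bounded_comp_supp_def by blast
  have "bounded (h ` cball 0 r)"
    using h by (intro compact_imp_bounded compact_continuous_image) (auto intro: continuous_on_subset)
  then obtain C where C: "C > 0" "\<And>\<xi>. norm \<xi> \<le> r \<Longrightarrow> norm (h \<xi>) \<le> C"
    by (auto simp: bounded_pos)
  have "norm (h \<xi> * W \<xi>) \<le> C * B" for \<xi>
  proof (cases "W \<xi> = 0")
    case True
    have "B \<ge> 0" using B[of \<xi>] norm_ge_zero order_trans by blast
    then show ?thesis using True C by simp
  next
    case False
    then show ?thesis using B[of \<xi>] C(2)[OF r[OF False]] C(1) by (simp add: norm_mult mult_mono)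
  qed
  moreover have "(\<lambda>\<xi>. h \<xi> * W \<xi>) \<in> borel_measurable borel"
    using meas borel_measurable_continuous_onI[OF h] by measurable
  ultimately show ?thesis
    unfolding bounded_comp_supp_def using r by (metis mult_zero_right)
qed

lemma fourier_adj_integrand:
  assumes "bounded_comp_supp W"
  shows "integrable lborel (\<lambda>\<xi>. exp (\<i> * complex_of_real (x \<bullet> \<xi>)) * W \<xi>)"
  using assms by (intro bounded_comp_supp_integrable bounded_comp_supp_mult continuous_intros)

lemma continuous_fourier_adj:
  assumes W: "bounded_comp_supp (W :: real ^ 'n::finite \<Rightarrow> complex)"
  shows "continuous_on UNIV (fourier_adj W)"
  unfolding continuous_on_eq_continuous_at[OF open_UNIV]
proof
  fix x :: "real ^ 'n"
  show "isCont (fourier_adj W) x"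
    unfolding isCont_def tendsto_at_iff_sequentially comp_def fourier_adj_def
  proof safe
    fix X :: "nat \<Rightarrow> real ^ 'n" assume X: "X \<longlonglongrightarrow> x"
    show "(\<lambda>i. LINT \<xi>|lborel. exp (\<i> * complex_of_real (X i \<bullet> \<xi>)) * W \<xi>) \<longlonglongrightarrow>
        (LINT \<xi>|lborel. exp (\<i> * complex_of_real (x \<bullet> \<xi>)) * W \<xi>)"
    proof (rule integral_dominated_convergence[where w="\<lambda>\<xi>. norm (W \<xi>)"])
      show "AE \<xi> in lborel. (\<lambda>i. exp (\<i> * complex_of_real (X i \<bullet> \<xi>)) * W \<xi>) \<longlonglongrightarrow>
          exp (\<i> * complex_of_real (x \<bullet> \<xi>)) * W \<xi>"
        by (intro AE_I2 tendsto_intros X)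
    qed (use W bounded_comp_supp_integrable[OF W] in \<open>auto simp: norm_mult bounded_comp_supp_def\<close>)
  qed
qed

lemma fourier_adj_has_partial_derivative:
  assumes W: "bounded_comp_supp W"
  shows "((\<lambda>s. fourier_adj W (x + s *\<^sub>R axis i 1)) has_vector_derivative
      \<i> * fourier_adj (\<lambda>\<xi>. complex_of_real (\<xi> $ i) * W \<xi>) x) (at 0)"
proof -
  define W' where "W' = (\<lambda>\<xi>. complex_of_real (\<xi> $ i) * W \<xi>)"
  have W': "bounded_comp_supp W'"
    unfolding W'_def by (intro bounded_comp_supp_mult W continuous_intros)
  have "((\<lambda>s. LINT \<xi>|lborel. exp (\<i> * complex_of_real ((x + s *\<^sub>R axis i 1) \<bullet> \<xi>)) * W \<xi>) has_vector_derivative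
      (LINT \<xi>|lborel. \<i> * (exp (\<i> * complex_of_real ((x + 0 *\<^sub>R axis i 1) \<bullet> \<xi>)) * W' \<xi>))) (at 0)"
  proof (rule has_vector_derivative_lebesgue_integral[where w="\<lambda>\<xi>. norm (W' \<xi>)"
        and f'="\<lambda>s \<xi>. \<i> * (exp (\<i> * complex_of_real ((x + s *\<^sub>R axis i 1) \<bullet> \<xi>)) * W' \<xi>)"])
    fix s :: real and \<xi> :: "real ^ 'a"
    have "((\<lambda>z. exp (\<i> * (of_real (x \<bullet> \<xi>) + z * of_real (\<xi> $ i))) * W \<xi>) has_field_derivative
        \<i> * (exp (\<i> * (of_real (x \<bullet> \<xi>) + of_real s * of_real (\<xi> $ i))) * W' \<xi>)) (at (of_real s))"
      by (auto intro!: derivative_eq_intros simp: W'_def)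
    from has_vector_derivative_real_field[OF this, of UNIV]
    show "((\<lambda>s. exp (\<i> * complex_of_real ((x + s *\<^sub>R axis i 1) \<bullet> \<xi>)) * W \<xi>) has_vector_derivative
        \<i> * (exp (\<i> * complex_of_real ((x + s *\<^sub>R axis i 1) \<bullet> \<xi>)) * W' \<xi>)) (at s)"
      by (simp add: inner_add_left inner_axis' )
  qed (use fourier_adj_integrand[OF W] fourier_adj_integrand[OF W', of x] bounded_comp_supp_integrable[OF W']
      in \<open>auto simp: norm_mult\<close>)
  then show ?thesis by (simp add: fourier_adj_def W'_def)
qed

lemma Dx_fourier_adj:
  "bounded_comp_supp W \<Longrightarrow> Dx i (fourier_adj W) = fourier_adj (\<lambda>\<xi>. complex_of_real (\<xi> $ i) * W \<xi>)"
  unfolding Dx_def by (rule ext) (simp add: vector_derivative_at[OF fourier_adj_has_partial_derivative])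

lemma Dx_funpow_fourier_adj:
  assumes "bounded_comp_supp W"
  shows "(Dx i ^^ k) (fourier_adj W) = fourier_adj (\<lambda>\<xi>. complex_of_real (\<xi> $ i) ^ k * W \<xi>)"
proof (induction k)
  case (Suc k)
  have "bounded_comp_supp (\<lambda>\<xi>. complex_of_real (\<xi> $ i) ^ k * W \<xi>)"
    by (intro bounded_comp_supp_mult assms continuous_intros)
  then show ?case using Suc by (simp add: Dx_fourier_adj mult.assoc)
qed simp

lemma smooth_fourier_adj:
  assumes "bounded_comp_supp W"
  shows "smooth (fourier_adj W)"
proof -
  have rep: "\<exists>V. bounded_comp_supp V \<and> foldr Dx js (fourier_adj W) = fourier_adj V" for js
  proof (induction js)
    case (Cons i js)
    then obtain V where V: "bounded_comp_supp V" "foldr Dx js (fourier_adj W) = fourier_adj V" by blast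
    then have "foldr Dx (i # js) (fourier_adj W) = fourier_adj (\<lambda>\<xi>. complex_of_real (\<xi> $ i) * V \<xi>)"
      by (simp add: Dx_fourier_adj)
    moreover have "bounded_comp_supp (\<lambda>\<xi>. complex_of_real (\<xi> $ i) * V \<xi>)"
      by (intro bounded_comp_supp_mult V continuous_intros)
    ultimately show ?case by blast
  qed (use assms in auto)
  show ?thesis
    unfolding smooth_def
  proof (intro allI conjI)
    fix js
    obtain V where V: "bounded_comp_supp V" "foldr Dx js (fourier_adj W) = fourier_adj V"
      using rep by blast
    show "continuous_on UNIV (foldr Dx js (fourier_adj W))"
      unfolding V by (rule continuous_fourier_adj[OF V(1)])
    show "(\<lambda>s. foldr Dx js (fourier_adj W) (x + s *\<^sub>R axis i 1)) differentiable at 0" for i x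
      unfolding V by (rule differentiableI_vector[OF fourier_adj_has_partial_derivative[OF V(1)]])
  qed
qed

lemma Dx_multi_fourier_adj:
  fixes \<alpha> :: "'n::finite \<Rightarrow> nat"
  assumes W: "bounded_comp_supp W"
  shows "Dx_multi \<alpha> (fourier_adj W) = fourier_adj (\<lambda>\<xi>. mpow \<xi> \<alpha> * W \<xi>)"
proof -
  define js where "js = (SOME js :: 'n list. distinct js \<and> set js = UNIV)"
  have js: "distinct js" "set js = UNIV"
    using someI_ex[of "\<lambda>js :: 'n list. distinct js \<and> set js = UNIV"] finite_distinct_list[OF finite[of "UNIV :: 'n set"]]
    unfolding js_def by auto
  have "foldr (\<lambda>i. Dx i ^^ \<alpha> i) xs (fourier_adj W)
      = fourier_adj (\<lambda>\<xi>. (\<Prod>i\<leftarrow>xs. complex_of_real (\<xi> $ i) ^ \<alpha> i) * W \<xi>)" for xs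
  proof (induction xs)
    case (Cons i xs)
    have "continuous_on UNIV (\<lambda>\<xi> :: real ^ 'n. \<Prod>i\<leftarrow>xs. complex_of_real (\<xi> $ i) ^ \<alpha> i)"
      by (induction xs) (auto intro!: continuous_intros)
    then have "bounded_comp_supp (\<lambda>\<xi>. (\<Prod>i\<leftarrow>xs. complex_of_real (\<xi> $ i) ^ \<alpha> i) * W \<xi>)"
      by (intro bounded_comp_supp_mult W)
    then show ?case using Cons by (simp add: Dx_funpow_fourier_adj mult.assoc)
  qed simp
  moreover have "(\<Prod>i\<leftarrow>js. complex_of_real (\<xi> $ i) ^ \<alpha> i) = mpow \<xi> \<alpha>" for \<xi> :: "real ^ 'n"
    using js by (simp add: mpow_def prod.distinct_set_conv_list[symmetric])
  ultimately show ?thesis by (simp add: Dx_multi_def flip: js_def)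
qed

lemma bounded_comp_supp_C0_infinity:
  assumes "f \<in> C0_infinity U"
  shows "bounded_comp_supp f"
proof -
  have cont: "continuous_on UNIV f" and K: "compact (closure {x. f x \<noteq> 0})"
    using assms by (auto simp: C0_infinity_def smooth_def dest: spec[of _ "[]"])
  have "bounded (f ` closure {x. f x \<noteq> 0})"
    using K cont by (intro compact_imp_bounded compact_continuous_image) (auto intro: continuous_on_subset)
  then obtain B where B: "B > 0" "\<And>x. x \<in> closure {x. f x \<noteq> 0} \<Longrightarrow> norm (f x) \<le> B"
    by (auto simp: bounded_pos)
  have "norm (f x) \<le> B" for x
    using B(1) B(2)[of x] closure_subset[of "{x. f x \<noteq> 0}"] by (cases "f x = 0") auto
  moreover obtain r where "\<And>x. x \<in> closure {x. f x \<noteq> 0} \<Longrightarrow> norm x \<le> r"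
    using compact_imp_bounded[OF K] by (auto simp: bounded_iff)
  then have "f x \<noteq> 0 \<longrightarrow> norm x \<le> r" for x
    using closure_subset[of "{x. f x \<noteq> 0}"] by auto
  ultimately show ?thesis
    unfolding bounded_comp_supp_def using borel_measurable_continuous_onI[OF cont] by blast
qed

lemma fourier_eq_fourier_adj: "fourier f \<xi> = fourier_adj f (- \<xi>)"
  by (simp add: fourier_def fourier_adj_def inner_commute)

lemma continuous_fourier:
  assumes "bounded_comp_supp f" shows "continuous_on UNIV (fourier f)"
proof -
  have "continuous_on UNIV (fourier_adj f \<circ> uminus)"
    by (intro continuous_on_compose continuous_intros continuous_on_subset[OF continuous_fourier_adj[OF assms]]) auto
  then show ?thesis by (simp add: o_def fourier_eq_fourier_adj[abs_def])
qed

lemma integrable_exp_mult: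
  fixes a :: "real ^ 'n::finite \<Rightarrow> complex"
  assumes "integrable lborel a"
  shows "integrable lborel (\<lambda>\<xi>. exp (\<i> * complex_of_real (x \<bullet> \<xi>)) * a \<xi>)"
  by (rule Bochner_Integration.integrable_bound[OF assms]) (use assms in \<open>auto simp: norm_mult\<close>)

text \<open>Fubini, the kernel \<open>exp (i x \<bullet> \<xi>)\<close> being symmetric.\<close>

lemma fourier_adj_multiplication_formula:
  fixes a b :: "real ^ 'n::finite \<Rightarrow> complex"
  assumes a: "integrable lborel a" and b: "integrable lborel b"
  shows "(LINT x|lborel. a x * fourier_adj b x) = (LINT \<xi>|lborel. b \<xi> * fourier_adj a \<xi>)"
proof -
  have [measurable]: "a \<in> borel_measurable borel" "b \<in> borel_measurable borel"
    using a b by auto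
  define F where "F = (\<lambda>(x, \<xi>). a x * (exp (\<i> * complex_of_real (x \<bullet> \<xi>)) * b \<xi>))"
  have expm: "(\<lambda>z :: (real ^ 'n) \<times> (real ^ 'n). exp (\<i> * complex_of_real (fst z \<bullet> snd z))) \<in> borel_measurable borel"
    by (intro borel_measurable_continuous_onI continuous_intros)
  then have [measurable]: "(\<lambda>z :: (real ^ 'n) \<times> (real ^ 'n). exp (\<i> * complex_of_real (fst z \<bullet> snd z)))
      \<in> borel_measurable (lborel \<Otimes>\<^sub>M lborel)"
    by (simp add: lborel_prod)
  have F: "integrable (lborel \<Otimes>\<^sub>M lborel) F"
  proof (rule lborel_pair.Fubini_integrable)
    show "F \<in> borel_measurable (lborel \<Otimes>\<^sub>M lborel)"
      unfolding F_def case_prod_unfold by measurable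
    show "integrable lborel (\<lambda>x. LINT \<xi>|lborel. norm (F (x, \<xi>)))"
      using a by (simp add: F_def norm_mult)
    show "AE x in lborel. integrable lborel (\<lambda>\<xi>. F (x, \<xi>))"
      using b by (auto simp: F_def intro!: integrable_mult_right integrable_exp_mult)
  qed
  have "(LINT x|lborel. a x * fourier_adj b x) = (LINT x|lborel. LINT \<xi>|lborel. F (x, \<xi>))"
    by (simp add: F_def fourier_adj_def)
  also have "\<dots> = (LINT \<xi>|lborel. LINT x|lborel. F (x, \<xi>))"
    using lborel_pair.Fubini_integral[of "\<lambda>x \<xi>. F (x, \<xi>)"] F by simp
  also have "\<dots> = (LINT \<xi>|lborel. b \<xi> * fourier_adj a \<xi>)"
  proof (rule Bochner_Integration.integral_cong[OF refl])
    fix \<xi>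
    have "(LINT x|lborel. F (x, \<xi>)) = (LINT x|lborel. b \<xi> * (exp (\<i> * complex_of_real (\<xi> \<bullet> x)) * a x))"
      by (rule Bochner_Integration.integral_cong[OF refl]) (simp add: F_def inner_commute)
    then show "(LINT x|lborel. F (x, \<xi>)) = b \<xi> * fourier_adj a \<xi>"
      by (simp add: fourier_adj_def)
  qed
  finally show ?thesis .
qed

section \<open>An inequality of Plancherel type\<close>

definition gauss :: "real \<Rightarrow> 'a::real_normed_vector \<Rightarrow> real" where
  "gauss s x = exp (- (s * norm x)\<^sup>2 / 2)"

text \<open>The characteristic function of the standard normal distribution, rescaled by \<open>s\<close>.\<close>

lemma gauss_1d:
  assumes s: "s > 0"
  shows "integrable lborel (\<lambda>x::real. exp (\<i> * complex_of_real (\<zeta> * x)) * complex_of_real (gauss s x))"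
    and "(LINT x|lborel. exp (\<i> * complex_of_real (\<zeta> * x)) * complex_of_real (gauss s x)) =
      complex_of_real (sqrt (2 * pi) / s * gauss (1 / s) \<zeta>)"
proof -
  define F where "F x = exp (\<i> * complex_of_real (\<zeta> / s * x)) * complex_of_real (exp (- x\<^sup>2 / 2))" for x :: real
  have dens: "exp (- x\<^sup>2 / 2) = sqrt (2 * pi) * std_normal_density x" for x :: real
    by (simp add: std_normal_density_def)
  have F_eq: "F x = complex_of_real (sqrt (2 * pi)) * (std_normal_density x *\<^sub>R iexp (\<zeta> / s * x))" for x
    unfolding F_def dens by (simp add: scaleR_conv_of_real)
  have int: "integrable lborel (\<lambda>x. std_normal_density x *\<^sub>R iexp (\<zeta> / s * x))"
    by (rule Bochner_Integration.integrable_bound[OF integrable_normal_density[of 1 0]]) auto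
  have F_int: "integrable lborel F"
    unfolding F_eq using int by (rule integrable_mult_right)
  have "(LINT x|lborel. std_normal_density x *\<^sub>R iexp (\<zeta> / s * x)) = char std_normal_distribution (\<zeta> / s)"
    unfolding char_def by (subst integral_density) auto
  then have F_val: "(LINT x|lborel. F x) = complex_of_real (sqrt (2 * pi) * exp (- (\<zeta> / s)\<^sup>2 / 2))"
    unfolding F_eq integral_mult_right_zero by (simp add: char_std_normal_distribution)
  have F_s: "F (0 + s * x) = exp (\<i> * complex_of_real (\<zeta> * x)) * complex_of_real (gauss s x)" for x
    using s by (simp add: F_def gauss_def power_mult_distrib)
  show "integrable lborel (\<lambda>x::real. exp (\<i> * complex_of_real (\<zeta> * x)) * complex_of_real (gauss s x))"
    using lborel_integrable_real_affine[OF F_int, of s 0] s unfolding F_s by simp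
  have "(LINT x|lborel. F x) = s *\<^sub>R (LINT x|lborel. F (0 + s * x))"
    using lborel_integral_real_affine[of s F 0] s by simp
  then show "(LINT x|lborel. exp (\<i> * complex_of_real (\<zeta> * x)) * complex_of_real (gauss s x)) =
      complex_of_real (sqrt (2 * pi) / s * gauss (1 / s) \<zeta>)"
    unfolding F_s F_val using s
    by (simp add: gauss_def power_divide scaleR_conv_of_real field_simps)
qed

lemma gauss_prod: "gauss s x = (\<Prod>b\<in>Basis. gauss s (x \<bullet> b))" for x :: "'a::euclidean_space"
proof -
  have "(s * norm x)\<^sup>2 = (\<Sum>b\<in>Basis. (s * (x \<bullet> b))\<^sup>2)"
    unfolding power_mult_distrib power2_norm_eq_inner euclidean_inner[of x x] sum_distrib_left
    by (simp only: power2_eq_square)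
  then show ?thesis
    by (simp add: gauss_def exp_sum[symmetric] sum_negf sum_divide_distrib power_mult_distrib)
qed

lemma gauss_fourier:
  fixes \<zeta> :: "real ^ 'n::finite"
  assumes s: "s > 0"
  shows "integrable lborel (\<lambda>x. exp (\<i> * complex_of_real (\<zeta> \<bullet> x)) * complex_of_real (gauss s x))"
    and "(LINT x|lborel. exp (\<i> * complex_of_real (\<zeta> \<bullet> x)) * complex_of_real (gauss s x)) =
      complex_of_real ((sqrt (2 * pi) / s) ^ DIM(real ^ 'n) * gauss (1 / s) \<zeta>)"
proof -
  define B where "B = (Basis :: (real ^ 'n) set)"
  define \<phi> where "\<phi> b u = exp (\<i> * complex_of_real ((\<zeta> \<bullet> b) * u)) * complex_of_real (gauss s u)" for b and u :: real
  interpret product_sigma_finite "\<lambda>_ :: real ^ 'n. lborel :: real measure" ..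
  have fin: "finite B" by (simp add: B_def)
  have \<phi>: "integrable lborel (\<phi> b)" for b
    unfolding \<phi>_def by (rule gauss_1d(1)[OF s])
  define F where "F x = exp (\<i> * complex_of_real (\<zeta> \<bullet> x)) * complex_of_real (gauss s x)" for x :: "real ^ 'n"
  have F_prod: "F x = (\<Prod>b\<in>B. \<phi> b (x \<bullet> b))" for x
  proof -
    have "exp (\<i> * complex_of_real (\<zeta> \<bullet> x)) = (\<Prod>b\<in>B. exp (\<i> * complex_of_real ((\<zeta> \<bullet> b) * (x \<bullet> b))))"
      using fin by (simp add: euclidean_inner[of \<zeta> x] B_def sum_distrib_left flip: exp_sum)
    then show ?thesis
      by (simp add: F_def \<phi>_def gauss_prod[of s x] B_def prod.distrib)
  qed
  have F_meas: "F \<in> borel_measurable borel"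
    unfolding F_def gauss_def by (intro borel_measurable_continuous_onI continuous_intros) simp_all
  have coord: "(\<Sum>b\<in>B. f b *\<^sub>R b) \<bullet> b' = f b'" if "b' \<in> B" for f b'
    using that by (simp add: B_def inner_sum_left inner_Basis if_distrib cong: if_cong)
  have F_coord: "F (\<Sum>b\<in>B. f b *\<^sub>R b) = (\<Prod>b\<in>B. \<phi> b (f b))" for f
    unfolding F_prod by (rule prod.cong) (simp_all add: coord)
  have meas: "(\<lambda>f. \<Sum>b\<in>B. f b *\<^sub>R b) \<in> (\<Pi>\<^sub>M b\<in>B. lborel) \<rightarrow>\<^sub>M borel"
    unfolding B_def by measurable
  have leb: "(lborel :: (real ^ 'n) measure) = distr (\<Pi>\<^sub>M b\<in>B. lborel) borel (\<lambda>f. \<Sum>b\<in>B. f b *\<^sub>R b)"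
    unfolding B_def by (rule lborel_eq)
  show "integrable lborel (\<lambda>x. exp (\<i> * complex_of_real (\<zeta> \<bullet> x)) * complex_of_real (gauss s x))"
    unfolding F_def[symmetric]
    by (subst leb, subst integrable_distr_eq[OF meas F_meas])
      (simp only: F_coord, rule product_integrable_prod[OF fin \<phi>])
  have "(LINT x|lborel. F x) = (\<Prod>b\<in>B. LINT u|lborel. \<phi> b u)"
    by (subst leb, subst integral_distr[OF meas F_meas])
      (simp only: F_coord, rule product_integral_prod[OF fin \<phi>])
  also have "\<dots> = (\<Prod>b\<in>B. complex_of_real (sqrt (2 * pi) / s * gauss (1 / s) (\<zeta> \<bullet> b)))"
    unfolding \<phi>_def by (simp only: gauss_1d(2)[OF s])
  also have "\<dots> = complex_of_real ((sqrt (2 * pi) / s) ^ DIM(real ^ 'n) * gauss (1 / s) \<zeta>)"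
    unfolding of_real_prod[symmetric] prod.distrib B_def gauss_prod[of "1 / s" \<zeta>] prod_constant by simp
  finally show "(LINT x|lborel. exp (\<i> * complex_of_real (\<zeta> \<bullet> x)) * complex_of_real (gauss s x)) =
      complex_of_real ((sqrt (2 * pi) / s) ^ DIM(real ^ 'n) * gauss (1 / s) \<zeta>)"
    unfolding F_def .
qed

lemma gauss_borel_measurable [measurable]: "gauss s \<in> borel_measurable (borel :: 'a::euclidean_space measure)"
  unfolding gauss_def by (intro borel_measurable_continuous_onI continuous_intros) simp_all

lemma gauss_pos: "gauss s x > 0"
  by (simp add: gauss_def)

lemma gauss_integral:
  assumes s: "s > 0"
  shows "integrable lborel (gauss s :: real ^ 'n::finite \<Rightarrow> real)"
    and "(\<integral>\<^sup>+ x. ennreal (gauss s (x :: real ^ 'n)) \<partial>lborel) = ennreal ((sqrt (2 * pi) / s) ^ DIM(real ^ 'n))"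
proof -
  have i: "integrable lborel (\<lambda>x :: real ^ 'n. complex_of_real (gauss s x))"
    using gauss_fourier(1)[OF s, of "0 :: real ^ 'n"] by simp
  then show int: "integrable lborel (gauss s :: real ^ 'n \<Rightarrow> real)"
    by (subst (asm) complex_of_real_integrable_eq)
  have "complex_of_real (LINT x|lborel. gauss s (x :: real ^ 'n)) = complex_of_real ((sqrt (2 * pi) / s) ^ DIM(real ^ 'n))"
    using gauss_fourier(2)[OF s, of "0 :: real ^ 'n"] by (simp add: gauss_def)
  then have "(LINT x|lborel. gauss s (x :: real ^ 'n)) = (sqrt (2 * pi) / s) ^ DIM(real ^ 'n)"
    by (simp only: of_real_eq_iff)
  then show "(\<integral>\<^sup>+ x. ennreal (gauss s (x :: real ^ 'n)) \<partial>lborel) = ennreal ((sqrt (2 * pi) / s) ^ DIM(real ^ 'n))"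
    using nn_integral_eq_integral[OF int AE_I2[OF less_imp_le[OF gauss_pos]]] by simp
qed

lemma nn_integral_translate:
  fixes f :: "'a::euclidean_space \<Rightarrow> ennreal"
  assumes [measurable]: "f \<in> borel_measurable borel"
  shows "(\<integral>\<^sup>+ x. f (c + x) \<partial>lborel) = (\<integral>\<^sup>+ x. f x \<partial>lborel)"
proof -
  have "(\<integral>\<^sup>+ x. f x \<partial>lborel) = (\<integral>\<^sup>+ x. f x \<partial>distr lborel borel ((+) c))"
    by (simp only: lborel_distr_plus)
  also have "\<dots> = (\<integral>\<^sup>+ x. f (c + x) \<partial>lborel)"
    by (rule nn_integral_distr) auto
  finally show ?thesis ..
qed

text \<open>Schur's test for a convolution kernel: bound \<open>u x * u y\<close> by \<open>((u x)\<^sup>2 + (u y)\<^sup>2) / 2\<close> and integrate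
  out the variable that does not occur in the square.\<close>

lemma schur_bound:
  fixes u :: "'a::euclidean_space \<Rightarrow> real" and k :: "'a \<Rightarrow> real"
  assumes [measurable]: "u \<in> borel_measurable borel" "k \<in> borel_measurable borel"
    and nn: "\<And>x. u x \<ge> 0" "\<And>x. k x \<ge> 0" and even: "\<And>x. k (- x) = k x"
  shows "(\<integral>\<^sup>+ x. \<integral>\<^sup>+ y. ennreal (u x * u y * k (y - x)) \<partial>lborel \<partial>lborel)
     \<le> (\<integral>\<^sup>+ x. ennreal (k x) \<partial>lborel) * (\<integral>\<^sup>+ x. ennreal ((u x)\<^sup>2) \<partial>lborel)"
proof -
  define I where "I = (\<integral>\<^sup>+ x. ennreal (k x) \<partial>lborel)"
  define J where "J = (\<integral>\<^sup>+ x. ennreal ((u x)\<^sup>2) \<partial>lborel)"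
  have shift: "(\<integral>\<^sup>+ y. ennreal (k (y - x)) \<partial>lborel) = I" for x
    unfolding I_def using nn_integral_translate[of "\<lambda>y. ennreal (k y)" "- x"] by simp
  have shift': "(\<integral>\<^sup>+ x. ennreal (k (y - x)) \<partial>lborel) = I" for y
    using shift[of y] even[of "y - _"] by simp
  have a: "(\<integral>\<^sup>+ x. \<integral>\<^sup>+ y. ennreal ((u x)\<^sup>2 / 2) * ennreal (k (y - x)) \<partial>lborel \<partial>lborel) = (J / 2) * I"
    by (simp add: nn_integral_cmult nn_integral_multc shift J_def nn_integral_divide ennreal_divide_numeral[symmetric]
        del: ennreal_divide_numeral)
  have b: "(\<integral>\<^sup>+ x. \<integral>\<^sup>+ y. ennreal ((u y)\<^sup>2 / 2) * ennreal (k (y - x)) \<partial>lborel \<partial>lborel) = (J / 2) * I"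
    by (subst lborel_pair.Fubini')
      (simp_all add: nn_integral_cmult nn_integral_multc shift' J_def nn_integral_divide ennreal_divide_numeral[symmetric]
        del: ennreal_divide_numeral)
  have "(\<integral>\<^sup>+ x. \<integral>\<^sup>+ y. ennreal (u x * u y * k (y - x)) \<partial>lborel \<partial>lborel) \<le>
      (\<integral>\<^sup>+ x. \<integral>\<^sup>+ y. ennreal ((u x)\<^sup>2 / 2) * ennreal (k (y - x)) + ennreal ((u y)\<^sup>2 / 2) * ennreal (k (y - x)) \<partial>lborel \<partial>lborel)"
  proof (intro nn_integral_mono)
    fix x y
    have "u x * u y \<le> (u x)\<^sup>2 / 2 + (u y)\<^sup>2 / 2"
      using sum_squares_bound[of "u x" "u y"] by simp
    then have "u x * u y * k (y - x) \<le> (u x)\<^sup>2 / 2 * k (y - x) + (u y)\<^sup>2 / 2 * k (y - x)"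
      using mult_right_mono[OF _ nn(2)[of "y - x"]] by (metis distrib_right)
    then show "ennreal (u x * u y * k (y - x)) \<le> ennreal ((u x)\<^sup>2 / 2) * ennreal (k (y - x)) + ennreal ((u y)\<^sup>2 / 2) * ennreal (k (y - x))"
      using nn by (simp add: ennreal_mult'[symmetric] ennreal_plus[symmetric] ennreal_leI del: ennreal_plus)
  qed
  also have "\<dots> = (J / 2) * I + (J / 2) * I"
    by (simp add: nn_integral_add a b)
  also have "\<dots> = I * J"
  proof -
    have "J / 2 + J / 2 = J * 2 / 2" by (simp add: mult_2[symmetric] ennreal_times_divide mult.commute)
    also have "\<dots> = J" by (rule mult_divide_eq_ennreal) simp_all
    finally show ?thesis by (metis distrib_right mult.commute)
  qed
  finally show ?thesis unfolding I_def J_def .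
qed

lemma norm_fourier_adj_le: 
  assumes "integrable lborel W"
  shows "norm (fourier_adj W x) \<le> (LINT \<xi>|lborel. norm (W \<xi>))"
  unfolding fourier_adj_def
  using integral_norm_bound[of lborel "\<lambda>\<xi>. exp (\<i> * complex_of_real (x \<bullet> \<xi>)) * W \<xi>"] by (simp add: norm_mult)

lemma norm_integral_le_nn_integral:
  "ennreal (norm (LINT x|M. f x)) \<le> (\<integral>\<^sup>+ x. ennreal (norm (f x)) \<partial>M)"
  for f :: "'a \<Rightarrow> complex"
  by (cases "integrable M f") (simp_all add: integral_norm_bound_ennreal not_integrable_integral_eq)

text \<open>With the Gaussian weight all integrals converge absolutely, and the left-hand side is a double
  integral of \<open>W \<xi> * cnj (W \<eta>)\<close> against the kernel \<open>k (\<eta> - \<xi>)\<close>, where \<open>k\<close> is the transform of the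
  Gaussian. It is nonnegative with integral \<open>(2\<pi>)\<^sup>n\<close>, whatever \<open>s\<close>, so Schur's test applies.\<close>

lemma gauss_weighted_plancherel:
  fixes W :: "real ^ 'n::finite \<Rightarrow> complex"
  assumes W: "bounded_comp_supp W" and s: "s > 0"
  shows "(\<integral>\<^sup>+ x. ennreal (gauss s x * (norm (fourier_adj W x))\<^sup>2) \<partial>lborel)
    \<le> ennreal ((2 * pi) ^ DIM(real ^ 'n)) * (\<integral>\<^sup>+ \<xi>. ennreal ((norm (W \<xi>))\<^sup>2) \<partial>lborel)"
proof -
  define c where "c = (sqrt (2 * pi) / s) ^ DIM(real ^ 'n)"
  define k where "k \<zeta> = c * gauss (1 / s) \<zeta>" for \<zeta> :: "real ^ 'n"
  have c: "c \<ge> 0" using s by (simp add: c_def)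
  have Wint: "integrable lborel W" using bounded_comp_supp_integrable[OF W] .
  have Wmeas [measurable]: "W \<in> borel_measurable borel" using W by (simp add: bounded_comp_supp_def)
  have \<Phi>meas [measurable]: "fourier_adj W \<in> borel_measurable borel"
    using continuous_fourier_adj[OF W] by (rule borel_measurable_continuous_onI)
  have [measurable]: "(\<lambda>x. cnj (fourier_adj W x)) \<in> borel_measurable borel"
    by (intro borel_measurable_continuous_onI continuous_intros continuous_fourier_adj[OF W])
  define N where "N = (LINT \<xi>|lborel. norm (W \<xi>))"
  have \<Phi>N: "norm (fourier_adj W x) \<le> N" for x
    unfolding N_def by (rule norm_fourier_adj_le[OF Wint])
  have N: "N \<ge> 0" using \<Phi>N[of 0] norm_ge_zero order_trans by blast
  have gint: "integrable lborel (\<lambda>x :: real ^ 'n. gauss s x)" by (rule gauss_integral(1)[OF s])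
  define a where "a x = complex_of_real (gauss s x) * cnj (fourier_adj W x)" for x
  have ameas [measurable]: "a \<in> borel_measurable borel" unfolding a_def by measurable
  have a: "integrable lborel a"
  proof (rule Bochner_Integration.integrable_bound[of lborel "\<lambda>x. N * gauss s x"])
    show "integrable lborel (\<lambda>x :: real ^ 'n. N * gauss s x)" using gint by simp
    show "AE x in lborel. norm (a x) \<le> norm (N * gauss s x)"
    proof (rule AE_I2)
      show "norm (a x) \<le> norm (N * gauss s x)" for x
        using mult_left_mono[OF \<Phi>N[of x], of "gauss s x"] N gauss_pos[of s x]
        by (simp add: a_def norm_mult mult.commute)
    qed
  qed simp
  have sq: "a x * fourier_adj W x = complex_of_real (gauss s x * (norm (fourier_adj W x))\<^sup>2)" for x
    unfolding a_def by (simp add: mult.assoc complex_norm_square mult.commute[of "cnj _"] del: of_real_power)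
  have sqint: "integrable lborel (\<lambda>x. gauss s x * (norm (fourier_adj W x))\<^sup>2)"
  proof (rule Bochner_Integration.integrable_bound[of lborel "\<lambda>x. N\<^sup>2 * gauss s x"])
    show "integrable lborel (\<lambda>x :: real ^ 'n. N\<^sup>2 * gauss s x)" using gint by simp
    show "AE x in lborel. norm (gauss s x * (norm (fourier_adj W x))\<^sup>2) \<le> norm (N\<^sup>2 * gauss s x)"
    proof (rule AE_I2)
      show "norm (gauss s x * (norm (fourier_adj W x))\<^sup>2) \<le> norm (N\<^sup>2 * gauss s x)" for x
        using mult_left_mono[OF power_mono[OF \<Phi>N[of x] norm_ge_zero, of 2], of "gauss s x"] N gauss_pos[of s x]
        by (simp add: abs_mult mult.commute)
    qed
  qed measurable
  have adj: "cnj (fourier_adj a \<xi>) = (LINT \<eta>|lborel. W \<eta> * complex_of_real (k (\<eta> - \<xi>)))" for \<xi>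
  proof -
    define b where "b x = exp (\<i> * complex_of_real ((- \<xi>) \<bullet> x)) * complex_of_real (gauss s x)" for x
    have b: "integrable lborel b" unfolding b_def by (rule gauss_fourier(1)[OF s])
    have "cnj (fourier_adj a \<xi>) = (LINT x|lborel. b x * fourier_adj W x)"
      unfolding fourier_adj_def[of a] Bochner_Integration.integral_cnj[symmetric]
      by (rule Bochner_Integration.integral_cong) (simp_all add: a_def b_def exp_cnj)
    also have "\<dots> = (LINT \<eta>|lborel. W \<eta> * fourier_adj b \<eta>)"
      by (rule fourier_adj_multiplication_formula[OF b Wint])
    also have "\<dots> = (LINT \<eta>|lborel. W \<eta> * complex_of_real (k (\<eta> - \<xi>)))"
    proof (rule Bochner_Integration.integral_cong[OF refl])
      fix \<eta>
      have "fourier_adj b \<eta> = (LINT x|lborel. exp (\<i> * complex_of_real ((\<eta> - \<xi>) \<bullet> x)) * complex_of_real (gauss s x))"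
        unfolding fourier_adj_def b_def
        by (rule Bochner_Integration.integral_cong) (simp_all add: inner_diff_left ring_distribs exp_add[symmetric] exp_diff mult.assoc[symmetric] exp_minus field_simps)
      then show "W \<eta> * fourier_adj b \<eta> = W \<eta> * complex_of_real (k (\<eta> - \<xi>))"
        using gauss_fourier(2)[OF s, of "\<eta> - \<xi>"] by (simp add: k_def c_def)
    qed
    finally show ?thesis .
  qed
  have kpos: "k \<zeta> \<ge> 0" for \<zeta> using c gauss_pos[of "1 / s" \<zeta>] by (simp add: k_def)
  have "(\<integral>\<^sup>+ x. ennreal (gauss s x * (norm (fourier_adj W x))\<^sup>2) \<partial>lborel)
      = ennreal (LINT x|lborel. gauss s x * (norm (fourier_adj W x))\<^sup>2)"
    by (rule nn_integral_eq_integral[OF sqint AE_I2]) (simp add: less_imp_le[OF gauss_pos])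
  also have "(LINT x|lborel. gauss s x * (norm (fourier_adj W x))\<^sup>2) = norm (LINT x|lborel. a x * fourier_adj W x)"
    unfolding sq integral_complex_of_real norm_of_real
    by (rule abs_of_nonneg[symmetric], rule integral_nonneg_AE, rule AE_I2) (simp add: less_imp_le[OF gauss_pos])
  also have "(LINT x|lborel. a x * fourier_adj W x) = (LINT \<xi>|lborel. W \<xi> * fourier_adj a \<xi>)"
    by (rule fourier_adj_multiplication_formula[OF a Wint])
  also have "ennreal (norm \<dots>) \<le> (\<integral>\<^sup>+ \<xi>. ennreal (norm (W \<xi> * fourier_adj a \<xi>)) \<partial>lborel)"
    by (rule norm_integral_le_nn_integral)
  also have "\<dots> \<le> (\<integral>\<^sup>+ \<xi>. \<integral>\<^sup>+ \<eta>. ennreal (norm (W \<xi>) * norm (W \<eta>) * k (\<eta> - \<xi>)) \<partial>lborel \<partial>lborel)"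
  proof (rule nn_integral_mono)
    fix \<xi>
    have [measurable]: "k \<in> borel_measurable borel" unfolding k_def by measurable
    have "ennreal (norm (fourier_adj a \<xi>)) = ennreal (norm (LINT \<eta>|lborel. W \<eta> * complex_of_real (k (\<eta> - \<xi>))))"
      by (simp flip: adj)
    also have "\<dots> \<le> (\<integral>\<^sup>+ \<eta>. ennreal (norm (W \<eta>) * k (\<eta> - \<xi>)) \<partial>lborel)"
      using norm_integral_le_nn_integral[of lborel "\<lambda>\<eta>. W \<eta> * complex_of_real (k (\<eta> - \<xi>))"] kpos
      by (simp add: norm_mult)
    finally have "ennreal (norm (W \<xi>)) * ennreal (norm (fourier_adj a \<xi>))
        \<le> ennreal (norm (W \<xi>)) * (\<integral>\<^sup>+ \<eta>. ennreal (norm (W \<eta>) * k (\<eta> - \<xi>)) \<partial>lborel)"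
      by (rule mult_left_mono) simp
    also have "\<dots> = (\<integral>\<^sup>+ \<eta>. ennreal (norm (W \<xi>) * norm (W \<eta>) * k (\<eta> - \<xi>)) \<partial>lborel)"
      by (subst nn_integral_cmult[symmetric]) (simp_all add: ennreal_mult[symmetric] kpos mult.assoc)
    finally show "ennreal (norm (W \<xi> * fourier_adj a \<xi>)) \<le> \<dots>"
      by (simp add: norm_mult ennreal_mult)
  qed
  also have "\<dots> \<le> (\<integral>\<^sup>+ x. ennreal (k x) \<partial>lborel) * (\<integral>\<^sup>+ x. ennreal ((norm (W x))\<^sup>2) \<partial>lborel)"
    by (rule schur_bound) (auto simp: k_def gauss_def c)
  also have "(\<integral>\<^sup>+ x. ennreal (k x) \<partial>lborel) = ennreal ((2 * pi) ^ DIM(real ^ 'n))"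
  proof -
    have "(\<integral>\<^sup>+ x. ennreal (k x) \<partial>lborel) = ennreal c * (\<integral>\<^sup>+ x. ennreal (gauss (1 / s) (x :: real ^ 'n)) \<partial>lborel)"
      unfolding k_def by (subst nn_integral_cmult[symmetric]) (simp_all add: ennreal_mult c less_imp_le[OF gauss_pos])
    also have "\<dots> = ennreal (c * (sqrt (2 * pi) / (1 / s)) ^ DIM(real ^ 'n))"
      using s c by (subst gauss_integral(2)) (simp_all add: ennreal_mult)
    also have "c * (sqrt (2 * pi) / (1 / s)) ^ DIM(real ^ 'n) = (2 * pi) ^ DIM(real ^ 'n)"
      unfolding c_def power_mult_distrib[symmetric] using s by (simp add: real_sqrt_mult_self)
    finally show ?thesis .
  qed
  finally show ?thesis .
qed

text \<open>Let the Gaussian weight tend to \<open>1\<close> and apply Fatou's lemma.\<close>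

lemma plancherel_inequality:
  fixes W :: "real ^ 'n::finite \<Rightarrow> complex"
  assumes W: "bounded_comp_supp W"
  shows "(\<integral>\<^sup>+ x. ennreal ((norm (fourier_adj W x))\<^sup>2) \<partial>lborel)
    \<le> ennreal ((2 * pi) ^ DIM(real ^ 'n)) * (\<integral>\<^sup>+ \<xi>. ennreal ((norm (W \<xi>))\<^sup>2) \<partial>lborel)"
    (is "_ \<le> ?C")
proof -
  have [measurable]: "fourier_adj W \<in> borel_measurable borel"
    using continuous_fourier_adj[OF W] by (rule borel_measurable_continuous_onI)
  define u where "u n x = ennreal (gauss (1 / real (Suc n)) x * (norm (fourier_adj W x))\<^sup>2)" for n x
  have [measurable]: "u n \<in> borel_measurable lborel" for n
    unfolding u_def by measurable
  have "(\<lambda>n. u n x) \<longlonglongrightarrow> ennreal (exp (- (0 * norm x)\<^sup>2 / 2) * (norm (fourier_adj W x))\<^sup>2)" for x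
    unfolding u_def gauss_def
    by (intro tendsto_ennrealI tendsto_intros LIMSEQ_Suc lim_1_over_n) simp
  then have lim: "liminf (\<lambda>n. u n x) = ennreal ((norm (fourier_adj W x))\<^sup>2)" for x
    using lim_imp_Liminf[OF sequentially_bot] by fastforce
  have "(\<integral>\<^sup>+ x. ennreal ((norm (fourier_adj W x))\<^sup>2) \<partial>lborel) = (\<integral>\<^sup>+ x. liminf (\<lambda>n. u n x) \<partial>lborel)"
    by (simp add: lim)
  also have "\<dots> \<le> liminf (\<lambda>n. \<integral>\<^sup>+ x. u n x \<partial>lborel)"
    by (rule nn_integral_liminf) simp
  also have "\<dots> \<le> liminf (\<lambda>n. ?C)"
    unfolding u_def by (intro Liminf_mono always_eventually allI gauss_weighted_plancherel[OF W]) simp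
  also have "\<dots> = ?C" by (rule Liminf_const) simp
  finally show ?thesis .
qed

section \<open>Multipliers of compact support between dual Lebesgue spaces\<close>

definition L2norm :: "(real ^ 'n::finite \<Rightarrow> complex) \<Rightarrow> real" where
  "L2norm W = sqrt (LINT \<xi>|lborel. (norm (W \<xi>))\<^sup>2)"

lemma L2norm_nonneg: "L2norm W \<ge> 0"
  by (simp add: L2norm_def)

lemma nn_integral_L2norm:
  assumes W: "bounded_comp_supp W"
  shows "(\<integral>\<^sup>+ \<xi>. ennreal ((norm (W \<xi>))\<^sup>2) \<partial>lborel) = ennreal ((L2norm W)\<^sup>2)"
proof -
  obtain B where B: "\<And>\<xi>. norm (W \<xi>) \<le> B" using W unfolding bounded_comp_supp_def by blast
  have B0: "B \<ge> 0" using B[of 0] norm_ge_zero order_trans by blast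
  have [measurable]: "W \<in> borel_measurable borel" using W by (simp add: bounded_comp_supp_def)
  have "integrable lborel (\<lambda>\<xi>. (norm (W \<xi>))\<^sup>2)"
  proof (rule Bochner_Integration.integrable_bound[of lborel "\<lambda>\<xi>. B * norm (W \<xi>)"])
    show "integrable lborel (\<lambda>\<xi>. B * norm (W \<xi>))"
      using bounded_comp_supp_integrable[OF W] by simp
    show "AE \<xi> in lborel. norm ((norm (W \<xi>))\<^sup>2) \<le> norm (B * norm (W \<xi>))"
      using B B0 by (intro AE_I2) (simp add: power2_eq_square abs_mult mult_right_mono)
  qed measurable
  then show ?thesis
    using nn_integral_eq_integral[of lborel "\<lambda>\<xi>. (norm (W \<xi>))\<^sup>2"] by (simp add: L2norm_def)
qed

lemma fourier_adj_sup_bound: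
  fixes W :: "real ^ 'n::finite \<Rightarrow> complex"
  assumes W: "bounded_comp_supp W" and K: "compact K" "\<And>\<xi>. \<xi> \<notin> K \<Longrightarrow> W \<xi> = 0"
  shows "norm (fourier_adj W x) \<le> sqrt (measure lborel K) * L2norm W"
proof -
  have [measurable]: "W \<in> borel_measurable borel" using W by (simp add: bounded_comp_supp_def)
  have [measurable]: "K \<in> sets borel" using K by (auto intro: borel_closed compact_imp_closed)
  have fin: "emeasure lborel K = ennreal (measure lborel K)"
    using emeasure_compact_finite[OF K(1)] by (simp add: emeasure_eq_ennreal_measure less_top)
  define N where "N = (LINT \<xi>|lborel. norm (W \<xi>))"
  have N: "ennreal N = (\<integral>\<^sup>+ \<xi>. ennreal (norm (W \<xi>)) * indicator K \<xi> \<partial>lborel)"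
  proof -
    have "ennreal N = (\<integral>\<^sup>+ \<xi>. ennreal (norm (W \<xi>)) \<partial>lborel)"
      unfolding N_def by (rule nn_integral_eq_integral[symmetric]) (use bounded_comp_supp_integrable[OF W] in auto)
    also have "\<dots> = (\<integral>\<^sup>+ \<xi>. ennreal (norm (W \<xi>)) * indicator K \<xi> \<partial>lborel)"
      by (rule nn_integral_cong) (use K in \<open>auto simp: indicator_def\<close>)
    finally show ?thesis .
  qed
  have N0: "N \<ge> 0" by (simp add: N_def)
  have "ennreal (N\<^sup>2) = (\<integral>\<^sup>+ \<xi>. ennreal (norm (W \<xi>)) * indicator K \<xi> \<partial>lborel)\<^sup>2"
    using N0 by (simp add: N[symmetric] ennreal_power)
  also have "\<dots> \<le> (\<integral>\<^sup>+ \<xi>. (ennreal (norm (W \<xi>)))\<^sup>2 \<partial>lborel) * (\<integral>\<^sup>+ \<xi>. (indicator K \<xi>)\<^sup>2 \<partial>lborel)"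
    by (rule Cauchy_Schwarz_nn_integral) auto
  also have "(\<integral>\<^sup>+ \<xi>. (indicator K \<xi> :: ennreal)\<^sup>2 \<partial>lborel) = emeasure lborel K"
  proof -
    have "(indicator K \<xi> :: ennreal)\<^sup>2 = indicator K \<xi>" for \<xi> by (simp add: indicator_def)
    then show ?thesis by simp
  qed
  also have "(\<integral>\<^sup>+ \<xi>. (ennreal (norm (W \<xi>)))\<^sup>2 \<partial>lborel) = ennreal ((L2norm W)\<^sup>2)"
    unfolding nn_integral_L2norm[OF W, symmetric] by (simp add: ennreal_power)
  finally have "ennreal (N\<^sup>2) \<le> ennreal ((L2norm W)\<^sup>2 * measure lborel K)"
    by (simp add: fin ennreal_mult)
  then have "N\<^sup>2 \<le> (L2norm W)\<^sup>2 * measure lborel K"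
    by (subst (asm) ennreal_le_iff) auto
  also have "\<dots> = (sqrt (measure lborel K) * L2norm W)\<^sup>2"
    by (simp add: power_mult_distrib)
  finally have "N \<le> sqrt (measure lborel K) * L2norm W"
    by (rule power2_le_imp_le) (simp add: L2norm_nonneg)
  then show ?thesis
    using norm_fourier_adj_le[OF bounded_comp_supp_integrable[OF W], of x] by (simp add: N_def)
qed

lemma Lp_norm_leI:
  assumes g: "g \<in> borel_measurable borel" and q: "q > 0" and a: "a \<ge> 0"
    and le: "(\<integral>\<^sup>+ x. ennreal (norm (g x) powr q) \<partial>lborel) \<le> ennreal (a powr q)"
  shows "Lp_norm (ennreal q) g \<le> ennreal a"
proof -
  define I where "I = (\<integral>\<^sup>+ x. ennreal (norm (g x) powr q) \<partial>lborel)"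
  have "I \<noteq> top" using le unfolding I_def by (auto simp: top_unique)
  then obtain i where i: "I = ennreal i" "i \<ge> 0" by (cases I) auto
  then have ia: "i \<le> a powr q" using le by (simp add: I_def[symmetric])
  have "i powr (1 / q) \<le> (a powr q) powr (1 / q)"
    using i ia q by (intro powr_mono2) auto
  also have "\<dots> = a" using q a by (simp add: powr_powr)
  finally show ?thesis
    using g q i by (simp add: Lp_norm_def Let_def I_def[symmetric] ennreal_leI)
qed

lemma Lp_norm_finiteD:
  assumes q: "q > 0" and a: "a \<ge> 0" and eq: "Lp_norm (ennreal q) g = ennreal a"
  shows "(\<integral>\<^sup>+ x. ennreal (norm (g x) powr q) \<partial>lborel) = ennreal (a powr q)"
proof -
  define I where "I = (\<integral>\<^sup>+ x. ennreal (norm (g x) powr q) \<partial>lborel)"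
  have eq': "ennreal a = (if I = \<infinity> then \<infinity> else ennreal (enn2real I powr (1 / q)))"
    using eq q by (auto simp: Lp_norm_def Let_def I_def[symmetric] split: if_splits)
  then have fin: "I \<noteq> \<infinity>" by auto
  with eq' have "ennreal a = ennreal (enn2real I powr (1 / q))" by simp
  then have "a = enn2real I powr (1 / q)" using a by (subst (asm) ennreal_inj) auto
  then have "a powr q = enn2real I" using q by (simp add: powr_powr)
  then show ?thesis using fin by (simp add: I_def[symmetric] less_top)
qed

text \<open>The passage from extended exponents to real ones; only \<open>q\<close> can be infinite.\<close>

lemma conjugate_exponents_cases:
  fixes p q :: ennreal
  assumes "1 \<le> p" "p \<le> 2" "1 / p + 1 / q = 1"
  obtains "p = 1" "q = \<infinity>"
  | p' q' :: real where "p = ennreal p'" "q = ennreal q'" "1 < p'" "2 \<le> q'" "1 / p' + 1 / q' = 1"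
proof -
  obtain p' where p': "p = ennreal p'" "p' \<ge> 0"
    using assms by (cases p) (auto simp: top_unique)
  have p'12: "1 \<le> p'" "p' \<le> 2"
    using assms(1,2) p' by (auto simp: ennreal_le_iff2 simp flip: ennreal_1 ennreal_numeral)
  have ip: "1 / p = ennreal (1 / p')"
    using p' p'12 by (simp add: divide_ennreal flip: ennreal_1)
  show ?thesis
  proof (cases "q = \<infinity>")
    case True
    then have "ennreal (1 / p') = ennreal 1" using assms(3) ip by simp
    then have "p' = 1" using p'12 by (subst (asm) ennreal_inj) auto
    then show ?thesis using True p' that(1) by simp
  next
    case False
    then obtain q' where q': "q = ennreal q'" "q' \<ge> 0" by (cases q) auto
    have "q' \<noteq> 0"
    proof
      assume "q' = 0"
      then have "1 / q = \<infinity>" using q' by (simp add: ennreal_divide_zero)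
      then show False using assms(3) by simp
    qed
    then have q'0: "q' > 0" using q' by simp
    have "1 / q = ennreal (1 / q')"
      using q' q'0 by (simp add: divide_ennreal flip: ennreal_1)
    then have "ennreal (1 / p' + 1 / q') = ennreal 1"
      using assms(3) ip p'12 q'0 by (simp add: ennreal_plus)
    then have sum: "1 / p' + 1 / q' = 1"
      using p'12 q'0 by (subst (asm) ennreal_inj) auto
    have "1 < p'"
    proof (rule ccontr)
      assume "\<not> 1 < p'"
      then have "p' = 1" using p'12 by simp
      then show False using sum q'0 by simp
    qed
    moreover have "2 \<le> q'"
    proof -
      have "1 / p' \<ge> 1 / 2" using p'12 by (intro divide_left_mono) auto
      then have "1 / q' \<le> 1 / 2" using sum by linarith
      then show ?thesis using q'0 by (simp add: field_simps)
    qed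
    ultimately show ?thesis using that(2) p' q' sum by blast
  qed
qed

text \<open>Interpolation of a single function between \<open>L\<^sup>2\<close> and \<open>L\<^sup>\<infinity>\<close>, where the supremum is bounded by the
  \<open>L\<^sup>2\<close> norm of \<open>W\<close> because \<open>K\<close> has finite measure.\<close>

lemma fourier_adj_Lq_bound:
  fixes K :: "(real ^ 'n::finite) set"
  assumes K: "compact K" and q: "q = \<infinity> \<or> (\<exists>q'\<ge>2. q = ennreal q')"
  obtains C where "C \<ge> 0"
    "\<And>W. bounded_comp_supp W \<Longrightarrow> (\<And>\<xi>. \<xi> \<notin> K \<Longrightarrow> W \<xi> = 0) \<Longrightarrow>
      Lp_norm q (fourier_adj W) \<le> ennreal (C * L2norm W)"
proof -
  define \<kappa> where "\<kappa> = sqrt (measure lborel K)"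
  have \<kappa>: "\<kappa> \<ge> 0" by (simp add: \<kappa>_def)
  have sup: "norm (fourier_adj W x) \<le> \<kappa> * L2norm W"
    if "bounded_comp_supp W" "\<And>\<xi>. \<xi> \<notin> K \<Longrightarrow> W \<xi> = 0" for W x
    unfolding \<kappa>_def by (rule fourier_adj_sup_bound[OF that(1) K that(2)])
  have meas: "fourier_adj W \<in> borel_measurable borel" if "bounded_comp_supp W" for W :: "real ^ 'n \<Rightarrow> complex"
    using continuous_fourier_adj[OF that] by (rule borel_measurable_continuous_onI)
  show ?thesis
  proof (cases "q = \<infinity>")
    case True
    have "Lp_norm q (fourier_adj W) \<le> ennreal (\<kappa> * L2norm W)"
      if W: "bounded_comp_supp W" "\<And>\<xi>. \<xi> \<notin> K \<Longrightarrow> W \<xi> = 0" for W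
    proof -
      have [measurable]: "fourier_adj W \<in> borel_measurable borel" by (rule meas[OF W(1)])
      have "esssup lborel (\<lambda>x. ennreal (norm (fourier_adj W x))) \<le> ennreal (\<kappa> * L2norm W)"
        by (rule esssup_I) (use sup[OF W] in \<open>auto intro: ennreal_leI\<close>)
      then show ?thesis using True by (simp add: Lp_norm_def)
    qed
    then show ?thesis using that \<kappa> by blast
  next
    case False
    then obtain r where r: "r \<ge> 2" "q = ennreal r" using q by blast
    define d where "d = (2 * pi) ^ DIM(real ^ 'n)"
    have d: "d \<ge> 0" by (simp add: d_def)
    define C where "C = (\<kappa> powr (r - 2) * d) powr (1 / r)"
    have "Lp_norm q (fourier_adj W) \<le> ennreal (C * L2norm W)"
      if W: "bounded_comp_supp W" "\<And>\<xi>. \<xi> \<notin> K \<Longrightarrow> W \<xi> = 0" for W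
      unfolding r(2)
    proof (rule Lp_norm_leI[OF meas[OF W(1)]])
      have [measurable]: "fourier_adj W \<in> borel_measurable borel" by (rule meas[OF W(1)])
      define S where "S = L2norm W"
      have S: "S \<ge> 0" unfolding S_def by (rule L2norm_nonneg)
      show "0 \<le> C * L2norm W" by (simp add: C_def L2norm_nonneg)
      have split: "a powr r = a powr (r - 2) * a\<^sup>2" if "a \<ge> 0" for a :: real
        using that by (cases "a = 0") (simp_all add: powr_diff)
      have "(\<integral>\<^sup>+ x. ennreal (norm (fourier_adj W x) powr r) \<partial>lborel)
          \<le> (\<integral>\<^sup>+ x. ennreal ((\<kappa> * S) powr (r - 2)) * ennreal ((norm (fourier_adj W x))\<^sup>2) \<partial>lborel)"
        using sup[OF W] r
        by (intro nn_integral_mono) (auto simp: split S_def ennreal_mult'[symmetric] intro!: ennreal_leI mult_right_mono powr_mono2)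
      also have "\<dots> = ennreal ((\<kappa> * S) powr (r - 2)) * (\<integral>\<^sup>+ x. ennreal ((norm (fourier_adj W x))\<^sup>2) \<partial>lborel)"
        by (rule nn_integral_cmult) measurable
      also have "\<dots> \<le> ennreal ((\<kappa> * S) powr (r - 2)) * (ennreal d * ennreal (S\<^sup>2))"
        using plancherel_inequality[OF W(1)] unfolding nn_integral_L2norm[OF W(1)] d_def S_def
        by (intro mult_left_mono) auto
      also have "\<dots> = ennreal ((\<kappa> * S) powr (r - 2) * (d * S\<^sup>2))"
        using d by (simp add: ennreal_mult)
      also have "(\<kappa> * S) powr (r - 2) * (d * S\<^sup>2) = (\<kappa> powr (r - 2) * d) * S powr r"
        using \<kappa> S by (simp add: powr_mult split mult_ac)
      also have "\<dots> = (C * S) powr r"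
        using S r d \<kappa> by (simp add: C_def powr_mult powr_powr)
      finally show "(\<integral>\<^sup>+ x. ennreal (norm (fourier_adj W x) powr r) \<partial>lborel) \<le> ennreal ((C * L2norm W) powr r)"
        unfolding S_def .
    qed (use r in auto)
    moreover have "C \<ge> 0" by (simp add: C_def)
    ultimately show ?thesis using that by blast
  qed
qed

text \<open>Young's inequality applied to \<open>f / a\<close> and \<open>u / b\<close>.\<close>

lemma Holder_inequality:
  fixes f u :: "real ^ 'n::finite \<Rightarrow> complex"
  assumes f [measurable]: "f \<in> borel_measurable borel" and u [measurable]: "u \<in> borel_measurable borel"
    and pq: "1 \<le> p" "p \<le> 2" "1 / p + 1 / q = 1"
    and a: "Lp_norm p f = ennreal a" "a \<ge> 0" and b: "Lp_norm q u = ennreal b" "b \<ge> 0"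
  shows "norm (LINT x|lborel. f x * u x) \<le> a * b"
proof -
  have "(\<integral>\<^sup>+ x. ennreal (norm (f x) * norm (u x)) \<partial>lborel) \<le> ennreal (a * b)"
    using pq
  proof (cases rule: conjugate_exponents_cases)
    case 1
    have F: "(\<integral>\<^sup>+ x. ennreal (norm (f x)) \<partial>lborel) = ennreal a"
      using Lp_norm_finiteD[of 1 a f] a 1 by simp
    have "AE x in lborel. ennreal (norm (u x)) \<le> ennreal b"
      using b 1 esssup_AE[where M=lborel and f="\<lambda>x. ennreal (norm (u x))"] by (simp add: Lp_norm_def)
    then have "(\<integral>\<^sup>+ x. ennreal (norm (f x) * norm (u x)) \<partial>lborel) \<le> (\<integral>\<^sup>+ x. ennreal (norm (f x)) * ennreal b \<partial>lborel)"
    proof (intro nn_integral_mono_AE, eventually_elim)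
      show "ennreal (norm (f x) * norm (u x)) \<le> ennreal (norm (f x)) * ennreal b"
        if "ennreal (norm (u x)) \<le> ennreal b" for x
        using mult_left_mono[OF that, of "ennreal (norm (f x))"] by (simp add: ennreal_mult)
    qed
    also have "\<dots> = ennreal a * ennreal b" by (simp add: nn_integral_multc F)
    finally show ?thesis using a b by (simp add: ennreal_mult)
  next
    case (2 p' q')
    have F: "(\<integral>\<^sup>+ x. ennreal (norm (f x) powr p') \<partial>lborel) = ennreal (a powr p')"
      using Lp_norm_finiteD[of p' a f] a 2 by simp
    have G: "(\<integral>\<^sup>+ x. ennreal (norm (u x) powr q') \<partial>lborel) = ennreal (b powr q')"
      using Lp_norm_finiteD[of q' b u] b 2 by simp
    have zero: "(\<integral>\<^sup>+ x. ennreal (norm (f x) * norm (u x)) \<partial>lborel) = 0"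
      if "AE x in lborel. f x = 0 \<or> u x = 0"
    proof -
      have "(\<integral>\<^sup>+ x. ennreal (norm (f x) * norm (u x)) \<partial>lborel) = (\<integral>\<^sup>+ x. 0 \<partial>(lborel :: (real ^ 'n) measure))"
        using that by (intro nn_integral_cong_AE) auto
      then show ?thesis by simp
    qed
    show ?thesis
    proof (cases "a = 0 \<or> b = 0")
      case True
      have "AE x in lborel. f x = 0 \<or> u x = 0"
      proof (cases "a = 0")
        case True
        then have "AE x in lborel. ennreal (norm (f x) powr p') = 0"
          using F by (subst nn_integral_0_iff_AE[symmetric]) auto
        then show ?thesis by eventually_elim (auto simp: ennreal_eq_0_iff)
      next
        case False
        then have "AE x in lborel. ennreal (norm (u x) powr q') = 0"
          using G \<open>a = 0 \<or> b = 0\<close> by (subst nn_integral_0_iff_AE[symmetric]) auto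
        then show ?thesis by eventually_elim (auto simp: ennreal_eq_0_iff)
      qed
      then show ?thesis using zero by simp
    next
      case False
      then have ab: "a > 0" "b > 0" using a b by auto
      define A where "A = a * b / (p' * a powr p')"
      define B where "B = a * b / (q' * b powr q')"
      have AB: "A \<ge> 0" "B \<ge> 0" using ab 2 by (auto simp: A_def B_def)
      have "norm (f x) * norm (u x) \<le> A * norm (f x) powr p' + B * norm (u x) powr q'" for x
      proof -
        have "(norm (f x) / a) * (norm (u x) / b) \<le> (norm (f x) / a) powr p' / p' + (norm (u x) / b) powr q' / q'"
          using 2 ab by (intro Youngs_inequality) auto
        then have "a * b * ((norm (f x) / a) * (norm (u x) / b))
            \<le> a * b * ((norm (f x) / a) powr p' / p' + (norm (u x) / b) powr q' / q')"
          using ab by (intro mult_left_mono) auto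
        then show ?thesis
          using ab by (simp add: A_def B_def powr_divide distrib_left mult_ac)
      qed
      then have "(\<integral>\<^sup>+ x. ennreal (norm (f x) * norm (u x)) \<partial>lborel)
          \<le> (\<integral>\<^sup>+ x. ennreal A * ennreal (norm (f x) powr p') + ennreal B * ennreal (norm (u x) powr q') \<partial>lborel)"
        using AB by (intro nn_integral_mono)
          (simp add: ennreal_mult[symmetric] ennreal_plus[symmetric] ennreal_leI del: ennreal_plus)
      also have "\<dots> = ennreal A * ennreal (a powr p') + ennreal B * ennreal (b powr q')"
        by (simp add: nn_integral_add nn_integral_cmult F G)
      also have "\<dots> = ennreal (A * a powr p' + B * b powr q')"
        using AB by (simp add: ennreal_mult)
      also have "A * a powr p' + B * b powr q' = a * b * (1 / p' + 1 / q')"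
        using ab 2(3,4) by (simp add: A_def B_def distrib_left)
      finally show ?thesis using 2 by simp
    qed
  qed
  then have "ennreal (norm (LINT x|lborel. f x * u x)) \<le> ennreal (a * b)"
    using norm_integral_le_nn_integral[of lborel "\<lambda>x. f x * u x"] by (simp add: norm_mult)
  then show ?thesis using a b by simp
qed

lemma Lp_norm_finite:
  fixes f :: "real ^ 'n::finite \<Rightarrow> complex"
  assumes f: "bounded_comp_supp f" and p: "p > 0"
  shows "Lp_norm (ennreal p) f \<noteq> \<infinity>"
proof -
  obtain B r where B: "\<And>\<xi>. norm (f \<xi>) \<le> B" and r: "\<And>\<xi>. f \<xi> \<noteq> 0 \<Longrightarrow> norm \<xi> \<le> r"
    and [measurable]: "f \<in> borel_measurable borel"
    using f unfolding bounded_comp_supp_def by blast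
  have "(\<integral>\<^sup>+ x. ennreal (norm (f x) powr p) \<partial>lborel) \<le> (\<integral>\<^sup>+ x. ennreal (B powr p) * indicator (cball 0 r :: (real ^ 'n) set) x \<partial>lborel)"
  proof (rule nn_integral_mono)
    show "ennreal (norm (f x) powr p) \<le> ennreal (B powr p) * indicator (cball 0 r) x" for x
      using B[of x] r[of x] p by (cases "f x = 0") (auto simp: indicator_def intro!: ennreal_leI powr_mono2)
  qed
  also have "\<dots> = ennreal (B powr p) * emeasure lborel (cball 0 r :: (real ^ 'n) set)"
    by (subst nn_integral_cmult_indicator) auto
  also have "\<dots> < \<infinity>"
    using emeasure_lborel_cball_finite[of "0 :: real ^ 'n" r] by (simp add: ennreal_mult_less_top)
  finally show ?thesis using p by (simp add: Lp_norm_def Let_def)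
qed

lemma bounded_comp_supp_indicator:
  assumes "compact K"
  shows "bounded_comp_supp (\<lambda>\<xi>. indicator K \<xi> :: complex)"
  unfolding bounded_comp_supp_def
proof (intro conjI)
  show "(\<lambda>\<xi>. indicator K \<xi> :: complex) \<in> borel_measurable borel"
    using compact_imp_closed[OF assms] by simp
  show "\<exists>B. \<forall>\<xi>. norm (indicator K \<xi> :: complex) \<le> B"
    by (auto simp: indicator_def intro!: exI[of _ 1])
  show "\<exists>r. \<forall>\<xi>. (indicator K \<xi> :: complex) \<noteq> 0 \<longrightarrow> norm \<xi> \<le> r"
    using compact_imp_bounded[OF assms] by (auto simp: bounded_iff indicator_def)
qed

text \<open>The bound of \<open>fourier_adj\<close> from \<open>L\<^sup>2(K)\<close> to \<open>L\<^sup>q\<close> is used twice: directly for \<open>W\<close>, and by duality for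
  \<open>V = fourier f\<close> restricted to \<open>K\<close>. For the latter, \<open>\<parallel>V\<parallel>\<^sup>2\<close> is the integral of \<open>cnj f\<close> against the adjoint
  transform of \<open>V\<close>, so \<open>\<parallel>V\<parallel>\<^sup>2 \<le> \<parallel>f\<parallel>\<^sub>p C \<parallel>V\<parallel>\<close> by Hoelder's inequality.\<close>

lemma multiplier_Lp_Lq_bound:
  fixes K :: "(real ^ 'n::finite) set"
  assumes K: "compact K" and pq: "1 \<le> p" "p \<le> 2" "1 / p + 1 / q = 1"
  obtains C where "C \<ge> 0"
    "\<And>f W b. bounded_comp_supp f \<Longrightarrow> bounded_comp_supp W \<Longrightarrow> (\<And>\<xi>. \<xi> \<notin> K \<Longrightarrow> W \<xi> = 0) \<Longrightarrow>
       b \<ge> 0 \<Longrightarrow> (\<And>\<xi>. norm (W \<xi>) \<le> b * norm (fourier f \<xi>)) \<Longrightarrow>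
       Lp_norm q (fourier_adj W) \<le> ennreal (C * b) * Lp_norm p f"
proof -
  have q: "q = \<infinity> \<or> (\<exists>q'\<ge>2. q = ennreal q')" and p: "\<exists>p'>0. p = ennreal p'"
    using conjugate_exponents_cases[OF pq]
    by (metis ennreal_1 zero_less_one less_trans)+
  obtain C where C: "C \<ge> 0"
    and Lq: "\<And>W. bounded_comp_supp W \<Longrightarrow> (\<And>\<xi>. \<xi> \<notin> K \<Longrightarrow> W \<xi> = 0) \<Longrightarrow>
      Lp_norm q (fourier_adj W) \<le> ennreal (C * L2norm W)"
    using fourier_adj_Lq_bound[OF K q] by blast
  have "Lp_norm q (fourier_adj W) \<le> ennreal ((C * C) * b) * Lp_norm p f"
    if f: "bounded_comp_supp f" and W: "bounded_comp_supp W" "\<And>\<xi>. \<xi> \<notin> K \<Longrightarrow> W \<xi> = 0"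
      and b: "b \<ge> 0" "\<And>\<xi>. norm (W \<xi>) \<le> b * norm (fourier f \<xi>)" for f W b
  proof -
    have "Lp_norm p f \<noteq> \<infinity>" using p Lp_norm_finite[OF f] by blast
    then obtain a where a: "Lp_norm p f = ennreal a" "a \<ge> 0"
      by (cases "Lp_norm p f") auto
    have [measurable]: "f \<in> borel_measurable borel" using f by (simp add: bounded_comp_supp_def)
    have [measurable]: "(\<lambda>x. cnj (f x)) \<in> borel_measurable borel"
      using borel_measurable_continuous_onI[of cnj] by (intro measurable_compose[of f _ borel cnj]) (auto intro: continuous_intros)
    have [measurable]: "K \<in> sets borel" using K by (auto intro: borel_closed compact_imp_closed)
    define f' where "f' = (\<lambda>x. cnj (f x))"
    have f': "bounded_comp_supp f'"
      using f by (auto simp: f'_def bounded_comp_supp_def)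
    have a': "Lp_norm p f' = ennreal a"
      unfolding a(1)[symmetric] by (simp add: Lp_norm_def f'_def)
    have adj_f': "fourier_adj f' \<xi> = cnj (fourier f \<xi>)" for \<xi>
      unfolding fourier_adj_def fourier_def Bochner_Integration.integral_cnj[symmetric]
      by (rule Bochner_Integration.integral_cong) (simp_all add: f'_def exp_cnj inner_commute)
    define V where "V \<xi> = fourier f \<xi> * indicator K \<xi>" for \<xi>
    have V: "bounded_comp_supp V"
      unfolding V_def by (rule bounded_comp_supp_mult[OF bounded_comp_supp_indicator[OF K] continuous_fourier[OF f]])
    define S where "S = L2norm V"
    have S: "S \<ge> 0" unfolding S_def by (rule L2norm_nonneg)
    have "Lp_norm q (fourier_adj V) \<le> ennreal (C * S)"
      unfolding S_def by (rule Lq[OF V]) (simp add: V_def)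
    then obtain e where e: "Lp_norm q (fourier_adj V) = ennreal e" "e \<ge> 0" "e \<le> C * S"
      using C S by (cases "Lp_norm q (fourier_adj V)") (auto simp: top_unique)
    have sq: "V \<xi> * fourier_adj f' \<xi> = complex_of_real ((norm (V \<xi>))\<^sup>2)" for \<xi>
      unfolding adj_f' V_def complex_norm_square by (simp add: indicator_def)
    have "S\<^sup>2 = (LINT \<xi>|lborel. (norm (V \<xi>))\<^sup>2)"
      by (simp add: S_def L2norm_def)
    also have "\<dots> = norm (LINT \<xi>|lborel. V \<xi> * fourier_adj f' \<xi>)"
      unfolding sq integral_complex_of_real norm_of_real by simp
    also have "(LINT \<xi>|lborel. V \<xi> * fourier_adj f' \<xi>) = (LINT x|lborel. f' x * fourier_adj V x)"
      by (rule fourier_adj_multiplication_formula[OF bounded_comp_supp_integrable[OF V] bounded_comp_supp_integrable[OF f']])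
    also have "norm \<dots> \<le> a * e"
    proof (rule Holder_inequality[OF _ _ pq a' a(2) e(1,2)])
      show "f' \<in> borel_measurable borel" unfolding f'_def by measurable
      show "fourier_adj V \<in> borel_measurable borel"
        using continuous_fourier_adj[OF V] by (rule borel_measurable_continuous_onI)
    qed
    also have "\<dots> \<le> a * (C * S)" using e a by (intro mult_left_mono) auto
    finally have "S * S \<le> (a * C) * S" by (simp add: power2_eq_square mult.assoc)
    then have S_le: "S \<le> a * C"
      using S a C by (cases "S = 0") (auto simp: mult_le_cancel_right)
    have "(\<integral>\<^sup>+ \<xi>. ennreal ((norm (W \<xi>))\<^sup>2) \<partial>lborel) \<le> (\<integral>\<^sup>+ \<xi>. ennreal (b\<^sup>2) * ennreal ((norm (V \<xi>))\<^sup>2) \<partial>lborel)"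
    proof (rule nn_integral_mono)
      fix \<xi>
      have "norm (W \<xi>) \<le> b * norm (V \<xi>)"
        using b(2)[of \<xi>] W(2)[of \<xi>] by (cases "\<xi> \<in> K") (auto simp: V_def norm_mult)
      then have "(norm (W \<xi>))\<^sup>2 \<le> (b * norm (V \<xi>))\<^sup>2" by (rule power_mono) simp
      then show "ennreal ((norm (W \<xi>))\<^sup>2) \<le> ennreal (b\<^sup>2) * ennreal ((norm (V \<xi>))\<^sup>2)"
        by (simp add: ennreal_mult[symmetric] power_mult_distrib ennreal_leI)
    qed
    also have "\<dots> = ennreal (b\<^sup>2) * ennreal (S\<^sup>2)"
      unfolding S_def nn_integral_L2norm[OF V, symmetric]
      using V by (intro nn_integral_cmult) (auto simp: bounded_comp_supp_def)
    finally have "ennreal ((L2norm W)\<^sup>2) \<le> ennreal ((b * S)\<^sup>2)"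
      by (simp add: nn_integral_L2norm[OF W(1)] ennreal_mult[symmetric] power_mult_distrib)
    then have "(L2norm W)\<^sup>2 \<le> (b * S)\<^sup>2" by (subst (asm) ennreal_le_iff) auto
    then have "L2norm W \<le> b * S" using b S by (intro power2_le_imp_le[of "L2norm W"]) auto
    also have "\<dots> \<le> b * (a * C)" using S_le b by (intro mult_left_mono)
    finally have "C * L2norm W \<le> C * (b * (a * C))" using C by (intro mult_left_mono)
    then have "Lp_norm q (fourier_adj W) \<le> ennreal (C * (b * (a * C)))"
      using Lq[OF W] by (meson ennreal_leI order_trans)
    also have "\<dots> = ennreal ((C * C) * b) * Lp_norm p f"
      using a b C by (simp add: ennreal_mult[symmetric] mult_ac)
    finally show ?thesis .
  qed
  then show ?thesis using C that[of "C * C"] by simp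
qed

section \<open>The localized solution\<close>

lemma open_nbhd: "open (nbhd \<epsilon> M)"
proof (cases "M = {}")
  case False
  have "open {\<xi>. infdist \<xi> M < \<epsilon>}"
    by (intro open_Collect_less continuous_intros)
  then show ?thesis using False by (simp add: nbhd_def)
qed (simp add: nbhd_def)

lemma mpow_mult_bounded:
  assumes "bounded_comp_supp chi"
  obtains D where "D \<ge> 0" "\<And>\<xi>. norm (mpow \<xi> \<alpha> * chi \<xi>) \<le> D"
proof -
  have "bounded_comp_supp (\<lambda>\<xi>. mpow \<xi> \<alpha> * chi \<xi>)"
    by (rule bounded_comp_supp_mult[OF assms continuous_mpow])
  then obtain D where D: "\<And>\<xi>. norm (mpow \<xi> \<alpha> * chi \<xi>) \<le> D"
    unfolding bounded_comp_supp_def by blast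
  have "D \<ge> 0" using D[of 0] norm_ge_zero order_trans by blast
  then show ?thesis using D that by blast
qed

lemma support_C0_infinity:
  assumes "chi \<in> C0_infinity U"
  shows "compact (closure {\<xi>. chi \<xi> \<noteq> 0})" "closure {\<xi>. chi \<xi> \<noteq> 0} \<subseteq> U"
    "\<And>\<xi>. \<xi> \<notin> closure {\<xi>. chi \<xi> \<noteq> 0} \<Longrightarrow> chi \<xi> = 0"
  using assms closure_subset[of "{\<xi>. chi \<xi> \<noteq> 0}"] unfolding C0_infinity_def by auto

context separated_root_group
begin

text \<open>The integrand of \<open>D\<^sub>t\<^sup>n\<close> of the localized solution, apart from the exponential.\<close>

definition amplitude :: "(real ^ 'n \<Rightarrow> complex) \<Rightarrow> (real ^ 'n \<Rightarrow> complex) \<Rightarrow> nat \<Rightarrow> real \<Rightarrow> real ^ 'n \<Rightarrow> complex" where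
  "amplitude chi f n t \<xi> = fourier f \<xi> * (indicator U \<xi> * g n t \<xi> * chi \<xi>)"

lemma localized_solution_eq:
  "localized_solution U L \<tau> A chi f t = fourier_adj (amplitude chi f 0 t)"
  unfolding localized_solution_def fourier_adj_def set_lebesgue_integral_def
  by (intro ext Bochner_Integration.integral_cong)
    (simp_all add: amplitude_def group_part_eq_exp_poly deriv_part_def indicator_def)

context
  fixes chi f :: "real ^ 'n \<Rightarrow> complex"
  assumes chi: "chi \<in> C0_infinity U" and f: "f \<in> C0_infinity UNIV"
begin

abbreviation "K \<equiv> closure {\<xi>. chi \<xi> \<noteq> 0}"

lemmas K = support_C0_infinity[OF chi]

lemma bounded_comp_supp_amplitude: "bounded_comp_supp (amplitude chi f n t)"
  unfolding amplitude_def
proof (rule bounded_comp_supp_mult[OF _ continuous_fourier[OF bounded_comp_supp_C0_infinity[OF f]]])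
  obtain B r where B: "\<And>\<xi>. norm (chi \<xi>) \<le> B" and r: "\<And>\<xi>. chi \<xi> \<noteq> 0 \<Longrightarrow> norm \<xi> \<le> r"
    and [measurable]: "chi \<in> borel_measurable borel"
    using bounded_comp_supp_C0_infinity[OF chi] unfolding bounded_comp_supp_def by blast
  have B0: "B \<ge> 0" using B[of 0] norm_ge_zero order_trans by blast
  obtain C where C: "C \<ge> 0" "\<And>\<xi> s. \<xi> \<in> K \<Longrightarrow> \<bar>s\<bar> \<le> \<bar>t\<bar> \<Longrightarrow> norm (g n s \<xi>) \<le> C"
    using g_locally_bounded[OF K(1,2), of "\<bar>t\<bar>" n] by blast
  have "norm (indicator U \<xi> * g n t \<xi> * chi \<xi>) \<le> C * B" for \<xi>
  proof (cases "\<xi> \<in> K")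
    case True
    then show ?thesis using C(2)[OF True, of t] B[of \<xi>] C(1) B0
      by (auto simp: norm_mult indicator_def intro: mult_mono)
  qed (use K(3)[of \<xi>] C(1) B0 in simp)
  moreover have "(\<lambda>\<xi>. indicator U \<xi> * g n t \<xi> * chi \<xi>) \<in> borel_measurable borel"
    by (rule borel_measurable_times[OF g_borel_measurable]) measurable
  ultimately show "bounded_comp_supp (\<lambda>\<xi>. indicator U \<xi> * g n t \<xi> * chi \<xi>)"
    unfolding bounded_comp_supp_def using r by (metis mult_zero_right)
qed

lemma bounded_comp_supp_mpow_amplitude: "bounded_comp_supp (\<lambda>\<xi>. mpow \<xi> \<alpha> * amplitude chi f n t \<xi>)"
  by (rule bounded_comp_supp_mult[OF bounded_comp_supp_amplitude continuous_mpow])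

lemma norm_mpow_amplitude_le:
  assumes D: "\<And>\<xi>. norm (mpow \<xi> \<alpha> * chi \<xi>) \<le> D" and C: "\<And>\<xi>. \<xi> \<in> K \<Longrightarrow> norm (g n t \<xi>) \<le> C" "C \<ge> 0"
  shows "norm (mpow \<xi> \<alpha> * amplitude chi f n t \<xi>) \<le> D * C * norm (fourier f \<xi>)"
proof (cases "\<xi> \<in> K")
  case True
  then have "\<xi> \<in> U" by (rule subsetD[OF K(2)])
  then have "norm (mpow \<xi> \<alpha> * amplitude chi f n t \<xi>) = norm (mpow \<xi> \<alpha> * chi \<xi>) * norm (g n t \<xi>) * norm (fourier f \<xi>)"
    by (simp add: amplitude_def norm_mult)
  also have "\<dots> \<le> D * C * norm (fourier f \<xi>)"
    using D[of \<xi>] C(1)[OF True] C(2) order_trans[OF norm_ge_zero D[of \<xi>]] by (intro mult_mono) auto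
  finally show ?thesis .
next
  case False
  then show ?thesis
    using K(3)[of \<xi>] C(2) order_trans[OF norm_ge_zero D[of \<xi>]] by (simp add: amplitude_def)
qed

lemma fourier_adj_amplitude_has_time_derivative:
  "((\<lambda>t. fourier_adj (\<lambda>\<xi>. mpow \<xi> \<alpha> * amplitude chi f n t \<xi>) x) has_vector_derivative
    \<i> * fourier_adj (\<lambda>\<xi>. mpow \<xi> \<alpha> * amplitude chi f (Suc n) t \<xi>) x) (at t)"
proof -
  obtain C where C: "C \<ge> 0" "\<And>\<xi> s. \<xi> \<in> K \<Longrightarrow> \<bar>s\<bar> \<le> \<bar>t\<bar> + 1 \<Longrightarrow> norm (g (Suc n) s \<xi>) \<le> C"
    using g_locally_bounded[OF K(1,2), of "\<bar>t\<bar> + 1" "Suc n"] by blast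
  obtain D where D: "D \<ge> 0" "\<And>\<xi>. norm (mpow \<xi> \<alpha> * chi \<xi>) \<le> D"
    using mpow_mult_bounded[OF bounded_comp_supp_C0_infinity[OF chi]] by blast
  define F where "F n s \<xi> = exp (\<i> * complex_of_real (x \<bullet> \<xi>)) * (mpow \<xi> \<alpha> * amplitude chi f n s \<xi>)" for n s \<xi>
  define w where "w \<xi> = norm (D * C * fourier f \<xi> * indicator K \<xi>)" for \<xi>
  have F_int: "integrable lborel (F n s)" for n s
    unfolding F_def by (rule fourier_adj_integrand[OF bounded_comp_supp_mpow_amplitude])
  have dF: "((\<lambda>s. F n s \<xi>) has_vector_derivative \<i> * F (Suc n) s \<xi>) (at s)" for s \<xi>
    unfolding F_def amplitude_def
    by (rule has_vector_derivative_eq_rhs,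
        (rule has_vector_derivative_mult_right has_vector_derivative_mult_left deriv_part_has_vector_derivative)+)
      (simp add: mult_ac)
  have w_int: "integrable lborel w"
  proof -
    have "bounded_comp_supp (\<lambda>\<xi>. (D * C * fourier f \<xi>) * indicator K \<xi>)"
      by (rule bounded_comp_supp_mult[OF bounded_comp_supp_indicator[OF K(1)]])
        (intro continuous_intros continuous_fourier bounded_comp_supp_C0_infinity[OF f])
    then show ?thesis
      unfolding w_def by (intro integrable_norm bounded_comp_supp_integrable)
  qed
  have bound: "norm (\<i> * F (Suc n) s \<xi>) \<le> w \<xi>" if "\<bar>s - t\<bar> < 1" for s \<xi>
  proof (cases "\<xi> \<in> K")
    case True
    have "\<bar>s\<bar> \<le> \<bar>t\<bar> + 1" using that by linarith
    then show ?thesis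
      using norm_mpow_amplitude_le[of \<alpha> D "Suc n" s C \<xi>] C D True
      by (simp add: F_def w_def norm_mult)
  next
    case False
    then show ?thesis using K(3)[of \<xi>] by (simp add: F_def w_def amplitude_def)
  qed
  have "((\<lambda>s. LINT \<xi>|lborel. F n s \<xi>) has_vector_derivative (LINT \<xi>|lborel. \<i> * F (Suc n) t \<xi>)) (at t)"
    by (rule has_vector_derivative_lebesgue_integral[where w=w and f'="\<lambda>s \<xi>. \<i> * F (Suc n) s \<xi>"])
      (use F_int dF bound w_int in auto)
  then show ?thesis by (simp add: F_def fourier_adj_def)
qed

lemma Dt_funpow_localized_solution:
  "(Dt ^^ n) (\<lambda>t. Dx_multi \<alpha> (localized_solution U L \<tau> A chi f t) x) =
    (\<lambda>t. fourier_adj (\<lambda>\<xi>. mpow \<xi> \<alpha> * amplitude chi f n t \<xi>) x)"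
proof (induction n)
  case 0
  show ?case
    by (simp add: localized_solution_eq Dx_multi_fourier_adj[OF bounded_comp_supp_amplitude])
next
  case (Suc n)
  have "(Dt ^^ Suc n) (\<lambda>t. Dx_multi \<alpha> (localized_solution U L \<tau> A chi f t) x) =
      Dt (\<lambda>t. fourier_adj (\<lambda>\<xi>. mpow \<xi> \<alpha> * amplitude chi f n t \<xi>) x)"
    by (simp add: Suc)
  also have "\<dots> = (\<lambda>t. fourier_adj (\<lambda>\<xi>. mpow \<xi> \<alpha> * amplitude chi f (Suc n) t \<xi>) x)"
    unfolding Dt_def by (simp add: vector_derivative_at[OF fourier_adj_amplitude_has_time_derivative])
  finally show ?case .
qed

lemma smooth_localized_solution: "smooth (localized_solution U L \<tau> A chi f t)"
  unfolding localized_solution_eq by (rule smooth_fourier_adj[OF bounded_comp_supp_amplitude])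

lemma smooth_time_localized_solution:
  "smooth_time (\<lambda>t. Dx_multi \<alpha> (localized_solution U L \<tau> A chi f t) x)"
  unfolding smooth_time_def Dt_funpow_localized_solution
  by (intro allI differentiableI_vector[OF fourier_adj_amplitude_has_time_derivative])

end

lemma localized_solution_bound:
  assumes chi: "chi \<in> C0_infinity U"
    and \<delta>: "\<And>\<xi> k. \<xi> \<in> U \<Longrightarrow> k \<in> {1..L} \<Longrightarrow> Im (\<tau> k \<xi>) \<ge> \<delta>"
    and pq: "1 \<le> p" "p \<le> 2" "1 / p + 1 / q = 1"
  shows "\<exists>C\<ge>0. \<forall>t\<ge>0. \<forall>f\<in>C0_infinity UNIV.
    Lp_norm q (\<lambda>x. (Dt ^^ r) (\<lambda>s. Dx_multi \<alpha> (localized_solution U L \<tau> A chi f s) x) t)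
      \<le> ennreal (C * (1 + t) ^ (L - 1) * exp (- \<delta> * t)) * Lp_norm p f"
proof -
  note K = support_C0_infinity[OF chi]
  let ?K = "closure {\<xi>. chi \<xi> \<noteq> 0}"
  obtain C1 where C1: "C1 \<ge> 0"
    "\<And>\<xi> t. \<xi> \<in> ?K \<Longrightarrow> t \<ge> 0 \<Longrightarrow> norm (g r t \<xi>) \<le> C1 * (1 + t) ^ (L - 1) * exp (- \<delta> * t)"
    using g_decay[OF K(1,2), of \<delta> r] \<delta> K(2) by blast
  obtain D where D: "D \<ge> 0" "\<And>\<xi>. norm (mpow \<xi> \<alpha> * chi \<xi>) \<le> D"
    using mpow_mult_bounded[OF bounded_comp_supp_C0_infinity[OF chi]] by blast
  obtain C2 where C2: "C2 \<ge> 0"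
    and mult: "\<And>f W b. bounded_comp_supp f \<Longrightarrow> bounded_comp_supp W \<Longrightarrow> (\<And>\<xi>. \<xi> \<notin> ?K \<Longrightarrow> W \<xi> = 0) \<Longrightarrow>
       b \<ge> 0 \<Longrightarrow> (\<And>\<xi>. norm (W \<xi>) \<le> b * norm (fourier f \<xi>)) \<Longrightarrow>
       Lp_norm q (fourier_adj W) \<le> ennreal (C2 * b) * Lp_norm p f"
    using multiplier_Lp_Lq_bound[OF K(1) pq] by blast
  show ?thesis
  proof (intro exI[of _ "C2 * D * C1"] conjI allI impI ballI)
    show "0 \<le> C2 * D * C1" using C1 C2 D by simp
    fix t :: real and f :: "real ^ 'n \<Rightarrow> complex"
    assume t: "0 \<le> t" and f: "f \<in> C0_infinity UNIV"
    define b where "b = D * (C1 * (1 + t) ^ (L - 1) * exp (- \<delta> * t))"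
    have "Lp_norm q (fourier_adj (\<lambda>\<xi>. mpow \<xi> \<alpha> * amplitude chi f r t \<xi>)) \<le> ennreal (C2 * b) * Lp_norm p f"
    proof (rule mult[OF bounded_comp_supp_C0_infinity[OF f] bounded_comp_supp_mpow_amplitude[OF chi f]])
      show "mpow \<xi> \<alpha> * amplitude chi f r t \<xi> = 0" if "\<xi> \<notin> ?K" for \<xi>
        using K(3)[OF that] by (simp add: amplitude_def)
      show "0 \<le> b" using C1 D t by (simp add: b_def)
      show "norm (mpow \<xi> \<alpha> * amplitude chi f r t \<xi>) \<le> b * norm (fourier f \<xi>)" for \<xi>
        unfolding b_def using norm_mpow_amplitude_le[OF chi f D(2)] C1 t by simp
    qed
    then show "Lp_norm q (\<lambda>x. (Dt ^^ r) (\<lambda>s. Dx_multi \<alpha> (localized_solution U L \<tau> A chi f s) x) t)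
      \<le> ennreal (C2 * D * C1 * (1 + t) ^ (L - 1) * exp (- \<delta> * t)) * Lp_norm p f"
      unfolding Dt_funpow_localized_solution[OF chi f] b_def by (simp add: mult.assoc)
  qed
qed

end

theorem theorem2p2:
  fixes m L j r :: nat
    and P :: "nat \<Rightarrow> real ^ 'n::finite \<Rightarrow> complex"
    and c :: "('n \<Rightarrow> nat) \<Rightarrow> nat \<Rightarrow> complex"
    and \<tau> :: "nat \<Rightarrow> real ^ 'n \<Rightarrow> complex"
    and E :: "nat \<Rightarrow> real \<Rightarrow> real ^ 'n \<Rightarrow> complex"
    and A :: "nat \<Rightarrow> nat \<Rightarrow> real ^ 'n \<Rightarrow> complex poly"
    and M :: "(real ^ 'n) set"
    and \<epsilon> \<delta> :: real
    and chi :: "real ^ 'n \<Rightarrow> complex"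
    and p q :: ennreal
    and \<alpha> :: "'n \<Rightarrow> nat"
  assumes P: "\<And>i. i \<in> {1..m} \<Longrightarrow> homogeneous_poly i (P i)"
    and hyp: "strictly_hyperbolic m P"
    and roots: "characteristic_roots m P c \<tau>"
    and E: "\<And>i \<xi>. i < m \<Longrightarrow> fundamental_solution m P c \<xi> i (\<lambda>t. E i t \<xi>)"
    and A: "\<And>i t \<xi>. i < m \<Longrightarrow>
      E i t \<xi> = (\<Sum>k=1..m. exp (\<i> * \<tau> k \<xi> * complex_of_real t) * poly (A i k \<xi>) (complex_of_real t))"
    and L: "1 \<le> L" "L \<le> m"
    and M: "bounded M" "{\<xi>. \<forall>k\<in>{1..L}. \<tau> k \<xi> = \<tau> 1 \<xi>} \<subseteq> M"
    and \<epsilon>: "\<epsilon> > 0"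
    and separated: "\<And>\<xi> k l. \<xi> \<in> nbhd \<epsilon> M \<Longrightarrow> k \<in> {1..L} \<Longrightarrow> l \<in> {L+1..m} \<Longrightarrow> \<tau> k \<xi> \<noteq> \<tau> l \<xi>"
    and cont: "continuous_root_group L \<tau> (nbhd \<epsilon> M)"
    and chi: "chi \<in> C0_infinity (nbhd \<epsilon> M)"
    and \<delta>: "\<delta> > 0" "\<And>\<xi> k. \<xi> \<in> nbhd \<epsilon> M \<Longrightarrow> k \<in> {1..L} \<Longrightarrow> Im (\<tau> k \<xi>) \<ge> \<delta>"
    and pq: "1 \<le> p" "p \<le> 2" "1 / p + 1 / q = 1"
    and j: "j < m"
  shows "(\<forall>f\<in>C0_infinity UNIV.
             (\<forall>t. smooth (localized_solution (nbhd \<epsilon> M) L \<tau> (A j) chi f t)) \<and>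
             (\<forall>x. smooth_time (\<lambda>t. Dx_multi \<alpha> (localized_solution (nbhd \<epsilon> M) L \<tau> (A j) chi f t) x))) \<and>
         (\<exists>C\<ge>0. \<forall>t\<ge>0. \<forall>f\<in>C0_infinity UNIV.
             Lp_norm q (\<lambda>x. (Dt ^^ r) (\<lambda>s. Dx_multi \<alpha> (localized_solution (nbhd \<epsilon> M) L \<tau> (A j) chi f s) x) t)
               \<le> ennreal (C * (1 + t) ^ (L - 1) * exp (- \<delta> * t)) * Lp_norm p f)"
proof -
  have E': "fundamental_solution m P c \<xi> j
      (\<lambda>t. exp_poly {1..m} (\<lambda>k. \<tau> k \<xi>) (\<lambda>k. A j k \<xi>) (of_real t))" for \<xi>
    using E[OF j, of \<xi>] unfolding exp_poly_def A[OF j] .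
  interpret separated_root_group m L j P c \<tau> "A j" "nbhd \<epsilon> M"
    by unfold_locales (fact P roots E' L open_nbhd separated cont)+
  show ?thesis
    using smooth_localized_solution[OF chi] smooth_time_localized_solution[OF chi]
      localized_solution_bound[OF chi \<delta>(2) pq]
    by blast
qed

end
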